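(* Let $X\subseteq\mathbb{P}^n$ be an irreducible closed subvariety over $\mathbb{C}$ and let $F\in\mathbb{C}[x_0,\ldots,x_n]$ be a homogeneous polynomial of degree $\deg(F)\geq 1$ that does not vanish identically on $X$. For a generic linear form $u(x)=\sum_{i=0}^n u_ix_i$, let $f_{F,u}$ be the rational function on $X$ given by $F/u^{\deg(F)}$, and let $D_{F,u}:=\mathrm{Supp}(\mathrm{div}(f_{F,u}))\subseteq X$. Then for generic $u$, $\mathrm{MLD}_F(X)$ equals the number of critical points of $\log f_{F,u}$ away from $D_{F,u}$.
   Context: Work over $\mathbb{C}$. Let $C_X\subseteq\mathbb{C}^{n+1}$ be the affine cone over $X$, and let $C_X^\circ$ be the open subset of the smooth locus of $C_X$ where $F\neq 0$. For $u\in\mathbb{C}^{n+1}$, viewed as the linear form $u(x)=\sum_i u_ix_i$, put $\ell_{F,u}(x)=\log(F(x))-u(x)$. A critical point of $\ell_{F,u}|_{C_X^\circ}$ is a point of $C_X^\circ$ at which the restriction to $C_X^\circ$ of the $1$-form $\frac{dF}{F}-du$ vanishes. For generic $u$ (i.e. $u$ in a suitable nonempty Zariski open subset of $\mathbb{C}^{n+1}$) the set of critical points is finite, the scheme of critical points is reduced, and the number of critical points does not depend on $u$; this number is denoted $\mathrm{MLD}_F(X)$, the maximum likelihood degree of $F$ on $X$. Critical points are by definition smooth points of the variety: if $X_{\mathrm{sm}}$ denotes the smooth locus of $X$, the critical points of $\log f_{F,u}$ away from $D_{F,u}$ are the points of $X_{\mathrm{sm}}\setminus D_{F,u}$ at which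 the $1$-form $d\log f_{F,u}=df_{F,u}/f_{F,u}$ vanishes (rescaling $f_{F,u}$ by a nonzero constant does not change them). *)

theory Defs
  imports "HOL-Analysis.Analysis" "HOL-Library.Poly_Mapping" "HOL-Library.Extended_Nat"
begin

section \<open>Polynomials\<close>

text \<open>
  The finite type \<open>'n\<close> indexes the \<open>n + 1\<close> homogeneous coordinates, so \<open>complex ^ 'n\<close> is the affine
  space of dimension \<open>n + 1\<close>. A polynomial is a finitely supported map from exponent vectors to
  coefficients.
\<close>

type_synonym 'n cpoly = "('n \<Rightarrow>\<^sub>0 nat) \<Rightarrow>\<^sub>0 complex"

definition peval :: "'n::finite cpoly \<Rightarrow> complex ^ 'n \<Rightarrow> complex" where
  "peval p x = (\<Sum>m\<in>Poly_Mapping.keys p.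
     Poly_Mapping.lookup p m * (\<Prod>i\<in>UNIV. (x $ i) ^ Poly_Mapping.lookup m i))"

text \<open>The zero polynomial is homogeneous of every degree.\<close>

definition homogeneous_poly :: "nat \<Rightarrow> 'n::finite cpoly \<Rightarrow> bool" where
  "homogeneous_poly d p \<longleftrightarrow>
     (\<forall>m\<in>Poly_Mapping.keys p. (\<Sum>i\<in>UNIV. Poly_Mapping.lookup m i) = d)"

definition linear_poly :: "complex ^ 'n::finite \<Rightarrow> 'n cpoly" where
  "linear_poly u = (\<Sum>i\<in>UNIV. Poly_Mapping.single (Poly_Mapping.single i 1) (u $ i))"


section \<open>Affine algebraic sets\<close>

definition zariski_closed :: "(complex ^ 'n::finite) set \<Rightarrow> bool" where
  "zariski_closed V \<longleftrightarrow> (\<exists>S :: 'n cpoly set. V = {x. \<forall>p\<in>S. peval p x = 0})"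

definition zariski_irreducible :: "(complex ^ 'n::finite) set \<Rightarrow> bool" where
  "zariski_irreducible V \<longleftrightarrow> V \<noteq> {} \<and>
     (\<forall>A B. zariski_closed A \<longrightarrow> zariski_closed B \<longrightarrow> V \<subseteq> A \<union> B \<longrightarrow> V \<subseteq> A \<or> V \<subseteq> B)"

definition generically :: "(complex ^ 'n::finite \<Rightarrow> bool) \<Rightarrow> bool" where
  "generically P \<longleftrightarrow> (\<exists>U. zariski_closed (- U) \<and> U \<noteq> {} \<and> (\<forall>u\<in>U. P u))"

definition krull_dim :: "(complex ^ 'n::finite) set \<Rightarrow> enat" where
  "krull_dim V = Sup {enat k | k. \<exists>Z :: nat \<Rightarrow> (complex ^ 'n) set.
     (\<forall>j\<le>k. zariski_closed (Z j) \<and> zariski_irreducible (Z j) \<and> Z j \<subseteq> V) \<and>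
     (\<forall>j<k. Z j \<subset> Z (Suc j))}"

definition vanishing_ideal :: "(complex ^ 'n::finite) set \<Rightarrow> 'n cpoly set" where
  "vanishing_ideal V = {p. \<forall>x\<in>V. peval p x = 0}"

text \<open>
  The differential of a polynomial or rational function is its Frechet derivative; these functions
  are holomorphic, so the (a priori real-linear) derivative is complex linear.
\<close>

definition tangent_space :: "(complex ^ 'n::finite) set \<Rightarrow> complex ^ 'n \<Rightarrow> (complex ^ 'n) set" where
  "tangent_space V x = {v. \<forall>p\<in>vanishing_ideal V. frechet_derivative (peval p) (at x) v = 0}"

text \<open>
  The Jacobian criterion. It is only used for irreducible \<open>V\<close>, for which the local dimension is the
  same at all points.
\<close>

definition smooth_locus :: "(complex ^ 'n::finite) set \<Rightarrow> (complex ^ 'n) set" where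
  "smooth_locus V = {x \<in> V. enat (vec.dim (tangent_space V x)) = krull_dim V}"

definition dlog :: "(complex ^ 'n::finite \<Rightarrow> complex) \<Rightarrow> complex ^ 'n \<Rightarrow> complex ^ 'n \<Rightarrow> complex" where
  "dlog g x v = frechet_derivative g (at x) v / g x"


section \<open>Projective varieties\<close>

text \<open>A point of projective space is a line through the origin.\<close>

definition proj_space :: "(complex ^ 'n::finite) set set" where
  "proj_space = {vec.span {x} | x. x \<noteq> 0}"

definition proj_closed :: "(complex ^ 'n::finite) set set \<Rightarrow> bool" where
  "proj_closed X \<longleftrightarrow> (\<exists>S :: 'n cpoly set. (\<forall>p\<in>S. \<exists>e. homogeneous_poly e p) \<and>
     X = {L \<in> proj_space. \<forall>p\<in>S. \<forall>x\<in>L. peval p x = 0})"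

definition proj_irreducible :: "(complex ^ 'n::finite) set set \<Rightarrow> bool" where
  "proj_irreducible X \<longleftrightarrow> X \<noteq> {} \<and>
     (\<forall>A B. proj_closed A \<longrightarrow> proj_closed B \<longrightarrow> X \<subseteq> A \<union> B \<longrightarrow> X \<subseteq> A \<or> X \<subseteq> B)"

definition affine_cone :: "(complex ^ 'n::finite) set set \<Rightarrow> (complex ^ 'n) set" where
  "affine_cone X = insert 0 (\<Union>X)"

text \<open>
  The part of \<open>X\<close> where the \<open>i\<close>-th coordinate is nonzero, as a closed subvariety of the affine
  \<open>n\<close>-space \<open>{x. x $ i = 1}\<close>: the point \<open>L\<close> of \<open>X\<close> corresponds to the unique \<open>x \<in> L\<close> with \<open>x $ i = 1\<close>.
\<close>

definition affine_chart :: "(complex ^ 'n::finite) set set \<Rightarrow> 'n \<Rightarrow> (complex ^ 'n) set" where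
  "affine_chart X i = {x \<in> affine_cone X. x $ i = 1}"

definition proj_smooth_locus :: "(complex ^ 'n::finite) set set \<Rightarrow> (complex ^ 'n) set set" where
  "proj_smooth_locus X = {L \<in> X. \<exists>i. \<exists>x\<in>L. x \<in> smooth_locus (affine_chart X i)}"

text \<open>
  Let \<open>P\<close> and \<open>Q\<close> be homogeneous of the same degree and let \<open>Q\<close> not vanish identically on the
  irreducible \<open>X\<close>. The pairs \<open>(G, H)\<close> below are the ways of writing the rational function \<open>P/Q\<close> on
  \<open>X\<close> as a quotient \<open>G/H\<close> of homogeneous polynomials of the same degree that do not vanish at \<open>L\<close>.
  Such a pair exists iff \<open>P/Q\<close> is a unit of the local ring of \<open>X\<close> at \<open>L\<close>. Thus
  \<open>div_support X P Q\<close> is the support of the Cartier divisor of \<open>P/Q\<close>.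
\<close>

definition unit_reps ::
  "(complex ^ 'n::finite) set set \<Rightarrow> 'n cpoly \<Rightarrow> 'n cpoly \<Rightarrow> (complex ^ 'n) set \<Rightarrow> ('n cpoly \<times> 'n cpoly) set"
  where
  "unit_reps X P Q L = {(G, H). (\<exists>e. homogeneous_poly e G \<and> homogeneous_poly e H) \<and>
     (\<exists>x\<in>L. peval G x \<noteq> 0 \<and> peval H x \<noteq> 0) \<and>
     (\<forall>x\<in>affine_cone X. peval P x * peval H x = peval Q x * peval G x)}"

definition div_support ::
  "(complex ^ 'n::finite) set set \<Rightarrow> 'n cpoly \<Rightarrow> 'n cpoly \<Rightarrow> (complex ^ 'n) set set" where
  "div_support X P Q = {L \<in> X. unit_reps X P Q L = {}}"

text \<open>
  The points of the smooth locus away from the divisor at which the 1-form \<open>dlog (P/Q)\<close> vanishes.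
  The form is computed in an affine chart, from a local representation \<open>G/H\<close> of \<open>P/Q\<close>, by
  restriction to the tangent space of the chart; the result does not depend on these choices.
\<close>

definition log_critical_points ::
  "(complex ^ 'n::finite) set set \<Rightarrow> 'n cpoly \<Rightarrow> 'n cpoly \<Rightarrow> (complex ^ 'n) set set" where
  "log_critical_points X P Q = {L \<in> proj_smooth_locus X - div_support X P Q.
     \<exists>i. \<exists>x\<in>L. \<exists>(G, H)\<in>unit_reps X P Q L. x $ i = 1 \<and>
       (\<forall>v\<in>tangent_space (affine_chart X i) x. dlog (\<lambda>y. peval G y / peval H y) x v = 0)}"


section \<open>The maximum likelihood degree\<close>

definition cone_critical_points ::
  "'n::finite cpoly \<Rightarrow> (complex ^ 'n) set set \<Rightarrow> complex ^ 'n \<Rightarrow> (complex ^ 'n) set" where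
  "cone_critical_points F X u = {x \<in> smooth_locus (affine_cone X). peval F x \<noteq> 0 \<and>
     (\<forall>v\<in>tangent_space (affine_cone X) x.
        dlog (peval F) x v - frechet_derivative (peval (linear_poly u)) (at x) v = 0)}"

definition MLD :: "'n::finite cpoly \<Rightarrow> (complex ^ 'n) set set \<Rightarrow> nat" where
  "MLD F X = (THE N. generically (\<lambda>u.
     finite (cone_critical_points F X u) \<and> card (cone_critical_points F X u) = N))"

end

theory Submission
  imports Defs "HOL-Computational_Algebra.Fundamental_Theorem_Algebra"
begin

text \<open>
  Let \<open>C\<close> be the affine cone over \<open>X\<close>. For generic \<open>u\<close> the map \<open>x \<mapsto> span {x}\<close> is a bijection from the
  critical points of \<open>log F - u\<close> on \<open>C\<close> onto the critical points of \<open>log (F / u ^ d)\<close> on \<open>X\<close>. The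
  radial vector \<open>x\<close> is tangent to \<open>C\<close> at \<open>x\<close> and \<open>(dF / F) x = d\<close> by Euler's identity, so a critical
  point on the cone satisfies \<open>u(x) = d\<close>. On vectors tangent to a chart of \<open>X\<close> the form
  \<open>dlog (F / u ^ d)\<close> is \<open>dF / F - d du / u\<close>, which at a point with \<open>u(x) = d\<close> is \<open>dF / F - du\<close>; it
  vanishes on the radial vector in any case. Hence a critical line carries exactly one critical point
  of the cone, namely its point with \<open>u(x) = d\<close> (\<open>span_crit_log_critical\<close>,
  \<open>log_critical_span_crit\<close>, \<open>inj_on_span_crit\<close>).

  Two points of this comparison need an argument. Firstly, \<open>F / u ^ d\<close> could be a unit at a point where
  \<open>F\<close> and \<open>u\<close> both vanish. There \<open>u\<close> would vanish on a whole irreducible component, larger than the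
  origin, of the zero set of \<open>F\<close> in \<open>C\<close>, which a generic \<open>u\<close> does not (\<open>unit_rep_nonzero\<close>,
  \<open>generically_not_vanishing_on\<close>). Secondly, smooth points of \<open>X\<close> and of \<open>C\<close> have to correspond. The
  tangent space of the cone is that of the chart plus the radial line, so the Krull dimensions of
  cone and chart have to differ by one as well (\<open>krull_dim_chart\<close>).

  That follows from \<open>krull_dim_generic_tangent_dim\<close>: the Krull dimension of an irreducible closed set
  \<open>V\<close> is the dimension of its tangent space at a generic point. Both agree with the largest number
  of polynomial functions that are algebraically independent on \<open>V\<close>:
  \<^item> an independent family on a proper irreducible subset of \<open>V\<close> stays independent on \<open>V\<close> after a
    function vanishing on the subset is added, so chains are not longer than independent families
    (\<open>indep_extend\<close>);
  \<^item> fixing the value of one function of an independent family cuts out a smaller irreducible set on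
    which the others are independent, so every independent family gives a chain (\<open>indep_slice\<close>);
  \<^item> near a point with \<open>t\<close>-dimensional tangent space, \<open>V\<close> is a Lipschitz image of a subset of the
    \<open>t\<close>-dimensional space, while the values of an independent family contain an open set; so for
    generic points the family has at most \<open>t\<close> members (\<open>indep_le_generic_tangent_dim\<close>);
  \<^item> coordinates that restrict to coordinates of the generic tangent space are independent, because a
    relation between them could be differentiated until it becomes a constant (\<open>indep_transversal\<close>).

  Finally, \<open>MLD\<close> is given by a description operator, so the generic number of critical points of the
  cone has to be shown to exist (\<open>generic_card_crit\<close>). Projections of constructible sets are
  constructible (quantifier elimination, \<open>constructible_ex\<close>), and a constructible condition is
  generically true or generically false (\<open>generic_dichotomy\<close>). So for each \<open>k\<close> there are generically
  at least \<open>k\<close> critical points or generically fewer, and a generic upper bound is all that is missing.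
  The pairs \<open>(x, u)\<close> with \<open>x\<close> critical for \<open>u\<close> depend locally on as many parameters as \<open>u\<close> has
  coordinates: the coordinates of the tangent space for \<open>x\<close> and those of the conormal space for
  \<open>u - dF / F\<close>. Therefore the pairs \<open>(x $ i, u)\<close> form a null set (\<open>negligible_crit_image\<close>). Being
  constructible, it lies in a hypersurface \<open>g = 0\<close>, and for generic \<open>u\<close> the coordinate \<open>x $ i\<close> is
  one of the boundedly many roots of \<open>g(_, u)\<close>.
\<close>

section \<open>Algebras of functions and constructible predicates\<close>

text \<open>
  Polynomial expressions in the functions of \<open>A\<close>. They are treated as functions, so that the same
  lemmas serve polynomial functions on \<open>complex ^ 'n\<close> and on assignments of values to variables.
\<close>

inductive_set alg :: "('a \<Rightarrow> complex) set \<Rightarrow> ('a \<Rightarrow> complex) set" for A where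
  alg_const: "(\<lambda>_. c) \<in> alg A"
| alg_gen: "f \<in> A \<Longrightarrow> f \<in> alg A"
| alg_add: "f \<in> alg A \<Longrightarrow> g \<in> alg A \<Longrightarrow> (\<lambda>x. f x + g x) \<in> alg A"
| alg_mult: "f \<in> alg A \<Longrightarrow> g \<in> alg A \<Longrightarrow> (\<lambda>x. f x * g x) \<in> alg A"

lemma alg_diff:
  assumes "f \<in> alg A" "g \<in> alg A" shows "(\<lambda>x. f x - g x) \<in> alg A"
  using alg_add[OF assms(1) alg_mult[OF alg_const[of "-1"] assms(2)]] by simp

lemma alg_sum: "(\<And>i. i \<in> I \<Longrightarrow> f i \<in> alg A) \<Longrightarrow> (\<lambda>x. \<Sum>i\<in>I. f i x) \<in> alg A"
  by (induction I rule: infinite_finite_induct) (auto intro: alg_const alg_add)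

lemma alg_prod: "(\<And>i. i \<in> I \<Longrightarrow> f i \<in> alg A) \<Longrightarrow> (\<lambda>x. \<Prod>i\<in>I. f i x) \<in> alg A"
  by (induction I rule: infinite_finite_induct) (auto intro: alg_const alg_mult)

lemma alg_power: "f \<in> alg A \<Longrightarrow> (\<lambda>x. f x ^ n) \<in> alg A"
  by (induction n) (auto intro: alg_const alg_mult)

lemmas alg_intros = alg_const alg_add alg_mult alg_diff alg_sum alg_prod alg_power

lemma alg_compose:
  assumes "f \<in> alg A" "\<And>a. a \<in> A \<Longrightarrow> (\<lambda>x. a (h x)) \<in> alg B"
  shows "(\<lambda>x. f (h x)) \<in> alg B"
  using assms by (induction rule: alg.induct) (auto intro: alg_intros)

lemma alg_mono: "A \<subseteq> alg B \<Longrightarrow> f \<in> alg A \<Longrightarrow> f \<in> alg B"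
  using alg_compose[of f A "\<lambda>x. x" B] by auto

text \<open>
  Polynomials in one variable whose coefficients are functions of a parameter. The number \<open>d\<close> bounds
  the degree uniformly, since the leading coefficient may vanish for some parameters.
\<close>

definition polyfam :: "('a \<Rightarrow> complex) set \<Rightarrow> nat \<Rightarrow> ('a \<Rightarrow> complex poly) \<Rightarrow> bool" where
  "polyfam A d q \<longleftrightarrow> (\<forall>k. (\<lambda>e. coeff (q e) k) \<in> alg A) \<and> (\<forall>e. degree (q e) \<le> d)"

lemma polyfam_coeff: "polyfam A d q \<Longrightarrow> (\<lambda>e. coeff (q e) k) \<in> alg A"
  by (simp add: polyfam_def)

lemma polyfam_mono: "polyfam A d q \<Longrightarrow> d \<le> d' \<Longrightarrow> polyfam A d' q"
  unfolding polyfam_def using order_trans by blast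

lemma polyfam_add: "polyfam A d p \<Longrightarrow> polyfam A d q \<Longrightarrow> polyfam A d (\<lambda>e. p e + q e)"
  unfolding polyfam_def by (auto intro: alg_intros degree_add_le)

lemma polyfam_diff: "polyfam A d p \<Longrightarrow> polyfam A d q \<Longrightarrow> polyfam A d (\<lambda>e. p e - q e)"
  unfolding polyfam_def by (auto intro: alg_intros degree_diff_le)

lemma polyfam_mult: "polyfam A d p \<Longrightarrow> polyfam A d' q \<Longrightarrow> polyfam A (d + d') (\<lambda>e. p e * q e)"
  unfolding polyfam_def
  by (auto simp: coeff_mult intro!: alg_intros) (meson add_mono degree_mult_le order_trans)

lemma polyfam_monom:
  assumes "f \<in> alg A" shows "polyfam A n (\<lambda>e. monom (f e) n)"
proof -
  have "(\<lambda>e. coeff (monom (f e) n) k) \<in> alg A" for k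
    using assms by (cases "n = k") (auto intro: alg_const)
  then show ?thesis unfolding polyfam_def by (auto intro: degree_monom_le)
qed

lemma polyfam_const: "f \<in> alg A \<Longrightarrow> polyfam A 0 (\<lambda>e. [:f e:])"
  using polyfam_monom[of f A 0] by (simp add: monom_0)

lemma polyfam_power: "polyfam A d p \<Longrightarrow> polyfam A (n * d) (\<lambda>e. p e ^ n)"
proof (induction n)
  case 0
  then show ?case using polyfam_const[OF alg_const[of 1]] by (simp add: one_pCons)
next
  case (Suc n)
  then show ?case using polyfam_mult[OF Suc.prems, of "n * d" "\<lambda>e. p e ^ n"] by simp
qed

lemma polyfam_drop_lead:
  assumes "polyfam A d q" "d > 0" "\<And>e. coeff (q e) d = 0"
  shows "polyfam A (d - 1) q"
proof -
  have "degree (q e) \<le> d - 1" for e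
  proof (rule degree_le, intro allI impI)
    fix i assume "d - 1 < i"
    moreover have "degree (q e) \<le> d" using assms(1) by (simp add: polyfam_def)
    ultimately have "i = d \<or> degree (q e) < i" using assms(2) by linarith
    then show "coeff (q e) i = 0" using assms(3) coeff_eq_0 by blast
  qed
  then show ?thesis using assms unfolding polyfam_def by auto
qed

lemma polyfam_cancel_lead:
  assumes p: "polyfam A d p" and a: "polyfam A m a" and dm: "d \<le> m" and m: "m > 0"
  shows "polyfam A (m - 1) (\<lambda>e. [:coeff (p e) d:] * a e - monom (coeff (a e) m) (m - d) * p e)"
proof (rule polyfam_drop_lead[OF _ m])
  have "polyfam A (0 + m) (\<lambda>e. [:coeff (p e) d:] * a e)"
    by (rule polyfam_mult[OF polyfam_const[OF polyfam_coeff[OF p]] a])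
  moreover have "polyfam A ((m - d) + d) (\<lambda>e. monom (coeff (a e) m) (m - d) * p e)"
    by (rule polyfam_mult[OF polyfam_monom[OF polyfam_coeff[OF a]] p])
  ultimately show "polyfam A m (\<lambda>e. [:coeff (p e) d:] * a e - monom (coeff (a e) m) (m - d) * p e)"
    using dm polyfam_diff[of A m] by simp
  fix e
  show "coeff ([:coeff (p e) d:] * a e - monom (coeff (a e) m) (m - d) * p e) m = 0"
    using dm by (simp add: coeff_monom_mult)
qed

text \<open>
  Each step multiplies \<open>a\<close> by the leading coefficient of \<open>p\<close> instead of dividing by it, so that the
  coefficients of the remainder stay in the algebra.
\<close>

lemma pseudo_remainder_family:
  assumes p: "polyfam A d p" and d: "d > 0"
  shows "polyfam A m a \<Longrightarrow> \<exists>k r. polyfam A (d - 1) r \<and>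
           (\<forall>e. \<exists>s. [:coeff (p e) d ^ k:] * a e = p e * s + r e)"
proof (induction m arbitrary: a rule: less_induct)
  case (less m)
  show ?case
  proof (cases "m < d")
    case True
    then have "polyfam A (d - 1) a" using less.prems polyfam_mono by fastforce
    then show ?thesis by (intro exI[of _ 0] exI[of _ a]) (auto intro!: exI[of _ 0])
  next
    case False
    let ?a = "\<lambda>e. [:coeff (p e) d:] * a e - monom (coeff (a e) m) (m - d) * p e"
    have "polyfam A (m - 1) ?a" using polyfam_cancel_lead[OF p less.prems] False d by simp
    from less.IH[OF _ this] False d obtain k r where kr: "polyfam A (d - 1) r"
      "\<forall>e. \<exists>s. [:coeff (p e) d ^ k:] * ?a e = p e * s + r e" by fastforce
    have "\<exists>s. [:coeff (p e) d ^ Suc k:] * a e = p e * s + r e" for e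
    proof -
      obtain s where "[:coeff (p e) d ^ k:] * ?a e = p e * s + r e" using kr(2) by blast
      then have "[:coeff (p e) d ^ k:] * ([:coeff (p e) d:] * a e) =
          p e * (s + [:coeff (p e) d ^ k:] * monom (coeff (a e) m) (m - d)) + r e"
        by (simp add: algebra_simps)
      then have "[:coeff (p e) d ^ Suc k:] * a e =
          p e * (s + [:coeff (p e) d ^ k:] * monom (coeff (a e) m) (m - d)) + r e"
        by (simp add: mult.commute)
      then show ?thesis by blast
    qed
    then show ?thesis using kr(1) by blast
  qed
qed

inductive constructible :: "('a \<Rightarrow> complex) set \<Rightarrow> ('a \<Rightarrow> bool) \<Rightarrow> bool" for A where
  constructible_zero: "f \<in> alg A \<Longrightarrow> constructible A (\<lambda>e. f e = 0)"
| constructible_not: "constructible A Q \<Longrightarrow> constructible A (\<lambda>e. \<not> Q e)"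
| constructible_conj: "constructible A Q \<Longrightarrow> constructible A R \<Longrightarrow> constructible A (\<lambda>e. Q e \<and> R e)"

lemma constructible_disj: "constructible A Q \<Longrightarrow> constructible A R \<Longrightarrow> constructible A (\<lambda>e. Q e \<or> R e)"
  using constructible_not[OF constructible_conj[OF constructible_not[of A Q] constructible_not[of A R]]] by simp

lemma constructible_const: "constructible A (\<lambda>e. b)"
proof -
  have "constructible A (\<lambda>_. True)" using constructible_zero[OF alg_const[of 0 A]] by simp
  then show ?thesis using constructible_not[of A "\<lambda>_. True"] by (cases b) auto
qed

lemma constructible_ball:
  "finite I \<Longrightarrow> (\<And>i. i \<in> I \<Longrightarrow> constructible A (Q i)) \<Longrightarrow> constructible A (\<lambda>e. \<forall>i\<in>I. Q i e)"
  by (induction I rule: finite_induct) (auto intro: constructible_conj constructible_const)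

lemma constructible_bex:
  "finite I \<Longrightarrow> (\<And>i. i \<in> I \<Longrightarrow> constructible A (Q i)) \<Longrightarrow> constructible A (\<lambda>e. \<exists>i\<in>I. Q i e)"
  by (induction I rule: finite_induct) (auto intro: constructible_disj constructible_const)

lemma constructible_eq: "f \<in> alg A \<Longrightarrow> g \<in> alg A \<Longrightarrow> constructible A (\<lambda>e. f e = g e)"
  using constructible_zero[OF alg_diff[of f A g]] by simp

lemma constructible_compose:
  assumes "constructible A Q" "\<And>a. a \<in> A \<Longrightarrow> (\<lambda>x. a (h x)) \<in> alg B"
  shows "constructible B (\<lambda>x. Q (h x))"
  using assms by (induction rule: constructible.induct)
    (auto intro: constructible.intros constructible_zero[OF alg_compose])

text \<open>
  A disjunction of systems, each of finitely many equations and a single inequation; one inequation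
  suffices because the inequations of a system can be multiplied.
\<close>

definition dnf :: "(('a \<Rightarrow> complex) list \<times> ('a \<Rightarrow> complex)) list \<Rightarrow> 'a \<Rightarrow> bool" where
  "dnf L e \<longleftrightarrow> (\<exists>(ps, q)\<in>set L. (\<forall>p\<in>set ps. p e = 0) \<and> q e \<noteq> 0)"

definition dnf_over :: "('a \<Rightarrow> complex) set \<Rightarrow> (('a \<Rightarrow> complex) list \<times> ('a \<Rightarrow> complex)) list \<Rightarrow> bool" where
  "dnf_over A L \<longleftrightarrow> (\<forall>(ps, q)\<in>set L. set ps \<subseteq> alg A \<and> q \<in> alg A)"

lemma dnf_or: "dnf_over A L \<Longrightarrow> dnf_over A M \<Longrightarrow> \<exists>K. dnf_over A K \<and> dnf K = (\<lambda>e. dnf L e \<or> dnf M e)"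
  by (rule exI[of _ "L @ M"]) (auto simp: dnf_def[abs_def] dnf_over_def fun_eq_iff)

lemma dnf_and:
  assumes "dnf_over A L" "dnf_over A M"
  shows "\<exists>K. dnf_over A K \<and> dnf K = (\<lambda>e. dnf L e \<and> dnf M e)"
proof (intro exI conjI)
  let ?K = "map (\<lambda>((ps, q), (ps', q')). (ps @ ps', \<lambda>x. q x * q' x)) (List.product L M)"
  show "dnf_over A ?K" using assms unfolding dnf_over_def by (auto intro!: alg_mult) blast+
  show "dnf ?K = (\<lambda>e. dnf L e \<and> dnf M e)"
  proof (rule ext, rule iffI)
    fix e assume "dnf ?K e"
    then obtain ps q ps' q' where "(ps, q) \<in> set L" "(ps', q') \<in> set M"
      "\<forall>p\<in>set (ps @ ps'). p e = 0" "q e * q' e \<noteq> 0" unfolding dnf_def by auto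
    then show "dnf L e \<and> dnf M e" unfolding dnf_def
      by (intro conjI bexI[of _ "(ps, q)"] bexI[of _ "(ps', q')"]) auto
  next
    fix e assume "dnf L e \<and> dnf M e"
    then obtain ps q ps' q' where "(ps, q) \<in> set L" "\<forall>p\<in>set ps. p e = 0" "q e \<noteq> 0"
      "(ps', q') \<in> set M" "\<forall>p\<in>set ps'. p e = 0" "q' e \<noteq> 0" unfolding dnf_def by auto
    then have "(ps @ ps', \<lambda>x. q x * q' x) \<in> set ?K" "\<forall>p\<in>set (ps @ ps'). p e = 0" "q e * q' e \<noteq> 0"
      by (auto intro!: image_eqI[of _ _ "((ps, q), (ps', q'))"])
    then show "dnf ?K e" unfolding dnf_def by (intro bexI[of _ "(ps @ ps', \<lambda>x. q x * q' x)"]) auto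
  qed
qed

text \<open>
  Treating \<open>Q\<close> together with its negation lets the induction pass through negations; the negation
  of a conjunction only asks for \<open>dnf_or\<close>.
\<close>

lemma constructible_dnf:
  "constructible A Q \<Longrightarrow> (\<exists>L. dnf_over A L \<and> Q = dnf L) \<and> (\<exists>L. dnf_over A L \<and> (\<lambda>e. \<not> Q e) = dnf L)"
proof (induction rule: constructible.induct)
  case (constructible_zero f)
  then have "dnf_over A [([f], \<lambda>_. 1)]" "dnf_over A [([], f)]"
    by (auto simp: dnf_over_def alg_const)
  moreover have "(\<lambda>e. f e = 0) = dnf [([f], \<lambda>_. 1)]" "(\<lambda>e. \<not> f e = 0) = dnf [([], f)]"
    by (auto simp: dnf_def)
  ultimately show ?case by blast
next
  case (constructible_conj Q R)
  obtain L L' M M' where L: "dnf_over A L" "Q = dnf L" "dnf_over A L'" "(\<lambda>e. \<not> Q e) = dnf L'"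
    and M: "dnf_over A M" "R = dnf M" "dnf_over A M'" "(\<lambda>e. \<not> R e) = dnf M'"
    using constructible_conj.IH by blast
  have "\<exists>K. dnf_over A K \<and> (\<lambda>e. Q e \<and> R e) = dnf K" using dnf_and[OF L(1) M(1)] L(2) M(2) by auto
  moreover have "\<exists>K. dnf_over A K \<and> (\<lambda>e. \<not> (Q e \<and> R e)) = dnf K"
    using dnf_or[OF L(3) M(3)] L(4)[symmetric] M(4)[symmetric] by auto
  ultimately show ?case by blast
qed auto

lemma constructible_poly_nonzero:
  assumes "polyfam A d q"
  shows "constructible A (\<lambda>e. q e \<noteq> 0)"
proof -
  have "(\<lambda>e. q e \<noteq> 0) = (\<lambda>e. \<exists>k\<in>{..d}. \<not> coeff (q e) k = 0)"
  proof (rule ext, rule iffI)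
    fix e assume "q e \<noteq> 0"
    then show "\<exists>k\<in>{..d}. \<not> coeff (q e) k = 0" using assms unfolding polyfam_def
      by (intro bexI[of _ "degree (q e)"]) auto
  qed auto
  then show ?thesis using assms
    by (auto intro!: constructible_bex constructible_not constructible_zero intro: polyfam_coeff)
qed

definition root_avoiding :: "(('a \<Rightarrow> complex poly) \<times> nat) list \<Rightarrow> ('a \<Rightarrow> complex poly) \<Rightarrow> 'a \<Rightarrow> bool" where
  "root_avoiding ps q e \<longleftrightarrow> (\<exists>y. (\<forall>(p, d)\<in>set ps. poly (p e) y = 0) \<and> poly (q e) y \<noteq> 0)"

text \<open>
  The Euclidean algorithm, carried out uniformly in the parameter. If the leading coefficient of an
  equation vanishes, its degree bound drops. Otherwise it can be used to cancel the leading
  coefficient of an equation of higher degree bound. What remains is one equation \<open>p = 0\<close> of degree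
  \<open>d\<close>; it has a root at which \<open>q\<close> does not vanish iff \<open>p\<close> does not divide \<open>q ^ d\<close>, that is, iff the
  pseudo-remainder is not zero.
\<close>

lemma constructible_root_avoiding:
  assumes q: "polyfam A m q"
  shows "(\<forall>(p, d)\<in>set ps. polyfam A d p) \<Longrightarrow> constructible A (root_avoiding ps q)"
proof (induction "sum_list (map (\<lambda>(p, d). Suc d) ps)" arbitrary: ps rule: less_induct)
  case less
  define size :: "(('a \<Rightarrow> complex poly) \<times> nat) list \<Rightarrow> nat"
    where "size ps = sum_list (map (\<lambda>(p, d). Suc d) ps)" for ps
  define size0 where "size0 = size ps"
  have [simp]: "size [] = 0" "size ((p, d) # rest) = Suc d + size rest" for p d rest
    by (auto simp: size_def)
  have IH: "constructible A (root_avoiding qs q)"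
    if "\<forall>(p, d)\<in>set qs. polyfam A d p" "size qs < size0" for qs
    using less.hyps[of qs] that unfolding size_def size0_def by auto
  have sz: "size ps \<le> size0" by (simp add: size0_def)
  \<comment> \<open>Where the coefficient at the degree bound vanishes, that term can be dropped.\<close>
  have lead: "\<exists>R. constructible A R \<and> (\<forall>e. coeff (p e) d = 0 \<longrightarrow> root_avoiding ps q e = R e)"
    if ps: "ps = (p, d) # rest" and ok: "\<forall>(p, d)\<in>set ps. polyfam A d p" and sz: "size ps \<le> size0"
    for p d rest ps
  proof -
    have p: "polyfam A d p" using ok ps by auto
    show ?thesis
    proof (cases "d = 0")
      case True
      have "constructible A (root_avoiding rest q)" by (rule IH) (use ok sz ps in auto)
      moreover have "root_avoiding ps q e = root_avoiding rest q e" if "coeff (p e) d = 0" for e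
      proof -
        have "p e = 0" using p that True unfolding polyfam_def
          by (metis le_zero_eq leading_coeff_0_iff)
        then show ?thesis using ps by (auto simp: root_avoiding_def)
      qed
      ultimately show ?thesis by blast
    next
      case False
      let ?p = "\<lambda>e. p e - monom (coeff (p e) d) d"
      have "polyfam A (d - 1) ?p" using False
        by (intro polyfam_drop_lead polyfam_diff p polyfam_monom polyfam_coeff[OF p]) auto
      then have "constructible A (root_avoiding ((?p, d - 1) # rest) q)" by (intro IH) (use ok sz ps False in auto)
      moreover have "root_avoiding ps q e = root_avoiding ((?p, d - 1) # rest) q e" if "coeff (p e) d = 0" for e
        using that ps by (auto simp: root_avoiding_def)
      ultimately show ?thesis by blast
    qed
  qed
  have combine: "constructible A (root_avoiding ps q)"
    if ps: "ps = (p, d) # rest" and ok: "\<forall>(p, d)\<in>set ps. polyfam A d p" and sz: "size ps \<le> size0"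
      and R: "constructible A R"
      "\<And>e. coeff (p e) d \<noteq> 0 \<Longrightarrow> root_avoiding ps q e = R e" for p d rest R ps
  proof -
    obtain R0 where R0: "constructible A R0" "\<forall>e. coeff (p e) d = 0 \<longrightarrow> root_avoiding ps q e = R0 e"
      using lead[OF ps ok sz] by blast
    have p: "polyfam A d p" using ok ps by auto
    have "root_avoiding ps q = (\<lambda>e. (coeff (p e) d = 0 \<and> R0 e) \<or> (\<not> coeff (p e) d = 0 \<and> R e))"
      using R0(2) R(2) by auto
    then show ?thesis
      using R0(1) R(1) constructible_zero[OF polyfam_coeff[OF p, of d]]
      by (auto intro!: constructible_disj constructible_conj constructible_not)
  qed
  \<comment> \<open>Where that coefficient does not vanish, it reduces the second equation.\<close>
  have two: "constructible A (root_avoiding ps q)"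
    if ps: "ps = (p, d) # (p', d') # rest" "d \<le> d'"
      and ok: "\<forall>(p, d)\<in>set ps. polyfam A d p" and sz: "size ps \<le> size0" for p d p' d' rest ps
  proof -
    have p: "polyfam A d p" "polyfam A d' p'" using ok ps by auto
    show ?thesis
    proof (cases "d' = 0")
      case True
      show ?thesis
      proof (rule combine[OF ps(1) ok sz constructible_const[of A False]])
        fix e assume c: "coeff (p e) d \<noteq> 0"
        have "degree (p e) = 0" "d = 0" using p True ps(2) unfolding polyfam_def by auto
        then have "poly (p e) y \<noteq> 0" for y using c by (metis degree_eq_zeroE coeff_pCons_0 poly_const_conv)
        then show "root_avoiding ps q e = False" using ps(1) by (auto simp: root_avoiding_def)
      qed
    next
      case False
      let ?p = "\<lambda>e. [:coeff (p e) d:] * p' e - monom (coeff (p' e) d') (d' - d) * p e"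
      let ?ps = "(p, d) # (?p, d' - 1) # rest"
      have "polyfam A (d' - 1) ?p" using False polyfam_cancel_lead[OF p ps(2)] by simp
      then have C: "constructible A (root_avoiding ?ps q)"
        by (intro IH) (use ok sz ps False in auto)
      show ?thesis
      proof (rule combine[OF ps(1) ok sz C])
        fix e assume c: "coeff (p e) d \<noteq> 0"
        show "root_avoiding ps q e = root_avoiding ?ps q e"
          unfolding root_avoiding_def ps(1) using c by auto
      qed
    qed
  qed
  show ?case
  proof (cases ps)
    case Nil
    have "root_avoiding ps q = (\<lambda>e. q e \<noteq> 0)"
      unfolding root_avoiding_def Nil using poly_all_0_iff_0 by fastforce
    then show ?thesis using constructible_poly_nonzero[OF q] by simp
  next
    case (Cons x rest)
    obtain p d where x: "x = (p, d)" by (cases x)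
    have p: "polyfam A d p" using less.prems Cons x by auto
    show ?thesis
    proof (cases rest)
      case Nil
      with Cons x have ps: "ps = [(p, d)]" by simp
      have dvd: "root_avoiding ps q e \<longleftrightarrow> \<not> p e dvd q e ^ d" if "coeff (p e) d \<noteq> 0" for e
      proof -
        have "degree (p e) = d" "p e \<noteq> 0"
          using that p le_degree[OF that] unfolding polyfam_def by (auto intro: antisym)
        then show ?thesis unfolding root_avoiding_def ps
          using nullstellensatz_univariate[of "p e" "q e"] by auto
      qed
      show ?thesis
      proof (cases "d = 0")
        case True
        show ?thesis
        proof (rule combine[OF ps less.prems sz constructible_const[of A False]])
          fix e assume c: "coeff (p e) d \<noteq> 0"
          have "degree (p e) = 0" "p e \<noteq> 0" using c True p unfolding polyfam_def by auto
          then have "is_unit (p e)" by (simp add: is_unit_iff_degree)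
          then show "root_avoiding ps q e = False" using dvd[OF c] True by simp
        qed
      next
        case False
        obtain k r where r: "polyfam A (d - 1) r"
            "\<forall>e. \<exists>s. [:coeff (p e) d ^ k:] * q e ^ d = p e * s + r e"
          using pseudo_remainder_family[OF p _ polyfam_power[OF q, of d]] False by blast
        show ?thesis
        proof (rule combine[OF ps less.prems sz constructible_poly_nonzero[OF r(1)]])
          fix e assume c: "coeff (p e) d \<noteq> 0"
          obtain s where s: "[:coeff (p e) d ^ k:] * q e ^ d = p e * s + r e" using r(2) by blast
          have "degree (p e) = d" using le_degree[OF c] p unfolding polyfam_def by (auto intro: antisym)
          have "degree (r e) \<le> d - 1" using r(1) by (simp add: polyfam_def)
          then have "degree (r e) < d" using False by linarith
          have "p e dvd q e ^ d \<longleftrightarrow> p e dvd [:coeff (p e) d ^ k:] * q e ^ d"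
            using c by (simp add: dvd_smult_iff)
          also have "\<dots> \<longleftrightarrow> p e dvd r e" unfolding s by (simp add: dvd_add_right_iff)
          also have "\<dots> \<longleftrightarrow> r e = 0"
            using \<open>degree (r e) < d\<close> \<open>degree (p e) = d\<close> dvd_imp_degree_le[of "p e" "r e"] by auto
          finally show "root_avoiding ps q e = (r e \<noteq> 0)" using dvd[OF c] by blast
        qed
      qed
    next
      case (Cons x' rest')
      obtain p' d' where x': "x' = (p', d')" by (cases x')
      have ps: "ps = (p, d) # (p', d') # rest'" using Cons x' \<open>ps = x # rest\<close> x by simp
      show ?thesis
      proof (cases "d \<le> d'")
        case True
        then show ?thesis using two[OF ps _ less.prems sz] by auto
      next
        case False
        let ?qs = "(p', d') # (p, d) # rest'"
        have "constructible A (root_avoiding ?qs q)"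
          by (rule two[OF refl]) (use False less.prems sz ps in auto)
        moreover have "root_avoiding ?qs q = root_avoiding ps q"
          unfolding root_avoiding_def ps by auto
        ultimately show ?thesis by simp
      qed
    qed
  qed
qed


section \<open>Quantifier elimination\<close>

text \<open>
  The variables, as functions on the assignments of values to them.
\<close>

definition coords :: "(('v \<Rightarrow> complex) \<Rightarrow> complex) set" where
  "coords = range (\<lambda>v e. e v)"

lemma alg_coord [intro, simp]: "(\<lambda>e. e v) \<in> alg coords"
  by (intro alg_gen) (auto simp: coords_def)

lemma alg_coords_polyfam:
  assumes "f \<in> alg (coords :: (('v \<Rightarrow> complex) \<Rightarrow> complex) set)"
  shows "\<exists>d q. polyfam coords d q \<and> (\<forall>e y. f (e(v := y)) = poly (q e) y)"
  using assms
proof (induction rule: alg.induct)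
  case (alg_const c)
  have "polyfam coords 0 (\<lambda>_ :: 'v \<Rightarrow> complex. [:c:])"
    by (intro polyfam_const alg.alg_const)
  then show ?case by (intro exI[of _ 0] exI[of _ "\<lambda>_. [:c:]"]) auto
next
  case (alg_gen f)
  then obtain w where f: "f = (\<lambda>e. e w)" by (auto simp: coords_def)
  show ?case
  proof (cases "w = v")
    case True
    have "polyfam coords 1 (\<lambda>_ :: 'v \<Rightarrow> complex. monom 1 1)"
      by (intro polyfam_monom alg.alg_const)
    then show ?thesis using f True by (intro exI[of _ 1] exI[of _ "\<lambda>_. monom 1 1"]) (auto simp: poly_monom)
  next
    case False
    have "polyfam coords 0 (\<lambda>e :: 'v \<Rightarrow> complex. [:e w:])"
      by (intro polyfam_const) auto
    then show ?thesis using f False by (intro exI[of _ 0] exI[of _ "\<lambda>e. [:e w:]"]) auto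
  qed
next
  case (alg_add f g)
  then obtain d p d' q where pq: "polyfam coords d p" "\<forall>e y. f (e(v := y)) = poly (p e) y"
    "polyfam coords d' q" "\<forall>e y. g (e(v := y)) = poly (q e) y" by blast
  have "polyfam coords (max d d') (\<lambda>e. p e + q e)"
    by (intro polyfam_add polyfam_mono[OF pq(1)] polyfam_mono[OF pq(3)]) auto
  then show ?case using pq by (intro exI[of _ "max d d'"] exI[of _ "\<lambda>e. p e + q e"]) (auto simp del: fun_upd_apply)
next
  case (alg_mult f g)
  then obtain d p d' q where pq: "polyfam coords d p" "\<forall>e y. f (e(v := y)) = poly (p e) y"
    "polyfam coords d' q" "\<forall>e y. g (e(v := y)) = poly (q e) y" by blast
  have "polyfam coords (d + d') (\<lambda>e. p e * q e)"
    by (intro polyfam_mult pq)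
  then show ?case using pq by (intro exI[of _ "d + d'"] exI[of _ "\<lambda>e. p e * q e"]) (auto simp del: fun_upd_apply)
qed

text \<open>
  Chevalley's theorem for the projection along one variable: in each system of the normal form the
  equations and the inequation are families of polynomials in that variable.
\<close>

lemma constructible_ex1:
  assumes "constructible coords Q"
  shows "constructible coords (\<lambda>e. \<exists>y. Q (e(v := y)))"
proof -
  obtain L where L: "dnf_over coords L" "Q = dnf L" using constructible_dnf[OF assms] by blast
  have "constructible coords (\<lambda>e. \<exists>y. (\<forall>p\<in>set ps. p (e(v := y)) = 0) \<and> q (e(v := y)) \<noteq> 0)"
    if "(ps, q) \<in> set L" for ps q
  proof -
    have "p \<in> alg coords" if "p \<in> insert q (set ps)" for p
      using that \<open>(ps, q) \<in> set L\<close> L(1) unfolding dnf_over_def by auto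
    then have ex: "\<exists>x. polyfam coords (fst x) (snd x) \<and> (\<forall>e y. p (e(v := y)) = poly (snd x e) y)"
      if "p \<in> insert q (set ps)" for p
      using alg_coords_polyfam[of p v] that by auto
    define D R where "D p = fst (SOME x. polyfam coords (fst x) (snd x) \<and> (\<forall>e y. p (e(v := y)) = poly (snd x e) y))"
      and "R p = snd (SOME x. polyfam coords (fst x) (snd x) \<and> (\<forall>e y. p (e(v := y)) = poly (snd x e) y))" for p
    have DR: "polyfam coords (D p) (R p)" "p (e(v := y)) = poly (R p e) y"
      if "p \<in> insert q (set ps)" for p e y
      using someI_ex[OF ex[OF that]] unfolding D_def R_def by blast+
    let ?ps = "map (\<lambda>p. (R p, D p)) ps"
    have "constructible coords (root_avoiding ?ps (R q))"
      by (rule constructible_root_avoiding[of _ "D q"]) (use DR(1) in auto)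
    moreover have "root_avoiding ?ps (R q) =
        (\<lambda>e. \<exists>y. (\<forall>p\<in>set ps. p (e(v := y)) = 0) \<and> q (e(v := y)) \<noteq> 0)"
    proof (rule ext)
      fix e
      have "(\<forall>(p, d)\<in>set ?ps. poly (p e) y = 0) \<longleftrightarrow> (\<forall>p\<in>set ps. p (e(v := y)) = 0)" for y
        using DR(2) by (simp del: fun_upd_apply)
      then show "root_avoiding ?ps (R q) e =
          (\<exists>y. (\<forall>p\<in>set ps. p (e(v := y)) = 0) \<and> q (e(v := y)) \<noteq> 0)"
        using DR(2)[of q] unfolding root_avoiding_def by simp
    qed
    ultimately show ?thesis by simp
  qed
  then have "constructible coords (\<lambda>e. \<exists>(ps, q)\<in>set L. \<exists>y. (\<forall>p\<in>set ps. p (e(v := y)) = 0) \<and> q (e(v := y)) \<noteq> 0)"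
    by (intro constructible_bex) (auto simp: case_prod_beta)
  moreover have "(\<lambda>e. \<exists>(ps, q)\<in>set L. \<exists>y. (\<forall>p\<in>set ps. p (e(v := y)) = 0) \<and> q (e(v := y)) \<noteq> 0)
      = (\<lambda>e. \<exists>y. Q (e(v := y)))"
    unfolding L(2) dnf_def by (auto simp: case_prod_beta)
  ultimately show ?thesis by simp
qed

lemma constructible_ex:
  assumes "finite B" "constructible coords Q"
  shows "constructible coords (\<lambda>e. \<exists>e'. (\<forall>v. v \<notin> B \<longrightarrow> e' v = e v) \<and> Q e')"
  using assms
proof (induction B rule: finite_induct)
  case empty
  have "(\<lambda>e. \<exists>e'. (\<forall>v. e' v = e v) \<and> Q e') = Q" by (simp add: fun_eq_iff[symmetric])
  then show ?case using empty by simp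
next
  case (insert b B)
  let ?R = "\<lambda>e. \<exists>e'. (\<forall>v. v \<notin> B \<longrightarrow> e' v = e v) \<and> Q e'"
  have "(\<lambda>e. \<exists>e'. (\<forall>v. v \<notin> insert b B \<longrightarrow> e' v = e v) \<and> Q e') = (\<lambda>e. \<exists>y. ?R (e(b := y)))"
  proof (rule ext, rule iffI)
    fix e assume "\<exists>e'. (\<forall>v. v \<notin> insert b B \<longrightarrow> e' v = e v) \<and> Q e'"
    then obtain e' where "\<forall>v. v \<notin> insert b B \<longrightarrow> e' v = e v" "Q e'" by blast
    then show "\<exists>y. ?R (e(b := y))" by (intro exI[of _ "e' b"] exI[of _ e']) auto
  next
    fix e assume "\<exists>y. ?R (e(b := y))"
    then obtain y e' where "\<forall>v. v \<notin> B \<longrightarrow> e' v = (e(b := y)) v" "Q e'" by blast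
    then show "\<exists>e'. (\<forall>v. v \<notin> insert b B \<longrightarrow> e' v = e v) \<and> Q e'"
      by (intro exI[of _ e']) auto
  qed
  then show ?case using constructible_ex1[OF insert.IH[OF insert.prems], of b] by simp
qed

section \<open>Generic truth\<close>

lemma alg_on_line:
  assumes "f \<in> alg (coords :: (('v \<Rightarrow> complex) \<Rightarrow> complex) set)"
  shows "\<exists>q. \<forall>s. f (\<lambda>v. a v + s * b v) = poly q s"
  using assms
proof (induction rule: alg.induct)
  case (alg_const c)
  show ?case by (rule exI[of _ "[:c:]"]) simp
next
  case (alg_gen f)
  then obtain w where f: "f = (\<lambda>e. e w)" by (auto simp: coords_def)
  show ?case by (rule exI[of _ "[:a w, b w:]"]) (simp add: f)
next
  case (alg_add f g)
  then obtain p q where "\<forall>s. f (\<lambda>v. a v + s * b v) = poly p s" "\<forall>s. g (\<lambda>v. a v + s * b v) = poly q s" by blast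
  then show ?case by (intro exI[of _ "p + q"]) simp
next
  case (alg_mult f g)
  then obtain p q where "\<forall>s. f (\<lambda>v. a v + s * b v) = poly p s" "\<forall>s. g (\<lambda>v. a v + s * b v) = poly q s" by blast
  then show ?case by (intro exI[of _ "p * q"]) simp
qed

text \<open>
  On the line through \<open>a\<close> and \<open>b\<close> both functions are nonzero polynomials in one variable.
\<close>

lemma alg_coords_domain:
  assumes f: "f \<in> alg (coords :: (('v \<Rightarrow> complex) \<Rightarrow> complex) set)" and g: "g \<in> alg coords"
    and "f a \<noteq> 0" "g b \<noteq> 0"
  shows "\<exists>e. f e * g e \<noteq> 0"
proof -
  obtain p q where p: "\<forall>s. f (\<lambda>v. a v + s * (b v - a v)) = poly p s"
    and q: "\<forall>s. g (\<lambda>v. a v + s * (b v - a v)) = poly q s"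
    using alg_on_line[OF f, of a "\<lambda>v. b v - a v"] alg_on_line[OF g, of a "\<lambda>v. b v - a v"] by blast
  have "poly p 0 \<noteq> 0" "poly q 1 \<noteq> 0"
    using p[rule_format, of 0] q[rule_format, of 1] assms(3,4) by auto
  then have "p * q \<noteq> 0" by auto
  then obtain s where "poly (p * q) s \<noteq> 0" using poly_all_0_iff_0 by blast
  then show ?thesis using p q by (metis poly_mult)
qed

text \<open>
  Truth on a principal open subset that meets \<open>V\<close>. For irreducible \<open>V\<close> such subsets are dense in \<open>V\<close>.
\<close>

definition generic_on :: "('a \<Rightarrow> complex) set \<Rightarrow> 'a set \<Rightarrow> ('a \<Rightarrow> bool) \<Rightarrow> bool" where
  "generic_on A V Q \<longleftrightarrow> (\<exists>h\<in>alg A. (\<exists>x\<in>V. h x \<noteq> 0) \<and> (\<forall>x\<in>V. h x \<noteq> 0 \<longrightarrow> Q x))"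

text \<open>
  Irreducibility of \<open>V\<close> in terms of functions: those vanishing on \<open>V\<close> form a prime ideal. In this form
  it says directly that two principal open subsets that meet \<open>V\<close> have a common point in \<open>V\<close>.
\<close>

definition prime_on :: "('a \<Rightarrow> complex) set \<Rightarrow> 'a set \<Rightarrow> bool" where
  "prime_on A V \<longleftrightarrow> V \<noteq> {} \<and> (\<forall>f\<in>alg A. \<forall>g\<in>alg A. (\<forall>x\<in>V. f x * g x = 0) \<longrightarrow>
     (\<forall>x\<in>V. f x = 0) \<or> (\<forall>x\<in>V. g x = 0))"

lemma prime_onD:
  assumes "prime_on A V" "f \<in> alg A" "g \<in> alg A" "\<And>x. x \<in> V \<Longrightarrow> f x * g x = 0"
  shows "(\<forall>x\<in>V. f x = 0) \<or> (\<forall>x\<in>V. g x = 0)"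
  using assms unfolding prime_on_def by blast

lemma prime_on_coords: "prime_on (coords :: (('v \<Rightarrow> complex) \<Rightarrow> complex) set) UNIV"
  unfolding prime_on_def using alg_coords_domain by (metis UNIV_I empty_not_UNIV)

lemma generic_on_conj:
  assumes "prime_on A V" "generic_on A V Q" "generic_on A V R"
  shows "generic_on A V (\<lambda>x. Q x \<and> R x)"
proof -
  obtain f g where "f \<in> alg A" "\<exists>x\<in>V. f x \<noteq> 0" "\<forall>x\<in>V. f x \<noteq> 0 \<longrightarrow> Q x"
    "g \<in> alg A" "\<exists>x\<in>V. g x \<noteq> 0" "\<forall>x\<in>V. g x \<noteq> 0 \<longrightarrow> R x"
    using assms unfolding generic_on_def by blast
  moreover from this have "\<exists>x\<in>V. f x * g x \<noteq> 0" using assms(1) unfolding prime_on_def by blast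
  ultimately show ?thesis unfolding generic_on_def by (intro bexI[of _ "\<lambda>x. f x * g x"] alg_mult) auto
qed

lemma generic_on_mono:
  "generic_on A V Q \<Longrightarrow> (\<And>x. x \<in> V \<Longrightarrow> Q x \<Longrightarrow> R x) \<Longrightarrow> generic_on A V R"
  unfolding generic_on_def by meson

lemma generic_on_ex: "generic_on A V Q \<Longrightarrow> \<exists>x\<in>V. Q x"
  unfolding generic_on_def by blast

lemma generic_on_always:
  assumes "prime_on A V" "\<And>x. x \<in> V \<Longrightarrow> Q x" shows "generic_on A V Q"
proof -
  obtain x where "x \<in> V" using assms(1) unfolding prime_on_def by blast
  then show ?thesis unfolding generic_on_def using assms(2)
    by (intro bexI[OF _ alg_const[of 1]]) auto
qed

lemma generic_on_ball:
  assumes "prime_on A V" "finite I" "\<And>i. i \<in> I \<Longrightarrow> generic_on A V (Q i)"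
  shows "generic_on A V (\<lambda>x. \<forall>i\<in>I. Q i x)"
  using assms(2,3)
proof (induction I rule: finite_induct)
  case empty
  then show ?case using generic_on_always[OF assms(1)] by auto
next
  case (insert i I)
  then show ?case using generic_on_conj[OF assms(1), of "Q i" "\<lambda>x. \<forall>i\<in>I. Q i x"] by auto
qed

text \<open>
  An equation \<open>f = 0\<close> holds on all of \<open>V\<close> or fails on the principal open subset of \<open>f\<close>, and the
  predicates that are decided generically are closed under negation and conjunction.
\<close>

lemma generic_dichotomy:
  assumes "prime_on A V" "constructible A Q"
  shows "generic_on A V Q \<or> generic_on A V (\<lambda>x. \<not> Q x)"
  using assms(2)
proof (induction rule: constructible.induct)
  case (constructible_zero f)
  show ?case
  proof (cases "\<forall>x\<in>V. f x = 0")
    case True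
    then show ?thesis using generic_on_always[OF assms(1)] by auto
  next
    case False
    then have "generic_on A V (\<lambda>x. f x \<noteq> 0)" unfolding generic_on_def
      by (intro bexI[OF _ constructible_zero]) auto
    then show ?thesis by blast
  qed
next
  case (constructible_conj Q R)
  show ?case
  proof (cases "generic_on A V Q \<and> generic_on A V R")
    case True
    then show ?thesis using generic_on_conj[OF assms(1)] by blast
  next
    case False
    then have "generic_on A V (\<lambda>x. \<not> Q x) \<or> generic_on A V (\<lambda>x. \<not> R x)"
      using constructible_conj.IH by blast
    then have "generic_on A V (\<lambda>x. \<not> (Q x \<and> R x))"
    proof
      assume "generic_on A V (\<lambda>x. \<not> Q x)"
      then show ?thesis by (rule generic_on_mono) blast
    next
      assume "generic_on A V (\<lambda>x. \<not> R x)"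
      then show ?thesis by (rule generic_on_mono) blast
    qed
    then show ?thesis by blast
  qed
qed auto

section \<open>Hilbert's basis theorem\<close>

text \<open>
  The ideal generated by \<open>J\<close> in \<open>R\<close>, as the set of sums of multiples of members of \<open>J\<close>.
\<close>

inductive_set idl :: "('a \<Rightarrow> complex) set \<Rightarrow> ('a \<Rightarrow> complex) set \<Rightarrow> ('a \<Rightarrow> complex) set" for R J where
  idl_zero: "(\<lambda>_. 0) \<in> idl R J"
| idl_step: "r \<in> R \<Longrightarrow> j \<in> J \<Longrightarrow> f \<in> idl R J \<Longrightarrow> (\<lambda>x. r x * j x + f x) \<in> idl R J"

lemma idl_gen: "j \<in> J \<Longrightarrow> j \<in> idl (alg A) J"
  using idl_step[OF alg_const[of 1 A] _ idl_zero, of j J] by simp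

lemma idl_mult:
  assumes "r \<in> alg A" "f \<in> idl (alg A) J"
  shows "(\<lambda>x. r x * f x) \<in> idl (alg A) J"
  using assms(2)
proof (induction rule: idl.induct)
  case idl_zero
  then show ?case by (simp add: idl.idl_zero)
next
  case (idl_step s j f)
  have "(\<lambda>x. (r x * s x) * j x + r x * f x) \<in> idl (alg A) J"
    by (rule idl.idl_step[OF alg_mult[OF assms(1) idl_step(1)] idl_step(2,4)])
  then show ?case by (simp add: algebra_simps)
qed

lemma idl_add:
  assumes "f \<in> idl R J" "g \<in> idl R J"
  shows "(\<lambda>x. f x + g x) \<in> idl R J"
  using assms(1)
proof (induction rule: idl.induct)
  case idl_zero
  then show ?case using assms(2) by simp
next
  case (idl_step s j f)
  have "(\<lambda>x. s x * j x + (f x + g x)) \<in> idl R J"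
    by (rule idl.idl_step[OF idl_step(1,2,4)])
  then show ?case by (simp add: algebra_simps)
qed

lemma idl_diff:
  assumes "f \<in> idl (alg A) J" "g \<in> idl (alg A) J"
  shows "(\<lambda>x. f x - g x) \<in> idl (alg A) J"
  using idl_add[OF assms(1) idl_mult[OF alg_const[of "-1"] assms(2)]] by simp

lemma idl_trans:
  assumes "f \<in> idl (alg A) J" "J \<subseteq> idl (alg A) K"
  shows "f \<in> idl (alg A) K"
  using assms(1)
proof (induction rule: idl.induct)
  case (idl_step r j f)
  then show ?case using assms(2) by (intro idl_add idl_mult) auto
qed (rule idl.idl_zero)

lemma idl_mono: "J \<subseteq> K \<Longrightarrow> f \<in> idl (alg A) J \<Longrightarrow> f \<in> idl (alg A) K"
  using idl_trans[of f A J K] idl_gen by blast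

lemma idl_alg: "J \<subseteq> alg A \<Longrightarrow> f \<in> idl (alg A) J \<Longrightarrow> f \<in> alg A"
  by (rotate_tac 1, induction rule: idl.induct) (auto intro!: alg_intros)

lemma idl_finite:
  assumes "f \<in> idl (alg A) J"
  shows "\<exists>J0\<subseteq>J. finite J0 \<and> f \<in> idl (alg A) J0"
  using assms
proof (induction rule: idl.induct)
  case idl_zero
  show ?case by (intro exI[of _ "{}"]) (auto intro: idl.idl_zero)
next
  case (idl_step r j f)
  then obtain J0 where J0: "J0 \<subseteq> J" "finite J0" "f \<in> idl (alg A) J0" by blast
  have "(\<lambda>x. r x * j x + f x) \<in> idl (alg A) (insert j J0)"
    by (intro idl.idl_step idl_step(1) idl_mono[OF _ J0(3)]) auto
  then show ?case using J0 idl_step(2) by (intro exI[of _ "insert j J0"]) auto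
qed

definition noetherian :: "('a \<Rightarrow> complex) set \<Rightarrow> bool" where
  "noetherian R \<longleftrightarrow> (\<forall>I\<subseteq>R. \<exists>J\<subseteq>I. finite J \<and> I \<subseteq> idl R J)"

lemma alg_empty: "f \<in> alg {} \<Longrightarrow> \<exists>c. f = (\<lambda>_. c)"
  by (induction rule: alg.induct) auto

lemma noetherian_constants: "noetherian (alg {})"
  unfolding noetherian_def
proof (intro allI impI)
  fix I :: "('a \<Rightarrow> complex) set" assume I: "I \<subseteq> alg {}"
  show "\<exists>J\<subseteq>I. finite J \<and> I \<subseteq> idl (alg {}) J"
  proof (cases "I \<subseteq> {\<lambda>_. 0}")
    case True
    then show ?thesis by (intro exI[of _ "{}"]) (auto intro: idl_zero)
  next
    case False
    then obtain c where c: "(\<lambda>_. c) \<in> I" "c \<noteq> 0" using I alg_empty by fastforce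
    have "f \<in> idl (alg {}) {\<lambda>_. c}" if f: "f \<in> I" for f
    proof -
      obtain b where "f = (\<lambda>_. b)" using f I alg_empty by blast
      then show ?thesis
        using idl_step[OF alg_const[of "b / c" "{}"] _ idl_zero, of "\<lambda>_. c" "{\<lambda>_. c}"] c(2) by simp
    qed
    then show ?thesis using c by (intro exI[of _ "{\<lambda>_. c}"]) auto
  qed
qed

text \<open>
  The value at \<open>a\<close> of the polynomial with coefficient functions \<open>c\<close> and formal degree \<open>d\<close>. Different
  \<open>c\<close> can give the same function, for \<open>a\<close> may satisfy algebraic equations over \<open>A\<close>. Leading
  coefficients therefore belong to a presentation of a function, not to the function.
\<close>

definition poly_in :: "('a \<Rightarrow> complex) \<Rightarrow> nat \<Rightarrow> (nat \<Rightarrow> 'a \<Rightarrow> complex) \<Rightarrow> 'a \<Rightarrow> complex" where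
  "poly_in a d c = (\<lambda>x. \<Sum>k\<le>d. c k x * a x ^ k)"

lemma poly_in_mono:
  assumes "d \<le> d'" shows "poly_in a d c = poly_in a d' (\<lambda>k. if k \<le> d then c k else (\<lambda>_. 0))"
proof (rule ext)
  fix x
  show "poly_in a d c x = poly_in a d' (\<lambda>k. if k \<le> d then c k else (\<lambda>_. 0)) x"
    unfolding poly_in_def by (rule sum.mono_neutral_cong_left) (use assms in auto)
qed

lemma poly_in_mult:
  "(\<lambda>x. poly_in a d c x * poly_in a d' c' x) =
     poly_in a (d + d') (\<lambda>n x. \<Sum>(i, j)\<in>{(i, j). i \<le> d \<and> j \<le> d' \<and> i + j = n}. c i x * c' j x)"
proof (rule ext)
  fix x
  have "poly_in a d c x * poly_in a d' c' x = (\<Sum>(i, j)\<in>{..d} \<times> {..d'}. (c i x * c' j x) * a x ^ (i + j))"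
    unfolding poly_in_def sum_product sum.cartesian_product by (simp add: power_add algebra_simps)
  also have "\<dots> = (\<Sum>n\<in>{..d + d'}. \<Sum>(i, j)\<in>{p \<in> {..d} \<times> {..d'}. fst p + snd p = n}. (c i x * c' j x) * a x ^ (i + j))"
    by (rule sum.group[symmetric]) auto
  also have "\<dots> = (\<Sum>n\<le>d + d'. (\<Sum>(i, j)\<in>{(i, j). i \<le> d \<and> j \<le> d' \<and> i + j = n}. c i x * c' j x) * a x ^ n)"
    unfolding sum_distrib_right by (intro sum.cong) auto
  finally show "poly_in a d c x * poly_in a d' c' x =
     poly_in a (d + d') (\<lambda>n x. \<Sum>(i, j)\<in>{(i, j). i \<le> d \<and> j \<le> d' \<and> i + j = n}. c i x * c' j x) x"
    unfolding poly_in_def .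
qed

lemma alg_insert_poly_in:
  assumes "f \<in> alg (insert a A)"
  shows "\<exists>d c. (\<forall>k. c k \<in> alg A) \<and> f = poly_in a d c"
  using assms
proof (induction rule: alg.induct)
  case (alg_const b)
  show ?case by (rule exI[of _ 0], rule exI[of _ "\<lambda>_ _. b"]) (auto simp: poly_in_def intro: alg.alg_const)
next
  case (alg_gen f)
  show ?case
  proof (cases "f = a")
    case True
    have "f = poly_in a 1 (\<lambda>k _. if k = 1 then 1 else 0)" using True by (auto simp: poly_in_def)
    then show ?thesis by (intro exI[of _ 1] exI[of _ "\<lambda>k _. if k = 1 then 1 else 0"]) (auto intro: alg.alg_const)
  next
    case False
    then show ?thesis using alg_gen
      by (intro exI[of _ 0] exI[of _ "\<lambda>_. f"]) (auto simp: poly_in_def intro: alg.alg_gen)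
  qed
next
  case (alg_add f g)
  then obtain d c d' c' where c: "\<forall>k. c k \<in> alg A" "f = poly_in a d c" "\<forall>k. c' k \<in> alg A" "g = poly_in a d' c'" by blast
  let ?D = "max d d'"
  let ?c = "\<lambda>k. if k \<le> d then c k else (\<lambda>_. 0)" and ?c' = "\<lambda>k. if k \<le> d' then c' k else (\<lambda>_. 0)"
  have "f = poly_in a ?D ?c" "g = poly_in a ?D ?c'" using c poly_in_mono[of d ?D a c] poly_in_mono[of d' ?D a c'] by auto
  then have "(\<lambda>x. f x + g x) = poly_in a ?D (\<lambda>k x. ?c k x + ?c' k x)"
    by (simp only: poly_in_def) (simp add: sum.distrib[symmetric] algebra_simps)
  moreover have "(\<lambda>x. ?c k x + ?c' k x) \<in> alg A" for k
    using c by (intro alg_intros) (auto intro: alg.alg_const)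
  ultimately show ?case by (intro exI[of _ ?D] exI[of _ "\<lambda>k x. ?c k x + ?c' k x"]) simp
next
  case (alg_mult f g)
  then obtain d c d' c' where c: "\<forall>k. c k \<in> alg A" "f = poly_in a d c" "\<forall>k. c' k \<in> alg A" "g = poly_in a d' c'" by blast
  have "(\<lambda>x. f x * g x) = poly_in a (d + d') (\<lambda>n x. \<Sum>(i, j)\<in>{(i, j). i \<le> d \<and> j \<le> d' \<and> i + j = n}. c i x * c' j x)"
    using c(2,4) poly_in_mult by simp
  moreover have "(\<lambda>x. \<Sum>(i, j)\<in>{(i, j). i \<le> d \<and> j \<le> d' \<and> i + j = n}. c i x * c' j x) \<in> alg A" for n
    unfolding case_prod_beta using c by (intro alg_intros) auto
  ultimately show ?case
    by (intro exI[of _ "d + d'"] exI[of _ "\<lambda>n x. \<Sum>(i, j)\<in>{(i, j). i \<le> d \<and> j \<le> d' \<and> i + j = n}. c i x * c' j x"]) simp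
qed

lemma poly_in_shift:
  assumes "d \<le> d'"
  shows "(\<lambda>x. a x ^ (d' - d) * poly_in a d c x) = poly_in a d' (\<lambda>k. if k < d' - d then (\<lambda>_. 0) else c (k - (d' - d)))"
proof (rule ext)
  fix x
  have "poly_in a d' (\<lambda>k. if k < d' - d then (\<lambda>_. 0) else c (k - (d' - d))) x =
      (\<Sum>k\<in>{d' - d..d'}. c (k - (d' - d)) x * a x ^ k)"
    unfolding poly_in_def by (rule sum.mono_neutral_cong_right) auto
  also have "\<dots> = (\<Sum>k\<in>{..d}. c k x * a x ^ (k + (d' - d)))"
    by (rule sum.reindex_bij_witness[of _ "\<lambda>k. k + (d' - d)" "\<lambda>k. k - (d' - d)"]) (use assms in auto)
  also have "\<dots> = a x ^ (d' - d) * poly_in a d c x"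
    unfolding poly_in_def sum_distrib_left by (simp add: power_add algebra_simps)
  finally show "a x ^ (d' - d) * poly_in a d c x = poly_in a d' (\<lambda>k. if k < d' - d then (\<lambda>_. 0) else c (k - (d' - d))) x" by simp
qed

text \<open>
  Hilbert's argument. The coefficients at the formal degree \<open>d\<close> of the members of an ideal form an
  ideal of the smaller algebra that grows with \<open>d\<close> and is constant from some \<open>D\<close> on. Lifts of finitely
  many generators of these leading ideals up to \<open>D\<close> generate the ideal: they reduce the formal degree
  of any of its members.
\<close>

theorem noetherian_insert:
  assumes N: "noetherian (alg A)"
  shows "noetherian (alg (insert a A))"
  unfolding noetherian_def
proof (intro allI impI)
  let ?S = "alg (insert a A)"
  fix I assume I: "I \<subseteq> ?S"
  define K where "K = idl ?S I"
  have aS: "(\<lambda>x. a x ^ n) \<in> ?S" for n by (intro alg_power alg_gen) auto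
  have RS: "r \<in> ?S" if "r \<in> alg A" for r using that by (rule alg_mono[rotated]) (auto intro: alg_gen)
  define L where "L d = {c d | c. (\<forall>k. c k \<in> alg A) \<and> poly_in a d c \<in> K}" for d
  have LR: "L d \<subseteq> alg A" for d unfolding L_def by auto
  have Lmono: "L d \<subseteq> L d'" if "d \<le> d'" for d d'
  proof
    fix l assume "l \<in> L d"
    then obtain c where c: "\<forall>k. c k \<in> alg A" "poly_in a d c \<in> K" "l = c d" unfolding L_def by blast
    let ?c = "\<lambda>k. if k < d' - d then (\<lambda>_. 0) else c (k - (d' - d))"
    have "poly_in a d' ?c \<in> K"
      using poly_in_shift[OF that, of a c] idl_mult[OF aS, of "poly_in a d c" I "d' - d"] c(2) by (simp add: K_def)
    moreover have "\<forall>k. ?c k \<in> alg A" using c(1) by (auto intro: alg_const)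
    moreover have "?c d' = l" using that c(3) by auto
    ultimately show "l \<in> L d'" unfolding L_def by (intro CollectI exI[of _ ?c]) auto
  qed
  have "(\<Union>d. L d) \<subseteq> alg A" using LR by auto
  then obtain J\<^sub>0 where J0: "J\<^sub>0 \<subseteq> (\<Union>d. L d)" "finite J\<^sub>0" "(\<Union>d. L d) \<subseteq> idl (alg A) J\<^sub>0"
    using N unfolding noetherian_def by meson
  obtain D where D: "J\<^sub>0 \<subseteq> L D"
  proof -
    have "\<exists>D. J \<subseteq> L D" if "finite J" "J \<subseteq> (\<Union>d. L d)" for J
      using that
    proof (induction J rule: finite_induct)
      case (insert j J)
      then obtain D d where "J \<subseteq> L D" "j \<in> L d" by auto
      then have "insert j J \<subseteq> L (max D d)" using Lmono[of D "max D d"] Lmono[of d "max D d"] by auto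
      then show ?case by blast
    qed auto
    then show ?thesis using that J0 by blast
  qed
  have "\<exists>J\<subseteq>L d. finite J \<and> L d \<subseteq> idl (alg A) J" for d
    using N LR unfolding noetherian_def by meson
  then obtain J where J: "\<And>d. J d \<subseteq> L d" "\<And>d. finite (J d)" "\<And>d. L d \<subseteq> idl (alg A) (J d)"
    by metis
  define M where "M d = (if d = D then J\<^sub>0 else J d)" for d
  have M: "M d \<subseteq> L d" "finite (M d)" for d using J D J0 by (auto simp: M_def)
  have MinL: "L d \<subseteq> idl (alg A) (M (min d D))" for d
  proof (cases "d < D")
    case True
    then show ?thesis using J(3)[of d] by (simp add: M_def min_def)
  next
    case False
    then show ?thesis using J0(3) by (auto simp: M_def min_def)
  qed
  define lift_lead where "lift_lead d l = (SOME c. (\<forall>k. c k \<in> alg A) \<and> poly_in a d c \<in> K \<and> l = c d)" for d l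
  have lift_lead: "lift_lead d l k \<in> alg A" "poly_in a d (lift_lead d l) \<in> K" "lift_lead d l d = l" if l: "l \<in> M d" for d l k
  proof -
    have "\<exists>c. (\<forall>k. c k \<in> alg A) \<and> poly_in a d c \<in> K \<and> l = c d" using M(1)[of d] that unfolding L_def by blast
    from someI_ex[OF this] show "lift_lead d l k \<in> alg A" "poly_in a d (lift_lead d l) \<in> K" "lift_lead d l d = l"
      unfolding lift_lead_def by auto
  qed
  define G where "G = (\<Union>d\<in>{..D}. (\<lambda>l. poly_in a d (lift_lead d l)) ` M d)"
  have Gfin: "finite G" unfolding G_def using M(2) by auto
  have GK: "G \<subseteq> K" unfolding G_def using lift_lead(2) by auto
  \<comment> \<open>Every leading coefficient in degree d is attained within the ideal generated by the lifts.\<close>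
  have lead: "\<exists>c. (\<forall>k. c k \<in> alg A) \<and> poly_in a d c \<in> idl ?S G \<and> c d = l"
    if "l \<in> idl (alg A) (M d')" "d' \<le> d" "d' \<le> D" for l d d'
    using that(1)
  proof (induction rule: idl.induct)
    case idl_zero
    have "poly_in a d (\<lambda>_ _. 0) = (\<lambda>_. 0)" by (simp add: poly_in_def)
    then show ?case by (intro exI[of _ "\<lambda>_ _. 0"]) (auto intro: alg_const idl.idl_zero)
  next
    case (idl_step r j f)
    then obtain c where c: "\<forall>k. c k \<in> alg A" "poly_in a d c \<in> idl ?S G" "c d = f" by blast
    let ?c1 = "\<lambda>k. if k < d - d' then (\<lambda>_. 0) else lift_lead d' j (k - (d - d'))"
    have c1: "\<forall>k. ?c1 k \<in> alg A" using lift_lead(1)[OF idl_step(2)] by (auto intro: alg_const)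
    have "poly_in a d' (lift_lead d' j) \<in> G" unfolding G_def using idl_step(2) that(3) by auto
    then have "(\<lambda>x. r x * (a x ^ (d - d') * poly_in a d' (lift_lead d' j) x)) \<in> idl ?S G"
      by (intro idl_mult RS[OF idl_step(1)] aS idl_gen)
    moreover have "(\<lambda>x. a x ^ (d - d') * poly_in a d' (lift_lead d' j) x) = poly_in a d ?c1"
      by (rule poly_in_shift[OF that(2)])
    ultimately have "(\<lambda>x. r x * poly_in a d ?c1 x) \<in> idl ?S G" by (simp add: fun_eq_iff)
    from idl_add[OF this c(2)] have "(\<lambda>x. r x * poly_in a d ?c1 x + poly_in a d c x) \<in> idl ?S G" .
    moreover have "(\<lambda>x. r x * poly_in a d ?c1 x + poly_in a d c x) = poly_in a d (\<lambda>k x. r x * ?c1 k x + c k x)"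
      unfolding poly_in_def by (simp add: sum_distrib_left sum.distrib[symmetric] algebra_simps)
    moreover have "\<forall>k. (\<lambda>x. r x * ?c1 k x + c k x) \<in> alg A"
    proof
      fix k show "(\<lambda>x. r x * ?c1 k x + c k x) \<in> alg A"
        using c1[rule_format, of k] c(1) idl_step(1) by (intro alg_add alg_mult) blast+
    qed
    moreover have "(\<lambda>x. r x * ?c1 d x + c d x) = (\<lambda>x. r x * j x + f x)"
      using that(2) c(3) lift_lead(3)[OF idl_step(2)] by auto
    ultimately show ?case by (intro exI[of _ "\<lambda>k x. r x * ?c1 k x + c k x"]) auto
  qed
  have main: "poly_in a d c \<in> idl ?S G" if "\<forall>k. c k \<in> alg A" "poly_in a d c \<in> K" for d c
    using that
  proof (induction d arbitrary: c)
    case 0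
    have "c 0 \<in> L 0" using 0 unfolding L_def by blast
    then obtain c' where c': "\<forall>k. c' k \<in> alg A" "poly_in a 0 c' \<in> idl ?S G" "c' 0 = c 0"
      using MinL[of 0] lead[of "c 0" "min 0 D" 0] by auto
    then show ?case by (simp add: poly_in_def)
  next
    case (Suc d)
    have "c (Suc d) \<in> L (Suc d)" using Suc.prems unfolding L_def by blast
    then obtain c' where c': "\<forall>k. c' k \<in> alg A" "poly_in a (Suc d) c' \<in> idl ?S G" "c' (Suc d) = c (Suc d)"
      using MinL[of "Suc d"] lead[of "c (Suc d)" "min (Suc d) D" "Suc d"] by auto
    let ?c = "\<lambda>k x. c k x - c' k x"
    have eq: "poly_in a d ?c = (\<lambda>x. poly_in a (Suc d) c x - poly_in a (Suc d) c' x)"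
      unfolding poly_in_def using c'(3) by (simp add: sum_subtractf[symmetric] algebra_simps)
    have "poly_in a (Suc d) c' \<in> K" using idl_trans[OF c'(2)] GK unfolding K_def by blast
    then have "poly_in a d ?c \<in> K" unfolding eq K_def using Suc.prems(2) by (intro idl_diff) (auto simp: K_def)
    moreover have "\<forall>k. ?c k \<in> alg A" using Suc.prems(1) c'(1) by (auto intro: alg_diff)
    ultimately have "poly_in a d ?c \<in> idl ?S G" by (intro Suc.IH[of ?c])
    from idl_add[OF this c'(2)] show ?case unfolding eq by simp
  qed
  have KG: "K \<subseteq> idl ?S G"
  proof
    fix f assume f: "f \<in> K"
    then have "f \<in> ?S" unfolding K_def using idl_alg[OF I] by blast
    then obtain d c where "\<forall>k. c k \<in> alg A" "f = poly_in a d c" using alg_insert_poly_in by blast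
    then show "f \<in> idl ?S G" using main f by blast
  qed
  have gens: "\<exists>J\<subseteq>I. finite J \<and> G' \<subseteq> idl ?S J" if "finite G'" "G' \<subseteq> K" for G'
    using that
  proof (induction G' rule: finite_induct)
    case (insert g G')
    then obtain J where J: "J \<subseteq> I" "finite J" "G' \<subseteq> idl ?S J" by auto
    obtain J' where J': "J' \<subseteq> I" "finite J'" "g \<in> idl ?S J'" using idl_finite[of g "insert a A" I] insert.prems
      unfolding K_def by auto
    show ?case using J J' idl_mono[of J "J \<union> J'"] idl_mono[of J' "J \<union> J'"]
      by (intro exI[of _ "J \<union> J'"]) auto
  qed auto
  obtain J' where J': "J' \<subseteq> I" "finite J'" "G \<subseteq> idl ?S J'" using gens[OF Gfin GK] by blast
  have "I \<subseteq> idl ?S J'"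
  proof
    fix f assume "f \<in> I"
    then have "f \<in> K" unfolding K_def by (rule idl_gen)
    then have "f \<in> idl ?S G" by (rule subsetD[OF KG])
    then show "f \<in> idl ?S J'" using J'(3) by (rule idl_trans)
  qed
  then show "\<exists>J\<subseteq>I. finite J \<and> I \<subseteq> idl ?S J" using J' by blast
qed

theorem noetherian_alg: "finite A \<Longrightarrow> noetherian (alg A)"
  by (induction A rule: finite_induct) (auto intro: noetherian_constants noetherian_insert)


section \<open>Polynomial functions and the Zariski topology\<close>

definition axes :: "(complex ^ 'n::finite \<Rightarrow> complex) set" where
  "axes = range (\<lambda>i x. x $ i)"

abbreviation polyfuns :: "(complex ^ 'n::finite \<Rightarrow> complex) set" where
  "polyfuns \<equiv> alg axes"

lemma polyfun_axis [intro, simp]: "(\<lambda>x. x $ i) \<in> polyfuns"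
  by (intro alg_gen) (auto simp: axes_def)

lemma finite_axes: "finite axes"
  by (simp add: axes_def)

lemma peval_superset:
  assumes "finite S" "Poly_Mapping.keys p \<subseteq> S"
  shows "peval p x = (\<Sum>m\<in>S. Poly_Mapping.lookup p m * (\<Prod>i\<in>UNIV. (x $ i) ^ Poly_Mapping.lookup m i))"
  unfolding peval_def using assms by (intro sum.mono_neutral_left) (auto simp: in_keys_iff)

lemma peval_add: "peval (p + q) x = peval p x + peval q x"
proof -
  let ?S = "Poly_Mapping.keys p \<union> Poly_Mapping.keys q"
  have "Poly_Mapping.keys (p + q) \<subseteq> ?S" by (rule Poly_Mapping.keys_add)
  then show ?thesis
    using peval_superset[of ?S p x] peval_superset[of ?S q x] peval_superset[of ?S "p + q" x]
    by (simp add: lookup_add algebra_simps sum.distrib)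
qed

lemma peval_zero [simp]: "peval 0 x = 0"
  by (simp add: peval_def)

lemma peval_sum: "peval (\<Sum>i\<in>I. f i) x = (\<Sum>i\<in>I. peval (f i) x)"
  by (induction I rule: infinite_finite_induct) (auto simp: peval_add)

lemma peval_single: "peval (Poly_Mapping.single m c) x = c * (\<Prod>i\<in>UNIV. (x $ i) ^ Poly_Mapping.lookup m i)"
  using peval_superset[of "{m}" "Poly_Mapping.single m c" x] by simp

lemma sum_single_keys: "p = (\<Sum>m\<in>Poly_Mapping.keys p. Poly_Mapping.single m (Poly_Mapping.lookup p m))"
  by (rule poly_mapping_eqI)
    (auto simp: lookup_sum lookup_single when_def in_keys_iff sum.delta' sum.delta if_distrib cong: if_cong)

lemma peval_mult_single:
  "peval (Poly_Mapping.single m c * Poly_Mapping.single m' c') x =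
     peval (Poly_Mapping.single m c) x * peval (Poly_Mapping.single m' c') x"
  unfolding mult_single peval_single by (simp add: lookup_add power_add prod.distrib)

lemma peval_mult: "peval (p * q) x = peval p x * peval q x"
proof -
  let ?p = "\<lambda>m. Poly_Mapping.single m (Poly_Mapping.lookup p m)"
  let ?q = "\<lambda>m. Poly_Mapping.single m (Poly_Mapping.lookup q m)"
  have "p * q = (\<Sum>m\<in>Poly_Mapping.keys p. \<Sum>m'\<in>Poly_Mapping.keys q. ?p m * ?q m')"
    by (subst (1) sum_single_keys[of p], subst (1) sum_single_keys[of q]) (simp add: sum_product)
  then have "peval (p * q) x = (\<Sum>m\<in>Poly_Mapping.keys p. \<Sum>m'\<in>Poly_Mapping.keys q. peval (?p m) x * peval (?q m') x)"
    by (simp add: peval_sum peval_mult_single)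
  also have "\<dots> = peval (\<Sum>m\<in>Poly_Mapping.keys p. ?p m) x * peval (\<Sum>m\<in>Poly_Mapping.keys q. ?q m) x"
    by (simp add: peval_sum sum_product)
  finally show ?thesis by (simp add: sum_single_keys[symmetric])
qed

lemma peval_one [simp]: "peval 1 x = 1"
  using peval_single[of 0 1 x] by simp

lemma peval_power: "peval (p ^ n) x = peval p x ^ n"
  by (induction n) (auto simp: peval_mult)

lemma peval_var: "peval (Poly_Mapping.single (Poly_Mapping.single i 1) c) x = c * x $ i"
proof -
  have "(\<Prod>j\<in>UNIV. (x $ j) ^ Poly_Mapping.lookup (Poly_Mapping.single i 1) j) = (\<Prod>j\<in>UNIV. if j = i then x $ i else 1)"
    by (intro prod.cong) (auto simp: lookup_single when_def)
  then show ?thesis by (simp add: peval_single)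
qed

lemma peval_linear_poly: "peval (linear_poly u) x = (\<Sum>i\<in>UNIV. u $ i * x $ i)"
  unfolding linear_poly_def peval_sum peval_var ..

lemma peval_polyfun: "peval p \<in> polyfuns"
  unfolding peval_def[abs_def] by (intro alg_intros) auto

lemma polyfun_peval:
  assumes "f \<in> polyfuns" shows "\<exists>p. f = peval p"
  using assms
proof (induction rule: alg.induct)
  case (alg_const c)
  show ?case by (intro exI[of _ "Poly_Mapping.single 0 c"]) (auto simp: peval_single)
next
  case (alg_gen f)
  then obtain i where "f = (\<lambda>x. x $ i)" by (auto simp: axes_def)
  then have "f = peval (Poly_Mapping.single (Poly_Mapping.single i 1) 1)"
    using peval_var[of i 1] by auto
  then show ?case ..
next
  case (alg_add f g)
  then obtain p q where "f = peval p" "g = peval q" by blast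
  then show ?case by (intro exI[of _ "p + q"]) (auto simp: peval_add)
next
  case (alg_mult f g)
  then obtain p q where "f = peval p" "g = peval q" by blast
  then show ?case by (intro exI[of _ "p * q"]) (auto simp: peval_mult)
qed

lemma range_peval: "range peval = polyfuns"
  using peval_polyfun polyfun_peval by blast

lemma zariski_closed_polyfuns:
  "zariski_closed V \<longleftrightarrow> (\<exists>S\<subseteq>polyfuns. V = {x. \<forall>f\<in>S. f x = 0})"
proof
  assume "zariski_closed V"
  then obtain S where "V = {x. \<forall>p\<in>S. peval p x = 0}" unfolding zariski_closed_def by blast
  then show "\<exists>S\<subseteq>polyfuns. V = {x. \<forall>f\<in>S. f x = 0}"
    using peval_polyfun by (intro exI[of _ "peval ` S"]) auto
next
  assume "\<exists>S\<subseteq>polyfuns. V = {x. \<forall>f\<in>S. f x = 0}"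
  then obtain S where S: "S \<subseteq> polyfuns" "V = {x. \<forall>f\<in>S. f x = 0}" by blast
  have "V = {x. \<forall>p\<in>peval -` S. peval p x = 0}"
    unfolding S(2) using S(1) polyfun_peval by blast
  then show "zariski_closed V" unfolding zariski_closed_def by blast
qed

lemma zariski_closed_zero: "f \<in> polyfuns \<Longrightarrow> zariski_closed {x. f x = 0}"
  unfolding zariski_closed_polyfuns by (intro exI[of _ "{f}"]) auto

definition vanishing :: "(complex ^ 'n::finite) set \<Rightarrow> (complex ^ 'n \<Rightarrow> complex) set" where
  "vanishing V = {f \<in> polyfuns. \<forall>x\<in>V. f x = 0}"

lemma vanishing_peval: "vanishing V = peval ` vanishing_ideal V"
  unfolding vanishing_def vanishing_ideal_def range_peval[symmetric] by auto

lemma zariski_closed_vanishing: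
  assumes "zariski_closed V" shows "V = {x. \<forall>f\<in>vanishing V. f x = 0}"
proof -
  obtain S where S: "S \<subseteq> polyfuns" "V = {x. \<forall>f\<in>S. f x = 0}" using assms zariski_closed_polyfuns by blast
  then have "S \<subseteq> vanishing V" unfolding vanishing_def by auto
  then show ?thesis using S(2) unfolding vanishing_def by blast
qed

lemma zariski_closed_Inter:
  assumes "\<And>V. V \<in> \<V> \<Longrightarrow> zariski_closed V"
  shows "zariski_closed (\<Inter>\<V>)"
proof -
  have "x \<in> \<Inter>\<V> \<longleftrightarrow> (\<forall>f\<in>\<Union>(vanishing ` \<V>). f x = 0)" for x
    using zariski_closed_vanishing[OF assms] by auto
  then have "\<Inter>\<V> = {x. \<forall>f\<in>\<Union>(vanishing ` \<V>). f x = 0}" by blast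
  moreover have "\<Union>(vanishing ` \<V>) \<subseteq> polyfuns" by (auto simp: vanishing_def)
  ultimately show ?thesis unfolding zariski_closed_polyfuns by blast
qed

lemma zariski_closed_Int: "zariski_closed V \<Longrightarrow> zariski_closed W \<Longrightarrow> zariski_closed (V \<inter> W)"
  using zariski_closed_Inter[of "{V, W}"] by auto

lemma idl_zero_at: "f \<in> idl R J \<Longrightarrow> (\<And>j. j \<in> J \<Longrightarrow> j x = 0) \<Longrightarrow> f x = 0"
  by (induction rule: idl.induct) auto

lemma vanishing_generators:
  obtains J where "finite J" "J \<subseteq> vanishing V" "vanishing V \<subseteq> idl polyfuns J"
proof -
  have "vanishing V \<subseteq> polyfuns" unfolding vanishing_def by auto
  then show ?thesis using noetherian_alg[OF finite_axes] that unfolding noetherian_def by meson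
qed

text \<open>
  Along a descending chain the vanishing ideals increase. Finitely many generators of their union
  already vanish on some member of the chain, and the chain is constant from there on.
\<close>

lemma wf_zariski_closed: "wf {(W, V). zariski_closed W \<and> zariski_closed V \<and> W \<subset> (V :: (complex ^ 'n::finite) set)}"
  unfolding wf_iff_no_infinite_down_chain
proof
  assume "\<exists>Z :: nat \<Rightarrow> (complex ^ 'n) set. \<forall>i. (Z (Suc i), Z i) \<in> {(W, V). zariski_closed W \<and> zariski_closed V \<and> W \<subset> V}"
  then obtain Z :: "nat \<Rightarrow> (complex ^ 'n) set"
    where Z': "\<forall>i. (Z (Suc i), Z i) \<in> {(W, V). zariski_closed W \<and> zariski_closed V \<and> W \<subset> V}" ..
  have Z: "zariski_closed (Z i)" "Z (Suc i) \<subset> Z i" for i using Z'[rule_format, of i] by auto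
  have Zmono: "Z j \<subseteq> Z i" if "i \<le> j" for i j using Z(2) that by (meson lift_Suc_antimono_le psubset_imp_subset)
  have Vmono: "vanishing (Z i) \<subseteq> vanishing (Z j)" if "i \<le> j" for i j
    using Zmono[OF that] unfolding vanishing_def by auto
  have "(\<Union>i. vanishing (Z i)) \<subseteq> polyfuns" unfolding vanishing_def by auto
  then obtain J where J: "J \<subseteq> (\<Union>i. vanishing (Z i))" "finite J" "(\<Union>i. vanishing (Z i)) \<subseteq> idl polyfuns J"
    using noetherian_alg[OF finite_axes] unfolding noetherian_def by meson
  have "\<exists>N. J' \<subseteq> vanishing (Z N)" if "finite J'" "J' \<subseteq> (\<Union>i. vanishing (Z i))" for J'
    using that
  proof (induction J' rule: finite_induct)
    case (insert j J')
    then obtain N m where "J' \<subseteq> vanishing (Z N)" "j \<in> vanishing (Z m)" by auto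
    then have "insert j J' \<subseteq> vanishing (Z (max N m))" using Vmono[of N "max N m"] Vmono[of m "max N m"] by auto
    then show ?case by blast
  qed auto
  then obtain N where N: "J \<subseteq> vanishing (Z N)" using J by blast
  have "Z N \<subseteq> Z (Suc N)"
  proof
    fix x assume x: "x \<in> Z N"
    have "f x = 0" if f: "f \<in> vanishing (Z (Suc N))" for f
    proof (rule idl_zero_at[of _ polyfuns J])
      show "f \<in> idl polyfuns J" using f J(3) by blast
      show "j x = 0" if "j \<in> J" for j using that N x unfolding vanishing_def by blast
    qed
    then show "x \<in> Z (Suc N)" using zariski_closed_vanishing[OF Z(1)[of "Suc N"]] by blast
  qed
  then show False using Z(2)[of N] by blast
qed

text \<open>
  Noetherian induction: a reducible set is the union of two smaller closed sets.
\<close>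

lemma zariski_components:
  fixes V :: "(complex ^ 'n::finite) set"
  assumes "zariski_closed V"
  shows "\<exists>\<Z>. finite \<Z> \<and> (\<forall>Z\<in>\<Z>. zariski_closed Z \<and> zariski_irreducible Z) \<and> V = \<Union>\<Z>"
  using assms
proof (induction V rule: wf_induct_rule[OF wf_zariski_closed])
  case (1 V)
  consider "V = {}" | "zariski_irreducible V" | "V \<noteq> {}" "\<not> zariski_irreducible V" by blast
  then show ?case
  proof cases
    case 1
    then show ?thesis by (intro exI[of _ "{}"]) auto
  next
    case 2
    then show ?thesis using \<open>zariski_closed V\<close> by (intro exI[of _ "{V}"]) auto
  next
    case 3
    then obtain A B where AB: "zariski_closed A" "zariski_closed B" "V \<subseteq> A \<union> B" "\<not> V \<subseteq> A" "\<not> V \<subseteq> B"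
      unfolding zariski_irreducible_def by blast
    have "\<exists>\<Z>. finite \<Z> \<and> (\<forall>Z\<in>\<Z>. zariski_closed Z \<and> zariski_irreducible Z) \<and> V \<inter> A = \<Union>\<Z>"
      by (rule 1(1)) (use 1(2) AB zariski_closed_Int in auto)
    moreover have "\<exists>\<Z>. finite \<Z> \<and> (\<forall>Z\<in>\<Z>. zariski_closed Z \<and> zariski_irreducible Z) \<and> V \<inter> B = \<Union>\<Z>"
      by (rule 1(1)) (use 1(2) AB zariski_closed_Int in auto)
    ultimately obtain \<Z> \<Y> where ZY: "finite \<Z>" "\<forall>Z\<in>\<Z>. zariski_closed Z \<and> zariski_irreducible Z" "V \<inter> A = \<Union>\<Z>"
      "finite \<Y>" "\<forall>Z\<in>\<Y>. zariski_closed Z \<and> zariski_irreducible Z" "V \<inter> B = \<Union>\<Y>" by blast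
    then have "V = \<Union>(\<Z> \<union> \<Y>)" using AB(3) by blast
    then show ?thesis using ZY by (intro exI[of _ "\<Z> \<union> \<Y>"]) blast
  qed
qed

lemma zariski_irreducible_prime_on:
  assumes "zariski_irreducible V" shows "prime_on axes V"
  unfolding prime_on_def
proof (intro conjI ballI impI)
  show "V \<noteq> {}" using assms unfolding zariski_irreducible_def by blast
  fix f g assume fg: "f \<in> polyfuns" "g \<in> polyfuns" "\<forall>x\<in>V. f x * g x = 0"
  then have "V \<subseteq> {x. f x = 0} \<union> {x. g x = 0}" by auto
  then have "V \<subseteq> {x. f x = 0} \<or> V \<subseteq> {x. g x = 0}"
    using assms zariski_closed_zero[OF fg(1)] zariski_closed_zero[OF fg(2)] unfolding zariski_irreducible_def by blast
  then show "(\<forall>x\<in>V. f x = 0) \<or> (\<forall>x\<in>V. g x = 0)" by blast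
qed

text \<open>
  Variables indexed by pairs hold one vector for each first component. Statements about several
  vectors thus become statements about one assignment, to which quantifier elimination applies.
\<close>

definition slot :: "('k \<times> 'n::finite \<Rightarrow> complex) \<Rightarrow> 'k \<Rightarrow> complex ^ 'n" where
  "slot e j = (\<chi> i. e (j, i))"

lemma alg_slot: "f \<in> polyfuns \<Longrightarrow> (\<lambda>e. f (slot e j)) \<in> alg coords"
  by (erule alg_compose) (auto simp: axes_def slot_def)

lemma prime_on_UNIV: "prime_on (axes :: (complex ^ 'n::finite \<Rightarrow> complex) set) UNIV"
  unfolding prime_on_def
proof (intro conjI ballI impI)
  fix f g :: "complex ^ 'n \<Rightarrow> complex" assume fg: "f \<in> polyfuns" "g \<in> polyfuns" "\<forall>x\<in>UNIV. f x * g x = 0"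
  have s: "slot (\<lambda>(j, i). x $ i) () = x" for x :: "complex ^ 'n" by (simp add: slot_def vec_eq_iff)
  have "(\<forall>e. f (slot e ()) = 0) \<or> (\<forall>e. g (slot e ()) = 0)"
  proof (rule ccontr)
    assume "\<not> ((\<forall>e. f (slot e ()) = 0) \<or> (\<forall>e. g (slot e ()) = 0))"
    then obtain a b where "f (slot a ()) \<noteq> 0" "g (slot b ()) \<noteq> 0" by blast
    then show False
      using alg_coords_domain[of "\<lambda>e. f (slot e ())" "\<lambda>e. g (slot e ())" a b]
        alg_slot[OF fg(1), of "()"] alg_slot[OF fg(2), of "()"] fg(3) by simp
  qed
  then have "(\<forall>x. f x = 0) \<or> (\<forall>x. g x = 0)"
  proof
    assume z: "\<forall>e. f (slot e ()) = 0"
    have "f x = 0" for x using z[rule_format, of "\<lambda>(j, i). x $ i"] unfolding s .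
    then show ?thesis by blast
  next
    assume z: "\<forall>e. g (slot e ()) = 0"
    have "g x = 0" for x using z[rule_format, of "\<lambda>(j, i). x $ i"] unfolding s .
    then show ?thesis by blast
  qed
  then show "(\<forall>x\<in>UNIV. f x = 0) \<or> (\<forall>x\<in>UNIV. g x = 0)" by blast
qed auto

lemma generically_generic_on: "generically P \<longleftrightarrow> generic_on axes UNIV P"
proof
  assume "generically P"
  then obtain U where U: "zariski_closed (- U)" "U \<noteq> {}" "\<forall>u\<in>U. P u" unfolding generically_def by blast
  obtain S where S: "S \<subseteq> polyfuns" "- U = {x. \<forall>f\<in>S. f x = 0}" using U(1) unfolding zariski_closed_polyfuns by blast
  obtain u where "u \<in> U" using U(2) by blast
  then obtain f where f: "f \<in> S" "f u \<noteq> 0" using S(2) by blast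
  have "P x" if "f x \<noteq> 0" for x using that f(1) S(2) U(3) by blast
  then show "generic_on axes UNIV P" unfolding generic_on_def using f S(1) by blast
next
  assume "generic_on axes UNIV P"
  then obtain h where h: "h \<in> polyfuns" "\<exists>x. h x \<noteq> 0" "\<forall>x. h x \<noteq> 0 \<longrightarrow> P x" unfolding generic_on_def by blast
  then show "generically P" unfolding generically_def
    using zariski_closed_zero[OF h(1)] h(2,3) by (intro exI[of _ "{x. h x \<noteq> 0}"]) (auto simp: Compl_eq)
qed

section \<open>Derivatives of polynomial functions\<close>

definition partial :: "(complex ^ 'n::finite \<Rightarrow> complex) \<Rightarrow> 'n \<Rightarrow> complex ^ 'n \<Rightarrow> complex" where
  "partial f i x = frechet_derivative f (at x) (axis i 1)"

text \<open>
  The index set \<open>I\<close> records on which coordinates the function depends, for relations between the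
  coordinates in \<open>I\<close> are differentiated later.
\<close>

lemma polyfun_derivative_ex:
  fixes I :: "'n::finite set"
  assumes "f \<in> alg ((\<lambda>i x. x $ i) ` I)"
  shows "\<exists>g. (\<forall>i. g i \<in> alg ((\<lambda>i x. x $ i) ` I)) \<and> (\<forall>i x. i \<notin> I \<longrightarrow> g i x = 0) \<and>
     (\<forall>x. (f has_derivative (\<lambda>v. \<Sum>i\<in>UNIV. g i x * v $ i)) (at x))"
  using assms
proof (induction rule: alg.induct)
  case (alg_const c)
  show ?case by (intro exI[of _ "\<lambda>_ _. 0"]) (auto intro: alg.alg_const)
next
  case (alg_gen f)
  then obtain j where f: "f = (\<lambda>x. x $ j)" "j \<in> I" by auto
  have "(\<Sum>i\<in>UNIV. (if i = j then 1 else 0) * v $ i) = v $ j" for v :: "complex ^ 'n"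
    by (simp add: if_distrib[of "\<lambda>c. c * _"] cong: if_cong)
  then have "(f has_derivative (\<lambda>v. \<Sum>i\<in>UNIV. (if i = j then 1 else 0) * v $ i)) (at x)" for x
    unfolding f by (simp add: bounded_linear_imp_has_derivative bounded_linear_vec_nth)
  then show ?case using f(2) by (intro exI[of _ "\<lambda>i _. if i = j then 1 else 0"]) (auto intro: alg.alg_const)
next
  case (alg_add f g)
  then obtain f' g' where f': "\<forall>i. f' i \<in> alg ((\<lambda>i x. x $ i) ` I)" "\<forall>i x. i \<notin> I \<longrightarrow> f' i x = 0"
      "\<forall>x. (f has_derivative (\<lambda>v. \<Sum>i\<in>UNIV. f' i x * v $ i)) (at x)"
    and g': "\<forall>i. g' i \<in> alg ((\<lambda>i x. x $ i) ` I)" "\<forall>i x. i \<notin> I \<longrightarrow> g' i x = 0"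
      "\<forall>x. (g has_derivative (\<lambda>v. \<Sum>i\<in>UNIV. g' i x * v $ i)) (at x)" by blast
  have "((\<lambda>x. f x + g x) has_derivative (\<lambda>v. \<Sum>i\<in>UNIV. (f' i x + g' i x) * v $ i)) (at x)" for x
    using has_derivative_add[OF f'(3)[rule_format, of x] g'(3)[rule_format, of x]]
    by (simp add: algebra_simps sum.distrib)
  moreover have "\<forall>i. (\<lambda>x. f' i x + g' i x) \<in> alg ((\<lambda>i x. x $ i) ` I)"
    using f' g' by (auto intro: alg.alg_add)
  ultimately show ?case using f'(2) g'(2) by (intro exI[of _ "\<lambda>i x. f' i x + g' i x"]) auto
next
  case (alg_mult f g)
  then obtain f' g' where f': "\<forall>i. f' i \<in> alg ((\<lambda>i x. x $ i) ` I)" "\<forall>i x. i \<notin> I \<longrightarrow> f' i x = 0"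
      "\<forall>x. (f has_derivative (\<lambda>v. \<Sum>i\<in>UNIV. f' i x * v $ i)) (at x)"
    and g': "\<forall>i. g' i \<in> alg ((\<lambda>i x. x $ i) ` I)" "\<forall>i x. i \<notin> I \<longrightarrow> g' i x = 0"
      "\<forall>x. (g has_derivative (\<lambda>v. \<Sum>i\<in>UNIV. g' i x * v $ i)) (at x)" by blast
  have "((\<lambda>x. f x * g x) has_derivative (\<lambda>v. \<Sum>i\<in>UNIV. (f x * g' i x + f' i x * g x) * v $ i)) (at x)" for x
    using has_derivative_mult[OF f'(3)[rule_format, of x] g'(3)[rule_format, of x]]
    by (simp add: algebra_simps sum.distrib sum_distrib_left sum_distrib_right)
  moreover have "\<forall>i. (\<lambda>x. f x * g' i x + f' i x * g x) \<in> alg ((\<lambda>i x. x $ i) ` I)"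
    using f' g' alg_mult(1,2) by (intro allI alg.alg_add alg.alg_mult) blast+
  ultimately show ?case using f'(2) g'(2) by (intro exI[of _ "\<lambda>i x. f x * g' i x + f' i x * g x"]) auto
qed

lemma polyfun_has_derivative:
  assumes "f \<in> polyfuns"
  shows "(f has_derivative frechet_derivative f (at x)) (at x)"
proof -
  obtain g where "(f has_derivative (\<lambda>v. \<Sum>i\<in>UNIV. g i x * v $ i)) (at x)"
    using polyfun_derivative_ex[OF assms[unfolded axes_def]] by auto
  then show ?thesis unfolding frechet_derivative_works[symmetric] differentiable_def by blast
qed

lemma
  assumes "f \<in> alg ((\<lambda>i x. x $ i) ` I)"
  shows frechet_partial_on: "frechet_derivative f (at x) v = (\<Sum>i\<in>UNIV. partial f i x * v $ i)"
    and partial_alg_on: "partial f i \<in> alg ((\<lambda>i x. x $ i) ` I)"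
    and partial_outside: "i \<notin> I \<Longrightarrow> partial f i x = 0"
proof -
  obtain g where g: "\<forall>i. g i \<in> alg ((\<lambda>i x. x $ i) ` I)" "\<forall>i x. i \<notin> I \<longrightarrow> g i x = 0"
      "\<forall>x. (f has_derivative (\<lambda>v. \<Sum>i\<in>UNIV. g i x * v $ i)) (at x)"
    using polyfun_derivative_ex[OF assms] by blast
  have D: "frechet_derivative f (at x) = (\<lambda>v. \<Sum>i\<in>UNIV. g i x * v $ i)" for x
    using frechet_derivative_at[OF g(3)[rule_format, of x]] by simp
  have "(\<Sum>k\<in>UNIV. g k x * axis i 1 $ k) = g i x" for i x
  proof -
    have "(\<Sum>k\<in>UNIV. g k x * axis i 1 $ k) = (\<Sum>k\<in>UNIV. if k = i then g i x else 0)"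
      by (intro sum.cong) (auto simp: axis_def)
    then show ?thesis by simp
  qed
  then have "partial f i = g i" for i unfolding partial_def D by auto
  then show "frechet_derivative f (at x) v = (\<Sum>i\<in>UNIV. partial f i x * v $ i)"
    "partial f i \<in> alg ((\<lambda>i x. x $ i) ` I)" "i \<notin> I \<Longrightarrow> partial f i x = 0"
    using D g(1,2) by auto
qed

lemma
  assumes "f \<in> polyfuns"
  shows frechet_partial: "frechet_derivative f (at x) v = (\<Sum>i\<in>UNIV. partial f i x * v $ i)"
    and partial_polyfun: "partial f i \<in> polyfuns"
  using frechet_partial_on[OF assms[unfolded axes_def]] partial_alg_on[OF assms[unfolded axes_def]]
  by (simp_all add: axes_def)

lemma frechet_add:
  "f \<in> polyfuns \<Longrightarrow> frechet_derivative f (at x) (v + w) = frechet_derivative f (at x) v + frechet_derivative f (at x) w"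
  by (simp add: frechet_partial algebra_simps sum.distrib)

lemma frechet_scale:
  "f \<in> polyfuns \<Longrightarrow> frechet_derivative f (at x) (c *s v) = c * frechet_derivative f (at x) v"
  by (simp add: frechet_partial algebra_simps sum_distrib_left)

lemma frechet_sum_poly:
  "f \<in> polyfuns \<Longrightarrow> g \<in> polyfuns \<Longrightarrow> frechet_derivative (\<lambda>x. f x + g x) (at x) v =
     frechet_derivative f (at x) v + frechet_derivative g (at x) v"
  using frechet_derivative_at[OF has_derivative_add[OF polyfun_has_derivative[of f x] polyfun_has_derivative[of g x]]]
  by (simp add: fun_eq_iff)

lemma frechet_mult_poly:
  "f \<in> polyfuns \<Longrightarrow> g \<in> polyfuns \<Longrightarrow> frechet_derivative (\<lambda>x. f x * g x) (at x) v =
     f x * frechet_derivative g (at x) v + frechet_derivative f (at x) v * g x"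
  using frechet_derivative_at[OF has_derivative_mult[OF polyfun_has_derivative[of f x] polyfun_has_derivative[of g x]]]
  by (simp add: fun_eq_iff)

lemma tangent_space_vanishing:
  "tangent_space V x = {v. \<forall>f\<in>vanishing V. frechet_derivative f (at x) v = 0}"
  unfolding tangent_space_def vanishing_peval by auto

lemma idl_derivative_zero:
  assumes "f \<in> idl polyfuns J" "J \<subseteq> polyfuns" "\<And>j. j \<in> J \<Longrightarrow> j x = 0"
    "\<And>j. j \<in> J \<Longrightarrow> frechet_derivative j (at x) v = 0"
  shows "frechet_derivative f (at x) v = 0"
  using assms(1)
proof (induction rule: idl.induct)
  case idl_zero
  show ?case by simp
next
  case (idl_step r j f)
  have j: "j \<in> polyfuns" using idl_step(2) assms(2) by blast
  have f: "f \<in> polyfuns" using idl_alg[OF assms(2) idl_step(3)] .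
  have "frechet_derivative (\<lambda>x. r x * j x + f x) (at x) v =
      frechet_derivative (\<lambda>x. r x * j x) (at x) v + frechet_derivative f (at x) v"
    by (rule frechet_sum_poly[OF alg_mult[OF idl_step(1) j] f])
  then show ?case using frechet_mult_poly[OF idl_step(1) j, of x v] assms(3,4)[OF idl_step(2)] idl_step(4) by simp
qed

definition kernel_of :: "(complex ^ 'n::finite \<Rightarrow> complex) set \<Rightarrow> complex ^ 'n \<Rightarrow> (complex ^ 'n) set" where
  "kernel_of J x = {v. \<forall>j\<in>J. frechet_derivative j (at x) v = 0}"

text \<open>
  Finitely many generators of the vanishing ideal give linear equations for all tangent spaces at
  once. This is why conditions on the tangent space at \<open>x\<close> are constructible in \<open>x\<close>.
\<close>

lemma tangent_space_kernel:
  assumes "J \<subseteq> vanishing V" "vanishing V \<subseteq> idl polyfuns J" "x \<in> V"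
  shows "tangent_space V x = kernel_of J x"
proof
  show "tangent_space V x \<subseteq> kernel_of J x"
    using assms(1) unfolding tangent_space_vanishing kernel_of_def by auto
  show "kernel_of J x \<subseteq> tangent_space V x"
  proof
    fix v assume v: "v \<in> kernel_of J x"
    have "frechet_derivative f (at x) v = 0" if "f \<in> vanishing V" for f
    proof (rule idl_derivative_zero[of f J])
      show "f \<in> idl polyfuns J" using that assms(2) by blast
      show "J \<subseteq> polyfuns" using assms(1) unfolding vanishing_def by blast
      show "j x = 0" if "j \<in> J" for j using that assms(1,3) unfolding vanishing_def by blast
      show "frechet_derivative j (at x) v = 0" if "j \<in> J" for j using that v unfolding kernel_of_def by blast
    qed
    then show "v \<in> tangent_space V x" unfolding tangent_space_vanishing by blast
  qed
qed

lemma subspace_tangent_space: "vec.subspace (tangent_space V x)"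
proof -
  have P: "f \<in> polyfuns" if "f \<in> vanishing V" for f using that unfolding vanishing_def by blast
  show ?thesis unfolding tangent_space_vanishing
  proof (rule vec.subspaceI)
    show "0 \<in> {v. \<forall>f\<in>vanishing V. frechet_derivative f (at x) v = 0}" using P by (auto simp: frechet_partial)
    show "v + w \<in> {v. \<forall>f\<in>vanishing V. frechet_derivative f (at x) v = 0}"
      if "v \<in> {v. \<forall>f\<in>vanishing V. frechet_derivative f (at x) v = 0}" "w \<in> {v. \<forall>f\<in>vanishing V. frechet_derivative f (at x) v = 0}" for v w
      using that P by (auto simp: frechet_add)
    show "c *s v \<in> {v. \<forall>f\<in>vanishing V. frechet_derivative f (at x) v = 0}"
      if "v \<in> {v. \<forall>f\<in>vanishing V. frechet_derivative f (at x) v = 0}" for c v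
      using that P by (auto simp: frechet_scale)
  qed
qed

section \<open>Coordinates that determine a subspace\<close>

text \<open>
  The projection of \<open>T\<close> to the coordinates in \<open>I\<close> is injective. The dimension of \<open>T\<close> is the least size
  of such an \<open>I\<close>, which makes it accessible to constructible conditions.
\<close>

definition determines :: "(complex ^ 'n::finite) set \<Rightarrow> 'n set \<Rightarrow> bool" where
  "determines T I \<longleftrightarrow> (\<forall>v\<in>T. (\<forall>i\<in>I. v $ i = 0) \<longrightarrow> v = 0)"

text \<open>
  Members of \<open>T\<close> with the coordinates of the standard basis in \<open>I\<close>; if \<open>T\<close> is determined by \<open>I\<close>, they
  are a basis of \<open>T\<close>.
\<close>

definition dual_family :: "(complex ^ 'n::finite) set \<Rightarrow> 'n set \<Rightarrow> ('n \<Rightarrow> complex ^ 'n) \<Rightarrow> bool" where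
  "dual_family T I b \<longleftrightarrow> (\<forall>i\<in>I. b i \<in> T \<and> (\<forall>k\<in>I. b i $ k = (if k = i then 1 else 0)))"

text \<open>
  By minimality, dropping \<open>i\<close> from \<open>I\<close> admits a nonzero vector of \<open>T\<close> whose only nonzero coordinate
  in \<open>I\<close> is the \<open>i\<close>-th.
\<close>

lemma dual_family_ex:
  assumes T: "vec.subspace T" and I: "determines T I" "\<And>i. i \<in> I \<Longrightarrow> \<not> determines T (I - {i})"
  shows "\<exists>b. dual_family T I b"
proof -
  have "\<exists>v. v \<in> T \<and> (\<forall>k\<in>I. v $ k = (if k = i then 1 else 0))" if i: "i \<in> I" for i
  proof -
    obtain v where v: "v \<in> T" "\<forall>k\<in>I - {i}. v $ k = 0" "v \<noteq> 0" using I(2)[OF i] unfolding determines_def by blast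
    have vi: "v $ i \<noteq> 0" using v I(1) unfolding determines_def by (metis DiffI singletonD)
    have "(1 / v $ i) *s v \<in> T" using T v(1) by (rule vec.subspace_scale)
    moreover have "\<forall>k\<in>I. ((1 / v $ i) *s v) $ k = (if k = i then 1 else 0)" using v(2) vi by auto
    ultimately show ?thesis by blast
  qed
  then show ?thesis unfolding dual_family_def by metis
qed

lemma dual_family_expand:
  assumes T: "vec.subspace T" and I: "determines T I" and b: "dual_family T I b" and w: "w \<in> T"
  shows "w = (\<Sum>i\<in>I. w $ i *s b i)"
proof -
  let ?s = "\<Sum>i\<in>I. w $ i *s b i"
  have "?s \<in> T" using T b unfolding dual_family_def by (intro vec.subspace_sum vec.subspace_scale) auto
  then have "w - ?s \<in> T" using T w vec.subspace_diff by blast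
  moreover have "(w - ?s) $ k = 0" if k: "k \<in> I" for k
  proof -
    have "?s $ k = (\<Sum>i\<in>I. w $ i * (if k = i then 1 else 0))"
      using b k unfolding dual_family_def by (auto intro!: sum.cong)
    also have "\<dots> = w $ k" using k by (simp add: if_distrib[of "\<lambda>c. _ * c"] cong: if_cong)
    finally show ?thesis by simp
  qed
  ultimately have "w - ?s = 0" using I unfolding determines_def by blast
  then show ?thesis by simp
qed

lemma dual_family_dim:
  assumes T: "vec.subspace T" and I: "determines T I" and b: "dual_family T I b"
  shows "vec.dim T = card I"
proof -
  have inj: "inj_on b I" using b unfolding dual_family_def inj_on_def by (metis zero_neq_one)
  have "vec.independent (b ` I)"
  proof (rule vec.independent_if_scalars_zero)
    fix f x assume s: "(\<Sum>x\<in>b ` I. f x *s x) = 0" and "x \<in> b ` I"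
    then obtain k where k: "k \<in> I" "x = b k" by blast
    have "0 = (\<Sum>i\<in>I. f (b i) *s b i) $ k" using s by (simp add: sum.reindex[OF inj])
    also have "\<dots> = (\<Sum>i\<in>I. f (b i) * (if k = i then 1 else 0))"
      using b k unfolding dual_family_def by (auto intro!: sum.cong)
    also have "\<dots> = f (b k)" using k by (simp add: if_distrib[of "\<lambda>c. _ * c"] cong: if_cong)
    finally show "f x = 0" using k by simp
  qed auto
  moreover have "T \<subseteq> vec.span (b ` I)"
  proof
    fix w assume "w \<in> T"
    have "(\<Sum>i\<in>I. w $ i *s b i) \<in> vec.span (b ` I)"
      by (intro vec.span_sum vec.span_scale vec.span_base) auto
    then show "w \<in> vec.span (b ` I)" using dual_family_expand[OF T I b \<open>w \<in> T\<close>] by simp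
  qed
  moreover have "b ` I \<subseteq> T" using b unfolding dual_family_def by blast
  ultimately show ?thesis using vec.dim_unique[of "b ` I" T "card I"] card_image[OF inj] by blast
qed

lemma determines_subset:
  assumes "determines T I"
  shows "\<exists>I0\<subseteq>I. determines T I0 \<and> (\<forall>i\<in>I0. \<not> determines T (I0 - {i}))"
  using finite[of I] assms
proof (induction I rule: finite_psubset_induct)
  case (psubset I)
  show ?case
  proof (cases "\<forall>i\<in>I. \<not> determines T (I - {i})")
    case True
    then show ?thesis using psubset.prems by blast
  next
    case False
    then obtain i where i: "i \<in> I" "determines T (I - {i})" by blast
    then obtain I0 where "I0 \<subseteq> I - {i}" "determines T I0 \<and> (\<forall>i\<in>I0. \<not> determines T (I0 - {i}))"
      using psubset.IH[of "I - {i}"] by blast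
    then show ?thesis by blast
  qed
qed

lemma determines_dim_le:
  assumes "vec.subspace T" "determines T I" shows "vec.dim T \<le> card I"
proof -
  obtain I0 where I0: "I0 \<subseteq> I" "determines T I0" "\<forall>i\<in>I0. \<not> determines T (I0 - {i})"
    using determines_subset[OF assms(2)] by blast
  obtain b where "dual_family T I0 b" using dual_family_ex[OF assms(1) I0(2)] I0(3) by blast
  then have "vec.dim T = card I0" using dual_family_dim assms(1) I0(2) by blast
  then show ?thesis using I0(1) card_mono[of I I0] by simp
qed

lemma determines_ex:
  assumes "vec.subspace T" shows "\<exists>I. determines T I \<and> card I = vec.dim T"
proof -
  have "determines T UNIV" unfolding determines_def by (auto simp: vec_eq_iff)
  then obtain I0 where I0: "determines T I0" "\<forall>i\<in>I0. \<not> determines T (I0 - {i})"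
    using determines_subset by blast
  obtain b where "dual_family T I0 b" using dual_family_ex[OF assms I0(1)] I0(2) by blast
  then show ?thesis using dual_family_dim[OF assms I0(1)] I0(1) by metis
qed

lemma determines_dual:
  assumes "vec.subspace T" "determines T I" "card I = vec.dim T" shows "\<exists>b. dual_family T I b"
proof -
  have "\<not> determines T (I - {i})" if "i \<in> I" for i
  proof
    assume "determines T (I - {i})"
    then have "vec.dim T \<le> card (I - {i})" by (rule determines_dim_le[OF assms(1)])
    then show False using assms(3) that
      by (metis card_Diff1_less finite_class.finite_code leD)
  qed
  then show ?thesis using dual_family_ex[OF assms(1,2)] by blast
qed

section \<open>Quantifiers over vectors\<close>

definition set_slot :: "('k \<times> 'n::finite \<Rightarrow> complex) \<Rightarrow> 'k \<Rightarrow> complex ^ 'n \<Rightarrow> ('k \<times> 'n \<Rightarrow> complex)" where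
  "set_slot e j x = (\<lambda>(k, i). if k = j then x $ i else e (k, i))"

lemma slot_set_slot: "slot (set_slot e j x) k = (if k = j then x else slot e k)"
  by (auto simp: slot_def set_slot_def vec_eq_iff)

lemma constructible_ex_slot:
  assumes "constructible coords Q"
  shows "constructible coords (\<lambda>e. \<exists>x. Q (set_slot e j x))"
proof -
  have "constructible coords (\<lambda>e. \<exists>e'. (\<forall>v. v \<notin> {j} \<times> UNIV \<longrightarrow> e' v = e v) \<and> Q e')"
    by (intro constructible_ex assms) auto
  moreover have "(\<exists>e'. (\<forall>v. v \<notin> {j} \<times> UNIV \<longrightarrow> e' v = e v) \<and> Q e') = (\<exists>x. Q (set_slot e j x))" for e
  proof
    assume "\<exists>e'. (\<forall>v. v \<notin> {j} \<times> UNIV \<longrightarrow> e' v = e v) \<and> Q e'"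
    then obtain e' where e': "\<forall>v. v \<notin> {j} \<times> UNIV \<longrightarrow> e' v = e v" "Q e'" by blast
    have "e' = set_slot e j (slot e' j)" using e'(1) by (auto simp: set_slot_def slot_def)
    then show "\<exists>x. Q (set_slot e j x)" using e'(2) by metis
  next
    assume "\<exists>x. Q (set_slot e j x)"
    then obtain x where "Q (set_slot e j x)" by blast
    then show "\<exists>e'. (\<forall>v. v \<notin> {j} \<times> UNIV \<longrightarrow> e' v = e v) \<and> Q e'"
      by (intro exI[of _ "set_slot e j x"]) (auto simp: set_slot_def)
  qed
  ultimately show ?thesis by simp
qed

lemma constructible_slot: "constructible axes Q \<Longrightarrow> constructible coords (\<lambda>e. Q (slot e j))"
  by (rule constructible_compose[of axes Q]) (auto simp: axes_def slot_def)

lemma constructible_axes: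
  assumes "constructible (coords :: ((bool \<times> 'n::finite \<Rightarrow> complex) \<Rightarrow> complex) set) (\<lambda>e. Q (slot e j))"
  shows "constructible (axes :: (complex ^ 'n \<Rightarrow> complex) set) Q"
proof -
  have "constructible axes (\<lambda>x :: complex ^ 'n. Q (slot (\<lambda>(k :: bool, i). x $ i) j))"
    by (rule constructible_compose[OF assms]) (auto simp: coords_def axes_def intro!: alg_gen split: prod.splits)
  then show ?thesis by (simp add: slot_def)
qed

lemma constructible_determines:
  assumes "finite J" "J \<subseteq> polyfuns"
  shows "constructible (axes :: (complex ^ 'n::finite \<Rightarrow> complex) set) (\<lambda>x. determines (kernel_of J x) I)"
proof (rule constructible_axes[where j = True])
  let ?C = "coords :: ((bool \<times> 'n \<Rightarrow> complex) \<Rightarrow> complex) set"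
  let ?Q = "\<lambda>e. ((\<forall>j\<in>J. (\<Sum>i\<in>UNIV. partial j i (slot e True) * e (False, i)) = 0) \<and> (\<forall>i\<in>I. e (False, i) = 0)) \<and>
      (\<exists>i\<in>UNIV. \<not> e (False, i) = 0)"
  have "constructible ?C ?Q"
    using assms by (intro constructible_conj constructible_ball constructible_bex constructible_zero constructible_not
        alg_sum alg_mult alg_slot partial_polyfun alg_coord) auto
  then have "constructible ?C (\<lambda>e. \<not> (\<exists>v. ?Q (set_slot e False v)))"
    by (intro constructible_not constructible_ex_slot)
  moreover have "(\<not> (\<exists>v. ?Q (set_slot e False v))) = determines (kernel_of J (slot e True)) I" for e
  proof -
    have "v \<in> kernel_of J (slot e True) \<longleftrightarrow> (\<forall>j\<in>J. (\<Sum>i\<in>UNIV. partial j i (slot e True) * v $ i) = 0)" for v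
      unfolding kernel_of_def mem_Collect_eq
      by (rule ball_cong[OF refl]) (use assms(2) in \<open>simp add: frechet_partial subset_iff\<close>)
    moreover have "v \<noteq> 0 \<longleftrightarrow> (\<exists>i\<in>UNIV. \<not> v $ i = 0)" for v :: "complex ^ 'n" by (simp add: vec_eq_iff)
    moreover have "set_slot e False v (False, i) = v $ i" for v i by (simp add: set_slot_def)
    moreover have "slot (set_slot e False v) True = slot e True" for v by (simp add: slot_set_slot)
    ultimately have "?Q (set_slot e False v) \<longleftrightarrow> v \<in> kernel_of J (slot e True) \<and> (\<forall>i\<in>I. v $ i = 0) \<and> v \<noteq> 0" for v
      by simp
    then show ?thesis unfolding determines_def by simp blast
  qed
  ultimately show "constructible ?C (\<lambda>e. determines (kernel_of J (slot e True)) I)" by simp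
qed

lemma constructible_closed:
  assumes "zariski_closed V" shows "constructible axes (\<lambda>x. x \<in> V)"
proof -
  obtain J where J: "finite J" "J \<subseteq> vanishing V" "vanishing V \<subseteq> idl polyfuns J" by (rule vanishing_generators)
  have "x \<in> V \<longleftrightarrow> (\<forall>j\<in>J. j x = 0)" for x
  proof
    assume "x \<in> V" then show "\<forall>j\<in>J. j x = 0" using J(2) unfolding vanishing_def by blast
  next
    assume j0: "\<forall>j\<in>J. j x = 0"
    have "f x = 0" if "f \<in> vanishing V" for f
      by (rule idl_zero_at[of _ polyfuns J]) (use that J(3) j0 in auto)
    then show "x \<in> V" using zariski_closed_vanishing[OF assms] by blast
  qed
  moreover have "constructible axes (\<lambda>x. \<forall>j\<in>J. j x = 0)"
    using J(1,2) by (intro constructible_ball constructible_zero) (auto simp: vanishing_def)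
  ultimately show ?thesis by simp
qed

section \<open>Images of small dimension are negligible\<close>

text \<open>
  The hypothesis says that \<open>\<pi>\<close> is a Lipschitz function of \<open>\<kappa>\<close>. So the image of \<open>\<pi>\<close> is a Lipschitz image
  of a subset of \<open>{0} \<times> UNIV\<close>, a null set of the same dimension as the target.
\<close>

lemma negligible_lipschitz_image_lowdim:
  fixes \<kappa> :: "'e::euclidean_space \<Rightarrow> 'm::euclidean_space" and \<pi> :: "'e \<Rightarrow> complex \<times> 'm"
  assumes "\<And>z z'. z \<in> P \<Longrightarrow> z' \<in> P \<Longrightarrow> dist (\<pi> z) (\<pi> z') \<le> B * dist (\<kappa> z) (\<kappa> z')"
  shows "negligible (\<pi> ` P)"
proof -
  define c where "c w = (SOME z. z \<in> P \<and> \<kappa> z = snd w)" for w :: "complex \<times> 'm"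
  have c: "c (0, \<kappa> z) \<in> P" "\<kappa> (c (0, \<kappa> z)) = \<kappa> z" if "z \<in> P" for z
    using someI[of "\<lambda>z'. z' \<in> P \<and> \<kappa> z' = \<kappa> z" z] that unfolding c_def by auto
  let ?S = "(\<lambda>z. (0 :: complex, \<kappa> z)) ` P"
  have "negligible {x :: complex \<times> 'm. (1, 0) \<bullet> x = 0}"
    by (rule negligible_hyperplane) (auto simp: zero_prod_def)
  then have "negligible ?S" by (rule negligible_subset) auto
  then have "negligible ((\<lambda>w. \<pi> (c w)) ` ?S)"
  proof (rule negligible_locally_Lipschitz_image[rotated])
    fix x assume "x \<in> ?S"
    have "norm (\<pi> (c y) - \<pi> (c x)) \<le> B * norm (y - x)" if yS: "y \<in> ?S" for y
    proof -
      obtain z z' where z: "z \<in> P" "z' \<in> P" "x = (0, \<kappa> z)" "y = (0, \<kappa> z')" using \<open>x \<in> ?S\<close> yS by blast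
      have "norm (y - x) = dist (\<kappa> z') (\<kappa> z)" using z by (simp add: dist_norm norm_Pair)
      then show ?thesis using assms[of "c y" "c x"] c[OF z(1)] c[OF z(2)] z by (simp add: dist_norm)
    qed
    then show "\<exists>T B. open T \<and> x \<in> T \<and> (\<forall>y\<in>?S \<inter> T. norm (\<pi> (c y) - \<pi> (c x)) \<le> B * norm (y - x))"
      by (intro exI[of _ UNIV] exI[of _ B]) auto
  qed auto
  moreover have "\<pi> ` P \<subseteq> (\<lambda>w. \<pi> (c w)) ` ?S"
  proof
    fix p assume "p \<in> \<pi> ` P"
    then obtain z where z: "z \<in> P" "p = \<pi> z" by blast
    have "\<pi> (c (0, \<kappa> z)) = \<pi> z" using assms[of "c (0, \<kappa> z)" z] c[OF z(1)] z(1) by simp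
    then show "p \<in> (\<lambda>w. \<pi> (c w)) ` ?S" using z by (intro image_eqI[of _ _ "(0, \<kappa> z)"]) auto
  qed
  ultimately show ?thesis by (rule negligible_subset)
qed

text \<open>
  Radius and Lipschitz constant depend on the point \<open>z\<close>, but \<open>Y\<close> is a countable union of pieces so
  small that one constant works for all pairs of points of a piece.
\<close>

lemma negligible_locally_determined_image:
  fixes \<kappa> :: "'e::euclidean_space \<Rightarrow> 'm::euclidean_space" and \<pi> :: "'e \<Rightarrow> complex \<times> 'm"
  assumes "\<And>z. z \<in> Y \<Longrightarrow> \<exists>k::nat. \<forall>z'\<in>Y. dist z z' < 1 / Suc k \<longrightarrow> dist (\<pi> z) (\<pi> z') \<le> Suc k * dist (\<kappa> z) (\<kappa> z')"
  shows "negligible (\<pi> ` Y)"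
proof -
  define Z where "Z k = {z \<in> Y. \<forall>z'\<in>Y. dist z z' < 1 / Suc k \<longrightarrow> dist (\<pi> z) (\<pi> z') \<le> Suc k * dist (\<kappa> z) (\<kappa> z')}" for k :: nat
  obtain D :: "'e set" where D: "countable D" "\<And>X. open X \<Longrightarrow> X \<noteq> {} \<Longrightarrow> \<exists>d\<in>D. d \<in> X"
    using countable_dense_exists by blast
  have "negligible (\<pi> ` (Z k \<inter> ball d (1 / (2 * Suc k))))" for k d
  proof (rule negligible_lipschitz_image_lowdim[where B = "Suc k"])
    fix z z' assume z: "z \<in> Z k \<inter> ball d (1 / (2 * Suc k))" "z' \<in> Z k \<inter> ball d (1 / (2 * Suc k))"
    have "dist z z' < 1 / (2 * Suc k) + 1 / (2 * Suc k)"
      by (rule dist_triangle_less_add[of _ d]) (use z in \<open>auto simp: dist_commute\<close>)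
    also have "\<dots> = 1 / Suc k" by (simp add: field_simps)
    finally show "dist (\<pi> z) (\<pi> z') \<le> real (Suc k) * dist (\<kappa> z) (\<kappa> z')" using z unfolding Z_def by auto
  qed
  then have "negligible (\<Union>(k, d)\<in>UNIV \<times> D. \<pi> ` (Z k \<inter> ball d (1 / (2 * Suc k))))"
    using D(1) by (intro negligible_countable_Union countable_image) (auto simp: case_prod_beta)
  moreover have "\<pi> ` Y \<subseteq> (\<Union>(k, d)\<in>UNIV \<times> D. \<pi> ` (Z k \<inter> ball d (1 / (2 * Suc k))))"
  proof
    fix p assume "p \<in> \<pi> ` Y"
    then obtain z where z: "z \<in> Y" "p = \<pi> z" by blast
    then obtain k where k: "z \<in> Z k" using assms[of z] unfolding Z_def by auto
    have "ball z (1 / (2 * Suc k)) \<noteq> {}" by simp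
    then obtain d where "d \<in> D" "d \<in> ball z (1 / (2 * Suc k))" using D(2) open_ball by blast
    then have "z \<in> Z k \<inter> ball d (1 / (2 * Suc k))" using k by (auto simp: dist_commute)
    then have "p \<in> \<pi> ` (Z k \<inter> ball d (1 / (2 * Suc k)))" using z(2) by (rule image_eqI[rotated])
    then show "p \<in> (\<Union>(k, d)\<in>UNIV \<times> D. \<pi> ` (Z k \<inter> ball d (1 / (2 * Suc k))))"
      using \<open>d \<in> D\<close> by (intro UN_I[of "(k, d)"]) auto
  qed
  ultimately show ?thesis by (rule negligible_subset)
qed

definition restrict_to :: "'n set \<Rightarrow> complex ^ 'n::finite \<Rightarrow> complex ^ 'n" where
  "restrict_to I v = (\<chi> i. if i \<in> I then v $ i else 0)"

lemma continuous_restrict_to: "continuous_on UNIV (restrict_to I)"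
proof -
  have "continuous_on UNIV (\<lambda>x :: complex ^ 'a. if i \<in> I then x $ i else 0)" for i
    by (cases "i \<in> I") (auto intro!: continuous_intros)
  then show ?thesis unfolding restrict_to_def by (rule continuous_on_vec_lambda)
qed

lemma restrict_to_scaleR: "restrict_to I (r *\<^sub>R v) = r *\<^sub>R restrict_to I v"
  by (simp add: restrict_to_def vec_eq_iff)

text \<open>
  Otherwise the unit directions of secants through \<open>x\<close> would accumulate at a tangent vector whose
  coordinates in \<open>I\<close> vanish.
\<close>

lemma variety_locally_determined:
  fixes V :: "(complex ^ 'n::finite) set"
  assumes x: "x \<in> V" and I: "determines (tangent_space V x) I"
  shows "\<exists>k::nat. \<forall>y\<in>V. dist x y < 1 / Suc k \<longrightarrow> norm (y - x) \<le> Suc k * norm (restrict_to I (y - x))"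
proof (rule ccontr)
  assume "\<not> ?thesis"
  then have "\<forall>k::nat. \<exists>y. y \<in> V \<and> dist x y < 1 / Suc k \<and> norm (y - x) > Suc k * norm (restrict_to I (y - x))"
    by (simp add: not_le) blast
  then obtain y where y: "\<And>k::nat. y k \<in> V" "\<And>k. dist x (y k) < 1 / Suc k"
      "\<And>k. norm (y k - x) > Suc k * norm (restrict_to I (y k - x))" by metis
  have ne: "y k \<noteq> x" for k
  proof
    assume "y k = x"
    then have "norm (y k - x) = 0" by simp
    moreover have "0 \<le> Suc k * norm (restrict_to I (y k - x))" by simp
    ultimately show False using y(3)[of k] by linarith
  qed
  define d where "d k = (1 / norm (y k - x)) *\<^sub>R (y k - x)" for k
  have nd: "norm (d k) = 1" for k using ne[of k] by (simp add: d_def)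
  have "compact (sphere (0 :: complex ^ 'n) 1)" by simp
  moreover have "\<forall>k. d k \<in> sphere 0 1" using nd by simp
  ultimately obtain v r where vr: "v \<in> sphere 0 1" "strict_mono (r :: nat \<Rightarrow> nat)" "(d \<circ> r) \<longlonglongrightarrow> v"
    unfolding compact_def by blast
  have inv: "(\<lambda>k. 1 / real (Suc k)) \<longlonglongrightarrow> 0" by (rule LIMSEQ_Suc) (rule lim_1_over_n)
  have "restrict_to I v = 0"
  proof -
    have "norm (restrict_to I (d k)) \<le> 1 / Suc k" for k
    proof -
      have "norm (restrict_to I (d k)) = norm (restrict_to I (y k - x)) / norm (y k - x)"
        unfolding d_def restrict_to_scaleR by simp
      also have "\<dots> \<le> 1 / Suc k"
        using y(3)[of k] ne[of k] by (simp add: divide_simps algebra_simps)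
      finally show ?thesis .
    qed
    then have "(\<lambda>k. restrict_to I (d k)) \<longlonglongrightarrow> 0"
      by (intro Lim_null_comparison[OF _ inv] eventuallyI) blast
    then have "(\<lambda>k. restrict_to I (d (r k))) \<longlonglongrightarrow> 0" using LIMSEQ_subseq_LIMSEQ[OF _ vr(2)] by (simp add: o_def)
    moreover have "(\<lambda>k. restrict_to I (d (r k))) \<longlonglongrightarrow> restrict_to I v"
      using continuous_on_tendsto_compose[OF continuous_restrict_to vr(3)] by (simp add: o_def)
    ultimately show ?thesis using LIMSEQ_unique by blast
  qed
  then have rI: "restrict_to I v $ i = 0" for i by simp
  have vI: "\<forall>i\<in>I. v $ i = 0"
  proof
    fix i assume "i \<in> I"
    then show "v $ i = 0" using rI[of i] by (simp add: restrict_to_def)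
  qed
  have yx: "filterlim y (at x) sequentially"
  proof -
    have "(\<lambda>k. dist (y k) x) \<longlonglongrightarrow> 0"
      by (rule Lim_null_comparison[OF _ inv]) (use y(2) in \<open>auto simp: dist_commute intro: less_imp_le eventuallyI\<close>)
    then have "y \<longlonglongrightarrow> x" using tendsto_dist_iff by blast
    then show ?thesis using ne by (simp add: filterlim_at)
  qed
  have "frechet_derivative f (at x) v = 0" if f: "f \<in> vanishing V" for f
  proof -
    let ?D = "frechet_derivative f (at x)"
    have der: "(f has_derivative ?D) (at x)" using f polyfun_has_derivative unfolding vanishing_def by blast
    have bl: "bounded_linear ?D" using der has_derivative_bounded_linear by blast
    have "((\<lambda>y. norm (f y - f x - ?D (y - x)) / norm (y - x)) \<longlongrightarrow> 0) (at x)"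
      using der unfolding has_derivative_iff_norm by blast
    from filterlim_compose[OF this yx]
    have "(\<lambda>k. norm (f (y k) - f x - ?D (y k - x)) / norm (y k - x)) \<longlonglongrightarrow> 0" .
    moreover have "norm (f (y k) - f x - ?D (y k - x)) / norm (y k - x) = norm (?D (d k))" for k
    proof -
      have "f (y k) = 0" "f x = 0" using f x y(1) unfolding vanishing_def by auto
      moreover have "?D (d k) = (1 / norm (y k - x)) *\<^sub>R ?D (y k - x)"
        unfolding d_def by (rule linear_cmul[OF bounded_linear.linear[OF bl]])
      ultimately show ?thesis by simp
    qed
    ultimately have "(\<lambda>k. ?D (d k)) \<longlonglongrightarrow> 0" by (simp add: tendsto_norm_zero_iff)
    then have "(\<lambda>k. ?D (d (r k))) \<longlonglongrightarrow> 0" using LIMSEQ_subseq_LIMSEQ[OF _ vr(2)] by (simp add: o_def)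
    moreover have "(\<lambda>k. ?D (d (r k))) \<longlonglongrightarrow> ?D v"
      using bounded_linear.tendsto[OF bl vr(3)] by (simp add: o_def)
    ultimately show ?thesis using LIMSEQ_unique by blast
  qed
  then have "v \<in> tangent_space V x" unfolding tangent_space_vanishing by blast
  then have "v = 0" using I vI unfolding determines_def by blast
  then show False using vr(1) by simp
qed

section \<open>Generic tangent dimension\<close>

text \<open>
  Take \<open>I\<close> of least size among the index sets that determine the tangent space generically; by the
  dichotomy each of the finitely many smaller ones generically fails to do so.
\<close>

lemma generic_tangent_dim:
  fixes V :: "(complex ^ 'n::finite) set"
  assumes V: "zariski_irreducible V"
  shows "\<exists>I. generic_on axes V (\<lambda>x. determines (tangent_space V x) I \<and> vec.dim (tangent_space V x) = card I)"
proof -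
  obtain J where J: "finite J" "J \<subseteq> vanishing V" "vanishing V \<subseteq> idl polyfuns J" by (rule vanishing_generators)
  have JP: "J \<subseteq> polyfuns" using J(2) unfolding vanishing_def by auto
  have prime: "prime_on axes V" by (rule zariski_irreducible_prime_on[OF V])
  have dich: "generic_on axes V (\<lambda>x. determines (tangent_space V x) I) \<or>
      generic_on axes V (\<lambda>x. \<not> determines (tangent_space V x) I)"
    for I :: "'n set"
    using generic_dichotomy[OF prime constructible_determines[OF J(1) JP, of I]]
  proof
    assume "generic_on axes V (\<lambda>x. determines (kernel_of J x) I)"
    then have "generic_on axes V (\<lambda>x. determines (tangent_space V x) I)"
      by (rule generic_on_mono) (simp add: tangent_space_kernel[OF J(2,3)])
    then show ?thesis ..
  next
    assume "generic_on axes V (\<lambda>x. \<not> determines (kernel_of J x) I)"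
    then have "generic_on axes V (\<lambda>x. \<not> determines (tangent_space V x) I)"
      by (rule generic_on_mono) (simp add: tangent_space_kernel[OF J(2,3)])
    then show ?thesis ..
  qed
  let ?G = "{I :: 'n set. generic_on axes V (\<lambda>x. determines (tangent_space V x) I)}"
  have "UNIV \<in> ?G" using generic_on_always[OF prime] by (auto simp: determines_def vec_eq_iff)
  then obtain I where I: "I \<in> ?G" "\<And>I'. I' \<in> ?G \<Longrightarrow> card I \<le> card I'"
    using ex_has_least_nat[of "\<lambda>I. I \<in> ?G" UNIV card] by blast
  have "generic_on axes V (\<lambda>x. \<forall>I'\<in>{I'. card I' < card I}. \<not> determines (tangent_space V x) I')"
  proof (rule generic_on_ball[OF prime])
    fix I' :: "'n set" assume "I' \<in> {I'. card I' < card I}"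
    then have "I' \<notin> ?G" using I(2)[of I'] by auto
    then show "generic_on axes V (\<lambda>x. \<not> determines (tangent_space V x) I')" using dich[of I'] by blast
  qed simp
  moreover have "generic_on axes V (\<lambda>x. determines (tangent_space V x) I)" using I(1) by simp
  ultimately have "generic_on axes V (\<lambda>x. determines (tangent_space V x) I \<and>
      (\<forall>I'\<in>{I'. card I' < card I}. \<not> determines (tangent_space V x) I'))"
    by (intro generic_on_conj[OF prime])
  then have "generic_on axes V (\<lambda>x. determines (tangent_space V x) I \<and> vec.dim (tangent_space V x) = card I)"
  proof (rule generic_on_mono)
    fix x assume a: "determines (tangent_space V x) I \<and> (\<forall>I'\<in>{I'. card I' < card I}. \<not> determines (tangent_space V x) I')"
    obtain I' where "determines (tangent_space V x) I'" "card I' = vec.dim (tangent_space V x)"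
      using determines_ex[OF subspace_tangent_space] by blast
    then have "\<not> vec.dim (tangent_space V x) < card I" using a by auto
    then show "determines (tangent_space V x) I \<and> vec.dim (tangent_space V x) = card I"
      using a determines_dim_le[OF subspace_tangent_space, of V x I] by auto
  qed
  then show ?thesis by blast
qed

section \<open>Algebraic independence on a variety\<close>

text \<open>
  Tuples of length \<open>r\<close> are padded with zeros, so that tuples of all lengths are assignments to the
  same variables.
\<close>

definition tup :: "nat \<Rightarrow> (nat \<Rightarrow> 'a \<Rightarrow> complex) \<Rightarrow> 'a \<Rightarrow> nat \<Rightarrow> complex" where
  "tup r f x = (\<lambda>k. if k < r then f k x else 0)"

definition trunc :: "nat \<Rightarrow> (nat \<Rightarrow> complex) \<Rightarrow> nat \<Rightarrow> complex" where
  "trunc r e = (\<lambda>k. if k < r then e k else 0)"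

text \<open>
  Algebraic independence of \<open>f 0, \<dots>, f (r - 1)\<close> on \<open>V\<close>: a relation that holds on \<open>V\<close> is zero as a
  polynomial in the first \<open>r\<close> variables.
\<close>

definition indep :: "'a set \<Rightarrow> nat \<Rightarrow> (nat \<Rightarrow> 'a \<Rightarrow> complex) \<Rightarrow> bool" where
  "indep V r f \<longleftrightarrow> (\<forall>g\<in>alg coords. (\<forall>x\<in>V. g (tup r f x) = 0) \<longrightarrow> (\<forall>e. g (trunc r e) = 0))"

lemma indepD: "indep V r f \<Longrightarrow> g \<in> alg coords \<Longrightarrow> (\<And>x. x \<in> V \<Longrightarrow> g (tup r f x) = 0) \<Longrightarrow> g (trunc r e) = 0"
  unfolding indep_def by blast

lemma alg_tup:
  assumes "g \<in> alg coords" "\<And>k. k < r \<Longrightarrow> f k \<in> polyfuns"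
  shows "(\<lambda>x. g (tup r f x)) \<in> polyfuns"
proof (rule alg_compose[OF assms(1)])
  fix a :: "(nat \<Rightarrow> complex) \<Rightarrow> complex" assume "a \<in> coords"
  then obtain k where a: "a = (\<lambda>e. e k)" by (auto simp: coords_def)
  show "(\<lambda>x. a (tup r f x)) \<in> polyfuns"
    using assms(2)[of k] by (cases "k < r") (auto simp: a tup_def intro: alg_const)
qed

lemma alg_trunc:
  assumes "g \<in> alg coords" shows "(\<lambda>e. g (trunc r e)) \<in> alg coords"
proof (rule alg_compose[OF assms])
  fix a :: "(nat \<Rightarrow> complex) \<Rightarrow> complex" assume "a \<in> coords"
  then obtain k where a: "a = (\<lambda>e. e k)" by (auto simp: coords_def)
  show "(\<lambda>x. a (trunc r x)) \<in> alg coords"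
    by (cases "k < r") (auto simp: a trunc_def intro: alg_const)
qed

lemma trunc_tup: "r' \<le> r \<Longrightarrow> trunc r' (tup r f x) = tup r' f x"
  by (auto simp: trunc_def tup_def)

lemma indep_mono:
  assumes "indep V r f" "r' \<le> r" shows "indep V r' f"
  unfolding indep_def
proof (intro ballI impI allI)
  fix g e assume g: "g \<in> alg coords" "\<forall>x\<in>V. g (tup r' f x) = 0"
  have "g (trunc r' (trunc r e)) = 0"
    by (rule indepD[OF assms(1) alg_trunc[OF g(1)]]) (use g(2) assms(2) in \<open>simp add: trunc_tup\<close>)
  moreover have "trunc r' (trunc r e) = trunc r' e" using assms(2) by (auto simp: trunc_def)
  ultimately show "g (trunc r' e) = 0" by simp
qed

text \<open>
  Regard a relation on \<open>V\<close> as a polynomial in \<open>h\<close>. If its first \<open>k\<close> coefficients are zero, the factor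
  \<open>h ^ k\<close> can be cancelled, because \<open>V\<close> is irreducible. What is left restricts on \<open>W\<close>, where \<open>h\<close>
  vanishes, to its coefficient at \<open>k\<close>, which is zero by independence on \<open>W\<close>.
\<close>

lemma indep_extend:
  fixes V :: "(complex ^ 'n::finite) set"
  assumes V: "zariski_irreducible V" and WV: "W \<subseteq> V" and f: "\<And>k. k < r \<Longrightarrow> f k \<in> polyfuns" and W: "indep W r f"
    and h: "h \<in> polyfuns" "\<And>x. x \<in> W \<Longrightarrow> h x = 0" "\<exists>x\<in>V. h x \<noteq> 0"
  shows "indep V (Suc r) (f(r := h))"
  unfolding indep_def
proof (intro ballI impI allI)
  fix g e0 assume g: "g \<in> alg coords" "\<forall>x\<in>V. g (tup (Suc r) (f(r := h)) x) = 0"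
  obtain d q where q: "polyfam coords d q" "\<forall>e y. g (e(r := y)) = poly (q e) y"
    using alg_coords_polyfam[OF g(1)] by blast
  have tup: "tup (Suc r) (f(r := h)) x = (tup r f x)(r := h x)" for x by (auto simp: tup_def)
  have zero: "poly (q (tup r f x)) (h x) = 0" if "x \<in> V" for x
    using g(2) that q(2)[rule_format, of "tup r f x" "h x"] by (simp add: tup del: fun_upd_apply)
  have coeff0: "coeff (q (trunc r e)) k = 0" for e k
  proof (induction k arbitrary: e rule: less_induct)
    case (less k)
    let ?s = "\<lambda>e y. \<Sum>j\<in>{k..max k d}. coeff (q e) j * y ^ (j - k)"
    have split: "poly (q (trunc r e)) y = y ^ k * ?s (trunc r e) y" for e y
    proof -
      have "poly (q (trunc r e)) y = (\<Sum>j\<le>max k d. coeff (q (trunc r e)) j * y ^ j)"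
      proof -
        have "degree (q (trunc r e)) \<le> d" using q(1) unfolding polyfam_def by blast
        then show ?thesis unfolding poly_altdef
          by (intro sum.mono_neutral_left) (auto simp: coeff_eq_0)
      qed
      also have "\<dots> = (\<Sum>j\<in>{k..max k d}. coeff (q (trunc r e)) j * y ^ j)"
        by (rule sum.mono_neutral_right) (auto simp: less.IH)
      also have "\<dots> = y ^ k * ?s (trunc r e) y" unfolding sum_distrib_left
      proof (rule sum.cong[OF refl])
        fix j assume "j \<in> {k..max k d}"
        then have "y ^ j = y ^ k * y ^ (j - k)" by (simp add: power_add[symmetric])
        then show "coeff (q (trunc r e)) j * y ^ j = y ^ k * (coeff (q (trunc r e)) j * y ^ (j - k))" by simp
      qed
      finally show ?thesis .
    qed
    have tt: "trunc r (tup r f x) = tup r f x" for x by (simp add: trunc_tup)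
    have prod: "h x ^ k * ?s (tup r f x) (h x) = 0" if "x \<in> V" for x
      using zero[OF that] split[of "tup r f x" "h x"] unfolding tt by simp
    have cP: "(\<lambda>x. coeff (q (tup r f x)) j) \<in> polyfuns" for j
      by (rule alg_tup[OF polyfam_coeff[OF q(1)] f])
    have "(\<forall>x\<in>V. h x ^ k = 0) \<or> (\<forall>x\<in>V. ?s (tup r f x) (h x) = 0)"
    proof (rule prime_onD[OF zariski_irreducible_prime_on[OF V]])
      show "(\<lambda>x. ?s (tup r f x) (h x)) \<in> polyfuns"
        by (intro alg_sum alg_mult cP alg_power h(1))
      show "(\<lambda>x. h x ^ k) \<in> polyfuns" by (intro alg_power h(1))
    qed (rule prod)
    moreover have "\<not> (\<forall>x\<in>V. h x ^ k = 0)" using h(3) by (metis power_not_zero)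
    ultimately have s0: "?s (tup r f x) (h x) = 0" if "x \<in> V" for x using that by blast
    have sc: "?s e' 0 = coeff (q e') k" for e'
    proof -
      have "?s e' 0 = (\<Sum>j\<in>{k..max k d}. if j = k then coeff (q e') k else 0)"
        by (intro sum.cong) auto
      then show ?thesis by simp
    qed
    have "coeff (q (tup r f x)) k = 0" if "x \<in> W" for x
      using s0[of x] h(2)[OF that] that WV sc[of "tup r f x"] by auto
    then show ?case by (intro indepD[OF W polyfam_coeff[OF q(1)]])
  qed
  have "trunc (Suc r) e0 = (trunc r e0)(r := e0 r)" by (auto simp: trunc_def less_Suc_eq)
  moreover have "q (trunc r e0) = 0" using coeff0 by (intro poly_eqI) simp
  ultimately show "g (trunc (Suc r) e0) = 0" using q(2)[rule_format, of "trunc r e0" "e0 r"] by simp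
qed

text \<open>
  The values of the family contain a set \<open>g \<noteq> 0\<close>. For \<open>c\<close> the last coordinate of a point of that set,
  the first \<open>r\<close> functions still take generic values on the slice \<open>f r = c\<close>. If they were
  dependent on every component of the slice, the product of the relations would be satisfied by
  these generic values.
\<close>

lemma indep_slice:
  fixes V :: "(complex ^ 'n::finite) set"
  assumes V: "zariski_closed V" and f: "\<And>k. k < Suc r \<Longrightarrow> f k \<in> polyfuns" and ind: "indep V (Suc r) f"
  shows "\<exists>W. zariski_closed W \<and> zariski_irreducible W \<and> W \<subset> V \<and> indep W r f"
proof -
  let ?C = "coords :: ((nat + 'n \<Rightarrow> complex) \<Rightarrow> complex) set"
  let ?v = "\<lambda>e :: nat + 'n \<Rightarrow> complex. \<chi> i. e (Inr i)"
  have Pv: "(\<lambda>e. p (?v e)) \<in> alg ?C" if "p \<in> polyfuns" for p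
    by (rule alg_compose[OF that]) (auto simp: axes_def)
  define B where "B e \<longleftrightarrow> (\<exists>x\<in>V. \<forall>k<Suc r. f k x = e k)" for e :: "nat \<Rightarrow> complex"
  have cV: "constructible ?C (\<lambda>e. ?v e \<in> V)"
    by (rule constructible_compose[OF constructible_closed[OF V]]) (auto simp: axes_def)
  have "constructible ?C (\<lambda>e. ?v e \<in> V \<and> (\<forall>k\<in>{..<Suc r}. f k (?v e) = e (Inl k)))"
    by (intro constructible_conj cV constructible_ball constructible_eq Pv f alg_coord) auto
  then have "constructible ?C (\<lambda>e. \<exists>e'. (\<forall>w. w \<notin> range Inr \<longrightarrow> e' w = e w) \<and>
      ?v e' \<in> V \<and> (\<forall>k\<in>{..<Suc r}. f k (?v e') = e' (Inl k)))"
    by (intro constructible_ex) auto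
  then have "constructible coords (\<lambda>e0 :: nat \<Rightarrow> complex. \<exists>e'. (\<forall>w. w \<notin> range Inr \<longrightarrow> e' w = (case_sum e0 (\<lambda>_. 0) :: nat + 'n \<Rightarrow> complex) w) \<and>
      ?v e' \<in> V \<and> (\<forall>k\<in>{..<Suc r}. f k (?v e') = e' (Inl k)))"
  proof (rule constructible_compose)
    fix a :: "(nat + 'n \<Rightarrow> complex) \<Rightarrow> complex" assume "a \<in> ?C"
    then obtain w where a: "a = (\<lambda>e. e w)" by (auto simp: coords_def)
    show "(\<lambda>e0. a (case_sum e0 (\<lambda>_. 0))) \<in> alg coords"
      unfolding a by (cases w) (auto intro: alg_const)
  qed
  moreover have "(\<exists>e'. (\<forall>w. w \<notin> range Inr \<longrightarrow> e' w = (case_sum e0 (\<lambda>_. 0) :: nat + 'n \<Rightarrow> complex) w) \<and>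
      ?v e' \<in> V \<and> (\<forall>k\<in>{..<Suc r}. f k (?v e') = e' (Inl k))) \<longleftrightarrow> B e0" for e0
  proof
    assume "\<exists>e'. (\<forall>w. w \<notin> range Inr \<longrightarrow> e' w = (case_sum e0 (\<lambda>_. 0) :: nat + 'n \<Rightarrow> complex) w) \<and>
      ?v e' \<in> V \<and> (\<forall>k\<in>{..<Suc r}. f k (?v e') = e' (Inl k))"
    then obtain e' where e': "\<forall>w. w \<notin> range Inr \<longrightarrow> e' w = (case_sum e0 (\<lambda>_. 0) :: nat + 'n \<Rightarrow> complex) w"
      "?v e' \<in> V" "\<forall>k\<in>{..<Suc r}. f k (?v e') = e' (Inl k)" by blast
    have "e' (Inl k) = e0 k" for k using e'(1)[rule_format, of "Inl k"] by auto
    then show "B e0" unfolding B_def using e'(2,3) by (intro bexI[of _ "?v e'"]) auto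
  next
    assume "B e0"
    then obtain x where x: "x \<in> V" "\<forall>k<Suc r. f k x = e0 k" unfolding B_def by blast
    let ?e = "case_sum e0 (\<lambda>i. x $ i) :: nat + 'n \<Rightarrow> complex"
    have "?v ?e = x" by (simp add: vec_eq_iff)
    moreover have "\<forall>w. w \<notin> range Inr \<longrightarrow> ?e w = (case_sum e0 (\<lambda>_. 0) :: nat + 'n \<Rightarrow> complex) w"
      by (auto split: sum.splits)
    ultimately show "\<exists>e'. (\<forall>w. w \<notin> range Inr \<longrightarrow> e' w = (case_sum e0 (\<lambda>_. 0) :: nat + 'n \<Rightarrow> complex) w) \<and>
      ?v e' \<in> V \<and> (\<forall>k\<in>{..<Suc r}. f k (?v e') = e' (Inl k))"
      using x by (intro exI[of _ ?e]) auto
  qed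
  ultimately have "constructible coords B" by simp
  from generic_dichotomy[OF prime_on_coords this]
  have dich: "generic_on coords UNIV B \<or> generic_on coords UNIV (\<lambda>e. \<not> B e)" .
  \<comment> \<open>The variables from Suc r on are frozen at a point where g does not vanish.\<close>
  have mix: "(\<lambda>e. g (\<lambda>k. if k < Suc r then e k else e2 k)) \<in> alg coords" if "g \<in> alg coords" for g e2
  proof (rule alg_compose[OF that])
    fix a :: "(nat \<Rightarrow> complex) \<Rightarrow> complex" assume "a \<in> coords"
    then obtain k where a: "a = (\<lambda>e. e k)" by (auto simp: coords_def)
    show "(\<lambda>e. a (\<lambda>k. if k < Suc r then e k else e2 k)) \<in> alg coords"
      by (cases "k < Suc r") (auto simp: a intro: alg_const)
  qed
  have "\<not> generic_on coords UNIV (\<lambda>e. \<not> B e)"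
  proof
    assume "generic_on coords UNIV (\<lambda>e. \<not> B e)"
    then obtain g e2 where g: "g \<in> alg coords" "g e2 \<noteq> 0" "\<forall>e. g e \<noteq> 0 \<longrightarrow> \<not> B e" unfolding generic_on_def by auto
    have "(\<lambda>e. g (\<lambda>k. if k < Suc r then e k else e2 k)) (trunc (Suc r) e2) = 0"
    proof (rule indepD[OF ind mix[OF g(1)]])
      fix x assume x: "x \<in> V"
      have "B (\<lambda>k. if k < Suc r then tup (Suc r) f x k else e2 k)"
        unfolding B_def using x by (intro bexI[of _ x]) (auto simp: tup_def)
      then show "g (\<lambda>k. if k < Suc r then tup (Suc r) f x k else e2 k) = 0" using g(3) by blast
    qed
    moreover have "(\<lambda>k. if k < Suc r then trunc (Suc r) e2 k else e2 k) = e2" by (auto simp: trunc_def)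
    ultimately show False using g(2) by simp
  qed
  then obtain g e2 where g: "g \<in> alg coords" "g e2 \<noteq> 0" "\<forall>e. g e \<noteq> 0 \<longrightarrow> B e"
    using dich unfolding generic_on_def by auto
  define c where "c = e2 r"
  have "zariski_closed {x. f r x - c = 0}" by (rule zariski_closed_zero) (intro alg_diff f alg_const, simp)
  then have slice: "zariski_closed (V \<inter> {x. f r x = c})" using zariski_closed_Int[OF V] by simp
  obtain \<Z> where Z: "finite \<Z>" "\<forall>Z\<in>\<Z>. zariski_closed Z \<and> zariski_irreducible Z" "V \<inter> {x. f r x = c} = \<Union>\<Z>"
    using zariski_components[OF slice] by blast
  have "\<exists>Z\<in>\<Z>. indep Z r f"
  proof (rule ccontr)
    assume no: "\<not> (\<exists>Z\<in>\<Z>. indep Z r f)"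
    have "\<exists>gZ. gZ \<in> alg coords \<and> (\<forall>x\<in>Z. gZ (tup r f x) = 0) \<and> (\<exists>e. gZ (trunc r e) \<noteq> 0)" if "Z \<in> \<Z>" for Z
      using no that unfolding indep_def by blast
    then have "\<forall>Z\<in>\<Z>. \<exists>gZ. gZ \<in> alg coords \<and> (\<forall>x\<in>Z. gZ (tup r f x) = 0) \<and> (\<exists>e. gZ (trunc r e) \<noteq> 0)"
      by blast
    from bchoice[OF this] obtain G where G': "\<forall>Z\<in>\<Z>. G Z \<in> alg coords \<and> (\<forall>x\<in>Z. G Z (tup r f x) = 0) \<and>
        (\<exists>e. G Z (trunc r e) \<noteq> 0)" ..
    have G: "G Z \<in> alg coords" "x \<in> Z \<Longrightarrow> G Z (tup r f x) = 0" "\<exists>e. G Z (trunc r e) \<noteq> 0"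
      if "Z \<in> \<Z>" for Z x
      using bspec[OF G' that] by auto
    have "generic_on coords UNIV (\<lambda>e. \<forall>Z\<in>\<Z>. G Z (trunc r e) \<noteq> 0)"
    proof (rule generic_on_ball[OF prime_on_coords Z(1)])
      fix Z assume "Z \<in> \<Z>"
      then show "generic_on coords UNIV (\<lambda>e. G Z (trunc r e) \<noteq> 0)" unfolding generic_on_def
        using G(3) by (intro bexI[OF _ alg_trunc[OF G(1)]]) auto
    qed
    moreover have "generic_on coords UNIV (\<lambda>e. g (\<lambda>k. if k < r then e k else e2 k) \<noteq> 0)"
    proof -
      have "(\<lambda>e. g (\<lambda>k. if k < r then e k else e2 k)) \<in> alg coords"
      proof (rule alg_compose[OF g(1)])
        fix a :: "(nat \<Rightarrow> complex) \<Rightarrow> complex" assume "a \<in> coords"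
        then obtain k where a: "a = (\<lambda>e. e k)" by (auto simp: coords_def)
        show "(\<lambda>e. a (\<lambda>k. if k < r then e k else e2 k)) \<in> alg coords"
          by (cases "k < r") (auto simp: a intro: alg_const)
      qed
      moreover have "(\<lambda>k. if k < r then e2 k else e2 k) = e2" by auto
      ultimately show ?thesis unfolding generic_on_def using g(2)
        by (intro bexI[of _ "\<lambda>e. g (\<lambda>k. if k < r then e k else e2 k)"]) (auto intro!: exI[of _ e2])
    qed
    ultimately have "generic_on coords UNIV (\<lambda>e. (\<forall>Z\<in>\<Z>. G Z (trunc r e) \<noteq> 0) \<and> g (\<lambda>k. if k < r then e k else e2 k) \<noteq> 0)"
      by (rule generic_on_conj[OF prime_on_coords])
    from generic_on_ex[OF this] obtain e where e: "\<forall>Z\<in>\<Z>. G Z (trunc r e) \<noteq> 0"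
      "g (\<lambda>k. if k < r then e k else e2 k) \<noteq> 0" by blast
    then have "B (\<lambda>k. if k < r then e k else e2 k)" using g(3) by blast
    then obtain x where x: "x \<in> V" "\<forall>k<Suc r. f k x = (if k < r then e k else e2 k)" unfolding B_def by blast
    then have "x \<in> V \<inter> {x. f r x = c}" unfolding c_def by auto
    then obtain Z' where Z': "Z' \<in> \<Z>" "x \<in> Z'" using Z(3) by blast
    have "tup r f x = trunc r e" using x(2) by (auto simp: tup_def trunc_def)
    then show False using G(2)[OF Z'] e(1) Z'(1) by auto
  qed
  then obtain W where W: "W \<in> \<Z>" "indep W r f" by blast
  have "W \<subseteq> V" using W(1) Z(3) by blast
  moreover have "W \<noteq> V"
  proof
    assume "W = V"
    then have "f r x = c" if "x \<in> V" for x using W(1) Z(3) that by blast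
    then have "(\<lambda>e. e r - c) (trunc (Suc r) (\<lambda>_. c + 1)) = 0"
      by (intro indepD[OF ind alg_diff[OF alg_coord alg_const]]) (simp add: tup_def)
    then show False by (simp add: trunc_def)
  qed
  ultimately show ?thesis using W Z(2) by blast
qed

section \<open>Independent functions are at most as many as tangent directions\<close>

lemma polyfun_differentiable: "f \<in> polyfuns \<Longrightarrow> f differentiable (at x)"
  using polyfun_has_derivative unfolding differentiable_def by blast

lemma differentiable_locally_lipschitz:
  assumes "f differentiable (at x)"
  shows "\<exists>k::nat. \<forall>y. dist x y < 1 / Suc k \<longrightarrow> norm (f y - f x) \<le> Suc k * norm (y - x)"
proof -
  let ?D = "frechet_derivative f (at x)"
  have der: "(f has_derivative ?D) (at x)" using assms frechet_derivative_works by blast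
  then obtain d where d: "d > 0" "\<forall>y. norm (y - x) < d \<longrightarrow> norm (f y - f x - ?D (y - x)) \<le> 1 * norm (y - x)"
    unfolding has_derivative_at_alt by (metis zero_less_one)
  obtain K where K: "\<And>v. norm (?D v) \<le> norm v * K"
    using bounded_linear.bounded[OF has_derivative_bounded_linear[OF der]] by blast
  obtain k :: nat where k: "real k > max (1 / d) (K + 1)" using reals_Archimedean2 by blast
  have "norm (f y - f x) \<le> Suc k * norm (y - x)" if y: "dist x y < 1 / Suc k" for y
  proof -
    have "1 / d < Suc k" using k by simp
    then have "1 / Suc k < d" using d(1) by (simp add: field_simps)
    then have "norm (y - x) < d" using y by (simp add: dist_norm norm_minus_commute)
    then have "norm (f y - f x - ?D (y - x)) \<le> norm (y - x)" using d(2) by simp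
    then have "norm (f y - f x) \<le> norm (y - x) + norm (?D (y - x))"
      using norm_triangle_sub[of "f y - f x" "?D (y - x)"] by simp
    also have "\<dots> \<le> norm (y - x) * (K + 1)" using K[of "y - x"] by (simp add: algebra_simps)
    also have "\<dots> \<le> norm (y - x) * Suc k" using k by (intro mult_left_mono) auto
    finally show ?thesis by (simp add: mult.commute)
  qed
  then show ?thesis by blast
qed

lemma norm_vec_le_sum: "norm (v :: complex ^ 'n::finite) \<le> (\<Sum>i\<in>UNIV. norm (v $ i))"
  unfolding norm_vec_def by (rule L2_set_le_sum) simp

lemma norm_restrict_to_le:
  assumes "\<And>i. i \<in> I \<Longrightarrow> norm (v $ i) \<le> norm (w $ i)"
  shows "norm (restrict_to I v) \<le> norm w"
  unfolding norm_vec_def restrict_to_def by (rule L2_set_mono) (use assms in auto)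

lemma continuous_alg:
  assumes "g \<in> alg A" "\<And>a. a \<in> A \<Longrightarrow> continuous_on S (\<lambda>z. a (\<iota> z))"
  shows "continuous_on S (\<lambda>z. g (\<iota> z))"
  using assms by (induction rule: alg.induct) (auto intro!: continuous_intros)

text \<open>
  Coordinates in \<open>I\<close> are taken from the first vector, the others from the second.
\<close>

definition glue :: "'n set \<Rightarrow> complex ^ 'n \<Rightarrow> complex ^ 'n \<Rightarrow> complex ^ 'n::finite" where
  "glue I x y = (\<chi> i. if i \<in> I then x $ i else y $ i)"

lemma glue_nth: "glue I x y $ i = (if i \<in> I then x $ i else y $ i)"
  by (simp add: glue_def)

text \<open>
  The point \<open>x\<close> is locally determined by its coordinates in \<open>I\<close>, so \<open>f0\<close> is one function more than
  there are parameters. The free coordinates \<open>y\<close> outside \<open>I\<close> on both sides make the two dimensions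
  independent of the size of \<open>I\<close>.
\<close>

lemma negligible_independent_image:
  fixes V :: "(complex ^ 'n::finite) set"
  assumes f: "f0 \<in> polyfuns" "\<And>i. f i \<in> polyfuns"
    and Y: "\<And>x. x \<in> Y \<Longrightarrow> x \<in> V \<and> determines (tangent_space V x) I"
  shows "negligible ((\<lambda>(x, y). (f0 x, glue I (\<chi> i. f i x) y)) ` (Y \<times> UNIV))"
proof (rule negligible_locally_determined_image[where \<kappa> = "\<lambda>(x, y). glue I x y"])
  fix z :: "(complex ^ 'n) \<times> (complex ^ 'n)" assume "z \<in> Y \<times> UNIV"
  then obtain x y where z: "z = (x, y)" "x \<in> V" "determines (tangent_space V x) I" using Y by auto
  obtain k where k: "\<forall>y\<in>V. dist x y < 1 / Suc k \<longrightarrow> norm (y - x) \<le> Suc k * norm (restrict_to I (y - x))"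
    using variety_locally_determined[OF z(2,3)] by blast
  obtain k0 where k0: "\<forall>y. dist x y < 1 / Suc k0 \<longrightarrow> norm (f0 y - f0 x) \<le> Suc k0 * norm (y - x)"
    using differentiable_locally_lipschitz[OF polyfun_differentiable[OF f(1)]] by blast
  have "\<exists>k::nat. \<forall>y. dist x y < 1 / Suc k \<longrightarrow> norm (f i y - f i x) \<le> Suc k * norm (y - x)" for i
    using differentiable_locally_lipschitz[OF polyfun_differentiable[OF f(2)]] by blast
  then obtain l where l: "\<And>i y. dist x y < 1 / Suc (l i) \<Longrightarrow> norm (f i y - f i x) \<le> Suc (l i) * norm (y - x)" by metis
  define L where "L = k + k0 + (\<Sum>i\<in>UNIV. l i)"
  have li: "l i \<le> L" for i
  proof -
    have "l i \<le> (\<Sum>i\<in>UNIV. l i)" by (rule member_le_sum) auto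
    then show ?thesis by (simp add: L_def)
  qed
  have kL: "k \<le> L" "k0 \<le> L" by (auto simp: L_def)
  define m where "m = Suc L * Suc L * (1 + CARD('n)) + CARD('n)"
  show "\<exists>m::nat. \<forall>z'\<in>Y \<times> UNIV. dist z z' < 1 / Suc m \<longrightarrow>
      dist (case z of (x, y) \<Rightarrow> (f0 x, glue I (\<chi> i. f i x) y)) (case z' of (x, y) \<Rightarrow> (f0 x, glue I (\<chi> i. f i x) y))
        \<le> Suc m * dist (case z of (x, y) \<Rightarrow> glue I x y) (case z' of (x, y) \<Rightarrow> glue I x y)"
  proof (intro exI[of _ m] ballI impI)
    fix z' :: "(complex ^ 'n) \<times> (complex ^ 'n)" assume "z' \<in> Y \<times> UNIV" and dz: "dist z z' < 1 / Suc m"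
    then obtain x' y' where z': "z' = (x', y')" "x' \<in> V" using Y by auto
    have "dist x x' \<le> dist z z'" unfolding z(1) z'(1) dist_Pair_Pair by (rule real_sqrt_sum_squares_ge1)
    moreover have small: "1 / Suc m \<le> 1 / Suc j" if "j \<le> L" for j
    proof -
      have "L \<le> m" unfolding m_def by (simp add: algebra_simps)
      then show ?thesis using that by (simp add: divide_simps)
    qed
    ultimately have dx: "dist x x' < 1 / Suc j" if "j \<le> L" for j using dz small[OF that] by linarith
    define \<delta> where "\<delta> = norm (glue I x' y' - glue I x y)"
    have "norm (restrict_to I (x' - x)) \<le> \<delta>"
      unfolding \<delta>_def by (rule norm_restrict_to_le) (simp add: glue_nth)
    moreover have "norm (x' - x) \<le> Suc k * norm (restrict_to I (x' - x))" using k dx[OF kL(1)] z'(2) by blast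
    moreover have "real (Suc k) \<le> Suc L" using kL by simp
    ultimately have xd: "norm (x' - x) \<le> Suc L * \<delta>"
      by (meson mult_mono norm_ge_zero of_nat_0_le_iff order_trans)
    have step: "norm (p x' - p x) \<le> Suc L * Suc L * \<delta>"
      if "norm (p x' - p x) \<le> Suc j * norm (x' - x)" "j \<le> L" for p :: "complex ^ 'n \<Rightarrow> complex" and j
    proof -
      have "norm (p x' - p x) \<le> Suc j * norm (x' - x)" by (rule that(1))
      also have "\<dots> \<le> Suc L * norm (x' - x)" using that(2) by (intro mult_right_mono) auto
      also have "\<dots> \<le> Suc L * (Suc L * \<delta>)" using xd by (intro mult_left_mono) auto
      finally show ?thesis by (simp only: mult.assoc of_nat_mult)
    qed
    have f0d: "norm (f0 x' - f0 x) \<le> Suc L * Suc L * \<delta>"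
      by (rule step[OF _ kL(2)]) (use k0 dx[OF kL(2)] in blast)
    have \<delta>0: "0 \<le> \<delta>" by (simp add: \<delta>_def)
    have comp: "norm ((glue I (\<chi> i. f i x') y' - glue I (\<chi> i. f i x) y) $ i) \<le> (Suc L * Suc L + 1) * \<delta>" for i
    proof (cases "i \<in> I")
      case True
      have "norm (f i x' - f i x) \<le> Suc L * Suc L * \<delta>" by (rule step[OF l[OF dx[OF li]] li])
      then show ?thesis using True \<delta>0 by (simp add: glue_nth algebra_simps)
    next
      case False
      have "norm ((glue I x' y' - glue I x y) $ i) \<le> \<delta>" unfolding \<delta>_def by (rule Finite_Cartesian_Product.norm_nth_le)
      moreover have "\<delta> \<le> (Suc L * Suc L + 1) * \<delta>" using \<delta>0 by (simp add: mult_left_mono algebra_simps)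
      ultimately show ?thesis using False by (simp add: glue_nth)
    qed
    have "norm (glue I (\<chi> i. f i x') y' - glue I (\<chi> i. f i x) y) \<le> (\<Sum>i\<in>(UNIV :: 'n set). (Suc L * Suc L + 1) * \<delta>)"
      by (rule order_trans[OF norm_vec_le_sum sum_mono]) (rule comp)
    also have "\<dots> = CARD('n) * (Suc L * Suc L + 1) * \<delta>"
      by (simp only: sum_constant mult.assoc of_nat_mult)
    finally have vd: "norm (glue I (\<chi> i. f i x') y' - glue I (\<chi> i. f i x) y) \<le> CARD('n) * (Suc L * Suc L + 1) * \<delta>" .
    have "dist (f0 x', glue I (\<chi> i. f i x') y') (f0 x, glue I (\<chi> i. f i x) y) \<le>
        norm (f0 x' - f0 x) + norm (glue I (\<chi> i. f i x') y' - glue I (\<chi> i. f i x) y)"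
      unfolding dist_norm diff_Pair by (rule norm_Pair_le)
    also have "\<dots> \<le> Suc L * Suc L * \<delta> + CARD('n) * (Suc L * Suc L + 1) * \<delta>" using f0d vd by linarith
    also have "\<dots> = real m * \<delta>"
    proof -
      have "real m = real (Suc L * Suc L) + real (CARD('n) * (Suc L * Suc L + 1))"
        unfolding m_def by (simp only: of_nat_add[symmetric] of_nat_eq_iff) (simp only: algebra_simps)
      then show ?thesis by (simp only: distrib_right of_nat_mult)
    qed
    also have "\<dots> \<le> Suc m * \<delta>" using \<delta>0 by (intro mult_right_mono) auto
    finally have "dist (f0 x', glue I (\<chi> i. f i x') y') (f0 x, glue I (\<chi> i. f i x) y) \<le> Suc m * \<delta>" .
    moreover have "dist (glue I x y) (glue I x' y') = \<delta>"
      by (simp add: \<delta>_def dist_norm norm_minus_commute)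
    ultimately show "dist (case z of (x, y) \<Rightarrow> (f0 x, glue I (\<chi> i. f i x) y)) (case z' of (x, y) \<Rightarrow> (f0 x, glue I (\<chi> i. f i x) y))
        \<le> Suc m * dist (case z of (x, y) \<Rightarrow> glue I x y) (case z' of (x, y) \<Rightarrow> glue I x y)"
      unfolding z(1) z'(1) prod.case by (simp only: dist_commute[of "(f0 x, glue I (\<chi> i. f i x) y)"])
  qed
qed


text \<open>
  If \<open>Q\<close> held generically, \<open>N\<close> would contain a nonempty open set. The target space is represented by
  the variable \<open>(2, i0)\<close> and the vector in slot \<open>0\<close>; all other variables are kept fixed.
\<close>

lemma generic_not_of_negligible:
  fixes Q :: "(nat \<times> 'n::finite \<Rightarrow> complex) \<Rightarrow> bool"
  assumes Q: "constructible coords Q" and N: "negligible N" "\<And>e. Q e \<Longrightarrow> (e (2, i0), slot e 0) \<in> N"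
  shows "generic_on coords UNIV (\<lambda>e. \<not> Q e)"
proof (rule ccontr)
  assume "\<not> ?thesis"
  then have "generic_on coords UNIV Q" using generic_dichotomy[OF prime_on_coords Q] by blast
  then obtain g e0 where g: "g \<in> alg coords" "g e0 \<noteq> 0" "\<forall>e. g e \<noteq> 0 \<longrightarrow> Q e" unfolding generic_on_def by auto
  define \<iota> where "\<iota> z = (\<lambda>(k, i). if k = 0 then snd z $ i else if (k, i) = (2, i0) then fst z else e0 (k, i))"
    for z :: "complex \<times> (complex ^ 'n)"
  have "continuous_on UNIV (\<lambda>z. g (\<iota> z))"
  proof (rule continuous_alg[OF g(1)])
    fix a :: "(nat \<times> 'n \<Rightarrow> complex) \<Rightarrow> complex" assume "a \<in> coords"
    then obtain k i where a: "a = (\<lambda>e. e (k, i))" by (auto simp: coords_def)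
    show "continuous_on UNIV (\<lambda>z. a (\<iota> z))"
      unfolding a \<iota>_def by (cases "k = 0"; cases "(k, i) = (2, i0)") (auto intro!: continuous_intros)
  qed
  then have op: "open {z. g (\<iota> z) \<noteq> 0}" by (intro open_Collect_neq continuous_intros)
  have "\<iota> (e0 (2, i0), slot e0 0) = e0" by (auto simp: \<iota>_def slot_def)
  then have "(e0 (2, i0), slot e0 0) \<in> {z. g (\<iota> z) \<noteq> 0}" using g(2) by simp
  moreover have "{z. g (\<iota> z) \<noteq> 0} \<subseteq> N"
  proof
    fix z assume "z \<in> {z. g (\<iota> z) \<noteq> 0}"
    then have "(\<iota> z (2, i0), slot (\<iota> z) 0) \<in> N" using g(3) N(2) by blast
    moreover have "(\<iota> z (2, i0), slot (\<iota> z) 0) = z" by (simp add: \<iota>_def slot_def prod_eq_iff vec_eq_iff)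
    ultimately show "z \<in> N" by simp
  qed
  ultimately show False using open_not_negligible[OF op] negligible_subset[OF N(1)] by blast
qed

text \<open>
  For one function more than \<open>card I\<close>, the set of values, extended by free coordinates outside \<open>I\<close>,
  is a null set. It is constructible, hence lies in a hypersurface, and freezing the free coordinates
  in the equation of the hypersurface leaves a relation between the functions.
\<close>

lemma indep_le_generic_tangent_dim:
  fixes V :: "(complex ^ 'n::finite) set"
  assumes V: "zariski_closed V" "zariski_irreducible V"
    and gen: "generic_on axes V (\<lambda>x. determines (tangent_space V x) I)"
    and f: "\<And>k. k < r \<Longrightarrow> f k \<in> polyfuns" and ind: "indep V r f"
  shows "r \<le> card I"
proof (rule ccontr)
  assume "\<not> r \<le> card I"
  then have r: "Suc (card I) \<le> r" by simp
  have ind': "indep V (Suc (card I)) f" by (rule indep_mono[OF ind r])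
  obtain \<sigma> where \<sigma>: "bij_betw \<sigma> I {1..card I}"
    using ex_bij_betw_finite_nat[of I] bij_betw_trans[of _ I "{0..<card I}" Suc "{1..card I}"]
    by (metis bij_betw_Suc atLeastLessThanSuc_atLeastAtMost finite_class.finite_code image_Suc_atLeastLessThan One_nat_def)
  have \<sigma>I: "\<sigma> i < Suc (card I)" "\<sigma> i \<noteq> 0" if "i \<in> I" for i
    using bij_betwE[OF \<sigma>] that by fastforce+
  obtain h where h: "h \<in> polyfuns" "\<exists>x\<in>V. h x \<noteq> 0" "\<forall>x\<in>V. h x \<noteq> 0 \<longrightarrow> determines (tangent_space V x) I"
    using gen unfolding generic_on_def by blast
  define Y where "Y = {x \<in> V. h x \<noteq> 0}"
  define F where "F i = (if i \<in> I then f (\<sigma> i) else f 0)" for i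
  have FP: "F i \<in> polyfuns" "f 0 \<in> polyfuns" for i
    using f r \<sigma>I by (auto simp: F_def intro!: f intro: less_le_trans)
  define \<pi> where "\<pi> = (\<lambda>(x, y). (f 0 x, glue I (\<chi> i. F i x) y))"
  have neg: "negligible (\<pi> ` (Y \<times> UNIV))" unfolding \<pi>_def
    by (rule negligible_independent_image[OF FP(2,1), of Y V I]) (use h(3) in \<open>auto simp: Y_def\<close>)
  let ?C = "coords :: ((nat \<times> 'n \<Rightarrow> complex) \<Rightarrow> complex) set"
  define i0 :: 'n where "i0 = (SOME i. True)"
  let ?Q = "\<lambda>e. slot e 1 \<in> V \<and> \<not> h (slot e 1) = 0 \<and> f 0 (slot e 1) = e (2, i0) \<and> (\<forall>i\<in>I. F i (slot e 1) = e (0, i))"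
  define C where "C e \<longleftrightarrow> (\<exists>x. ?Q (set_slot e 1 x))" for e :: "nat \<times> 'n \<Rightarrow> complex"
  have "constructible ?C ?Q"
    by (intro constructible_conj constructible_not constructible_zero constructible_eq constructible_ball
        constructible_slot[OF constructible_closed[OF V(1)]] alg_slot h(1) FP alg_coord) auto
  then have cC: "constructible ?C C" unfolding C_def by (rule constructible_ex_slot)
  have C_iff: "C e \<longleftrightarrow> (\<exists>x\<in>Y. f 0 x = e (2, i0) \<and> (\<forall>i\<in>I. F i x = e (0, i)))" for e
  proof -
    have "slot (set_slot e 1 x) 1 = x" for x by (simp only: slot_set_slot refl if_True)
    moreover have "set_slot e 1 x (2, i0) = e (2, i0)" "set_slot e 1 x (0, i) = e (0, i)" for x i
      by (simp_all add: set_slot_def)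
    ultimately show ?thesis unfolding C_def Y_def by simp
  qed
  have notC: "generic_on ?C UNIV (\<lambda>e. \<not> C e)"
  proof (rule generic_not_of_negligible[OF cC neg])
    fix e assume "C e"
    then obtain x where x: "x \<in> Y" "f 0 x = e (2, i0)" "\<forall>i\<in>I. F i x = e (0, i)" unfolding C_iff by blast
    have "(e (2, i0), slot e 0) = \<pi> (x, slot e 0)" using x(2,3) by (auto simp: \<pi>_def slot_def vec_eq_iff glue_nth)
    then show "(e (2, i0), slot e 0) \<in> \<pi> ` (Y \<times> UNIV)" using x(1) by blast
  qed
  obtain g e0 where g: "g \<in> alg ?C" "g e0 \<noteq> 0" "\<forall>e. g e \<noteq> 0 \<longrightarrow> \<not> C e" using notC unfolding generic_on_def by auto
  \<comment> \<open>The variables that do not carry values of f are frozen at a point where g does not vanish.\<close>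
  define \<iota> where "\<iota> e = (\<lambda>(k, i). if k = 0 \<and> i \<in> I then e (\<sigma> i) else if (k, i) = (2, i0) then e 0 else e0 (k, i))"
    for e :: "nat \<Rightarrow> complex"
  have gP: "(\<lambda>e. g (\<iota> e)) \<in> alg coords"
  proof (rule alg_compose[OF g(1)])
    fix a assume "a \<in> ?C"
    then obtain k i where a: "a = (\<lambda>e. e (k, i))" by (auto simp: coords_def)
    show "(\<lambda>e. a (\<iota> e)) \<in> alg coords"
      unfolding a \<iota>_def by (cases "k = 0 \<and> i \<in> I"; cases "(k, i) = (2, i0)") (auto intro: alg_const)
  qed
  have "h x * g (\<iota> (tup (Suc (card I)) f x)) = 0" if x: "x \<in> V" for x
  proof (cases "h x = 0")
    case False
    then have "x \<in> Y" using x by (simp add: Y_def)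
    then have "C (\<iota> (tup (Suc (card I)) f x))"
      unfolding C_iff using \<sigma>I by (intro bexI[of _ x]) (auto simp: \<iota>_def tup_def F_def)
    then show ?thesis using g(3) by auto
  qed simp
  moreover have "(\<lambda>x. g (\<iota> (tup (Suc (card I)) f x))) \<in> polyfuns"
    using alg_tup[OF gP, of "Suc (card I)" f] f r by simp
  ultimately have "(\<forall>x\<in>V. h x = 0) \<or> (\<forall>x\<in>V. g (\<iota> (tup (Suc (card I)) f x)) = 0)"
    by (intro prime_onD[OF zariski_irreducible_prime_on[OF V(2)] h(1)])
  then have gz: "g (\<iota> (tup (Suc (card I)) f x)) = 0" if "x \<in> V" for x using h(2) that by blast
  define e where "e k = (if k = 0 then e0 (2, i0) else e0 (0, the_inv_into I \<sigma> k))" for k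
  have "g (\<iota> (trunc (Suc (card I)) e)) = 0" by (rule indepD[OF ind' gP gz])
  moreover have "\<iota> (trunc (Suc (card I)) e) = e0"
    by (auto simp: \<iota>_def trunc_def e_def fun_eq_iff \<sigma>I the_inv_into_f_f[OF bij_betw_imp_inj_on[OF \<sigma>]])
  ultimately show False using g(2) by simp
qed

section \<open>Coordinates transversal to the generic tangent space are independent\<close>

lemma polyfun_on_line:
  assumes "p \<in> polyfuns" shows "\<exists>q. \<forall>s. p (x + s *s v) = poly q s"
proof -
  obtain q where "\<forall>s. p (slot (\<lambda>w. (\<lambda>(_ :: unit, i). x $ i) w + s * (\<lambda>(_ :: unit, i). v $ i) w) ()) = poly q s"
    using alg_on_line[OF alg_slot[OF assms, of "()"], of "\<lambda>(_, i). x $ i" "\<lambda>(_, i). v $ i"] by blast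
  moreover have "slot (\<lambda>w. (\<lambda>(_ :: unit, i). x $ i) w + s * (\<lambda>(_ :: unit, i). v $ i) w) () = x + s *s v" for s
    by (simp add: slot_def vec_eq_iff)
  ultimately show ?thesis by auto
qed

lemma pderiv_on_line:
  assumes p: "p \<in> polyfuns" and q: "\<And>s. p (x + s *s v) = poly q s"
  shows "frechet_derivative p (at (x + s *s v)) v = poly (pderiv q) s"
proof -
  let ?D = "frechet_derivative p (at (x + s *s v))"
  have "bounded_linear (\<lambda>h. h *s v)"
  proof (rule bounded_linearI')
    show "(a + b) *s v = a *s v + b *s v" for a b by (simp add: vec_eq_iff algebra_simps)
    show "(r *\<^sub>R b) *s v = r *\<^sub>R (b *s v)" for r b by (simp add: vec_eq_iff)
  qed
  then have "((\<lambda>s. x + s *s v) has_derivative (\<lambda>h. h *s v)) (at s)"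
    using has_derivative_add[OF has_derivative_const bounded_linear_imp_has_derivative, of "\<lambda>h. h *s v" x "at s"] by simp
  from has_derivative_compose[OF this polyfun_has_derivative[OF p]]
  have "((\<lambda>s. poly q s) has_derivative (\<lambda>h. ?D (h *s v))) (at s)" by (simp add: q)
  moreover have "(\<lambda>h. ?D (h *s v)) = (*) (?D v)" using frechet_scale[OF p] by (auto simp: mult.commute)
  ultimately have "(poly q has_field_derivative ?D v) (at s)" by (simp add: has_field_derivative_def)
  then show ?thesis using poly_DERIV DERIV_unique by blast
qed

text \<open>
  At generic points of \<open>V\<close> the tangent space maps onto the coordinates in \<open>I\<close>. So the derivative of
  \<open>p\<close> along the tangent space being zero forces all partial derivatives of \<open>p\<close> to vanish on \<open>V\<close>, and
  then all higher ones by repetition. Along a line through a point of \<open>V\<close> the function \<open>p\<close> is therefore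
  a polynomial all of whose derivatives vanish there.
\<close>

lemma vanishing_transversal:
  fixes V :: "(complex ^ 'n::finite) set"
  assumes V: "zariski_irreducible V"
    and gen: "generic_on axes V (\<lambda>x. determines (tangent_space V x) I \<and> vec.dim (tangent_space V x) = card I)"
    and p: "p \<in> alg ((\<lambda>i x. x $ i) ` I)" "\<And>x. x \<in> V \<Longrightarrow> p x = 0"
  shows "p x = 0"
proof -
  have AP: "f \<in> polyfuns" if "f \<in> alg ((\<lambda>i x. x $ i) ` I)" for f :: "complex ^ 'n \<Rightarrow> complex"
    using that by (rule alg_mono[rotated]) auto
  obtain h where h: "h \<in> polyfuns" "\<exists>x\<in>V. h x \<noteq> 0"
    "\<forall>x\<in>V. h x \<noteq> 0 \<longrightarrow> determines (tangent_space V x) I \<and> vec.dim (tangent_space V x) = card I"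
    using gen unfolding generic_on_def by blast
  have step: "partial f i x = 0" if f: "f \<in> alg ((\<lambda>i x. x $ i) ` I)" "\<And>x. x \<in> V \<Longrightarrow> f x = 0" and x: "x \<in> V" for f i x
  proof (cases "i \<in> I")
    case False
    then show ?thesis by (rule partial_outside[OF f(1)])
  next
    case True
    have "h x * partial f i x = 0" if x: "x \<in> V" for x
    proof (cases "h x = 0")
      case False
      then obtain b where b: "dual_family (tangent_space V x) I b"
        using determines_dual[OF subspace_tangent_space] h(3) x by metis
      have "f \<in> vanishing V" using f AP unfolding vanishing_def by blast
      then have "0 = frechet_derivative f (at x) (b i)"
        using b True unfolding dual_family_def tangent_space_vanishing by auto
      also have "\<dots> = (\<Sum>k\<in>UNIV. partial f k x * b i $ k)" by (rule frechet_partial_on[OF f(1)])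
      also have "\<dots> = (\<Sum>k\<in>UNIV. if k = i then partial f i x else 0)"
      proof (rule sum.cong[OF refl])
        fix k
        show "partial f k x * b i $ k = (if k = i then partial f i x else 0)"
          using b True partial_outside[OF f(1), of k x] unfolding dual_family_def by (cases "k \<in> I") auto
      qed
      finally show ?thesis by simp
    qed simp
    then have "(\<forall>x\<in>V. h x = 0) \<or> (\<forall>x\<in>V. partial f i x = 0)"
      by (intro prime_onD[OF zariski_irreducible_prime_on[OF V] h(1) partial_polyfun[OF AP[OF f(1)]]])
    then show ?thesis using h(2) x by blast
  qed
  obtain x0 where x0: "x0 \<in> V" using h(2) by blast
  have line: "q = 0" if "f \<in> alg ((\<lambda>i x. x $ i) ` I)" "\<And>x. x \<in> V \<Longrightarrow> f x = 0" "\<And>s. f (x0 + s *s v) = poly q s" for f q v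
    using that
  proof (induction "degree q" arbitrary: f q rule: less_induct)
    case less
    let ?g = "\<lambda>x. \<Sum>i\<in>UNIV. partial f i x * v $ i"
    have "pderiv q = 0" if "degree q > 0"
    proof (rule less.hyps[of _ ?g])
      show "degree (pderiv q) < degree q" using that degree_pderiv[of q] by simp
      show "?g \<in> alg ((\<lambda>i x. x $ i) ` I)" by (intro alg_sum alg_mult alg_const partial_alg_on[OF less.prems(1)])
      show "?g x = 0" if "x \<in> V" for x using step[OF less.prems(1,2) that] by simp
      show "?g (x0 + s *s v) = poly (pderiv q) s" for s
        using pderiv_on_line[OF AP[OF less.prems(1)] less.prems(3), of s] frechet_partial_on[OF less.prems(1)] by simp
    qed
    then have "degree q = 0" using pderiv_eq_0_iff by blast
    then obtain c where "q = [:c:]" by (rule degree_eq_zeroE)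
    moreover have "f x0 = 0" using less.prems(2) x0 by blast
    ultimately show "q = 0" using less.prems(3)[of 0] by simp
  qed
  obtain q where q: "\<forall>s. p (x0 + s *s (x - x0)) = poly q s" using polyfun_on_line[OF AP[OF p(1)]] by blast
  have "q = 0" by (rule line[OF p(1) p(2), where v = "x - x0"]) (use q in blast)+
  then show "p x = 0" using q[rule_format, of 1] by simp
qed

lemma indep_transversal:
  fixes V :: "(complex ^ 'n::finite) set"
  assumes V: "zariski_irreducible V"
    and gen: "generic_on axes V (\<lambda>x. determines (tangent_space V x) I \<and> vec.dim (tangent_space V x) = card I)"
  shows "\<exists>f. (\<forall>k<card I. f k \<in> polyfuns) \<and> indep V (card I) f"
proof -
  obtain \<sigma> where \<sigma>: "bij_betw \<sigma> {0..<card I} I" using ex_bij_betw_nat_finite[of I] by auto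
  define f where "f k = (\<lambda>x :: complex ^ 'n. x $ \<sigma> k)" for k
  have "indep V (card I) f" unfolding indep_def
  proof (intro ballI impI allI)
    fix g e assume g: "g \<in> alg coords" "\<forall>x\<in>V. g (tup (card I) f x) = 0"
    have "(\<lambda>x. g (tup (card I) f x)) \<in> alg ((\<lambda>i x. x $ i) ` I)"
    proof (rule alg_compose[OF g(1)])
      fix a :: "(nat \<Rightarrow> complex) \<Rightarrow> complex" assume "a \<in> coords"
      then obtain k where a: "a = (\<lambda>e. e k)" by (auto simp: coords_def)
      show "(\<lambda>x. a (tup (card I) f x)) \<in> alg ((\<lambda>i x. x $ i) ` I)"
        using bij_betwE[OF \<sigma>] unfolding a tup_def f_def
        by (cases "k < card I") (auto intro: alg_const alg_gen)
    qed
    then have z: "g (tup (card I) f x) = 0" for x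
      by (rule vanishing_transversal[OF V gen]) (use g(2) in blast)
    define x :: "complex ^ 'n" where "x = (\<chi> i. e (the_inv_into {0..<card I} \<sigma> i))"
    have "tup (card I) f x = trunc (card I) e"
      using the_inv_into_f_f[OF bij_betw_imp_inj_on[OF \<sigma>]] by (auto simp: tup_def trunc_def f_def x_def)
    then show "g (trunc (card I) e) = 0" using z[of x] by simp
  qed
  then show ?thesis by (intro exI[of _ f]) (auto simp: f_def)
qed

section \<open>Krull dimension\<close>

lemma indep_chain:
  fixes V :: "(complex ^ 'n::finite) set"
  assumes "zariski_closed V" "zariski_irreducible V" "\<And>k. k < r \<Longrightarrow> f k \<in> polyfuns" "indep V r f"
  shows "\<exists>Z :: nat \<Rightarrow> (complex ^ 'n) set. Z r = V \<and> (\<forall>j\<le>r. zariski_closed (Z j) \<and> zariski_irreducible (Z j)) \<and>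
     (\<forall>j<r. Z j \<subset> Z (Suc j))"
  using assms
proof (induction r arbitrary: V)
  case 0
  then show ?case by (intro exI[of _ "\<lambda>_. V"]) auto
next
  case (Suc r)
  obtain W where W: "zariski_closed W" "zariski_irreducible W" "W \<subset> V" "indep W r f"
    using indep_slice[OF Suc.prems(1,3,4)] by blast
  then obtain Z :: "nat \<Rightarrow> (complex ^ 'n) set" where Z: "Z r = W"
    "\<forall>j\<le>r. zariski_closed (Z j) \<and> zariski_irreducible (Z j)" "\<forall>j<r. Z j \<subset> Z (Suc j)"
    using Suc.IH[of W] Suc.prems(3) by auto
  show ?case using Z W(3) Suc.prems(1,2)
    by (intro exI[of _ "Z(Suc r := V)"]) (auto simp: less_Suc_eq le_Suc_eq)
qed

lemma chain_indep:
  fixes Z :: "nat \<Rightarrow> (complex ^ 'n::finite) set"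
  assumes "\<forall>j\<le>k. zariski_closed (Z j) \<and> zariski_irreducible (Z j)" "\<forall>j<k. Z j \<subset> Z (Suc j)" "j \<le> k"
  shows "\<exists>f. (\<forall>i<j. f i \<in> polyfuns) \<and> indep (Z j) j f"
  using assms(3)
proof (induction j)
  case 0
  obtain x where "x \<in> Z 0" using assms(1) unfolding zariski_irreducible_def by blast
  then have "indep (Z 0) 0 (\<lambda>_ _. 0)" unfolding indep_def by (auto simp: tup_def trunc_def)
  then show ?case by blast
next
  case (Suc j)
  then obtain f where f: "\<forall>i<j. f i \<in> polyfuns" "indep (Z j) j f" by auto
  have j: "Z j \<subset> Z (Suc j)" "zariski_closed (Z j)" "zariski_irreducible (Z (Suc j))" using assms Suc.prems by auto
  obtain x where "x \<in> Z (Suc j)" "x \<notin> Z j" using j(1) by blast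
  then obtain h where h: "h \<in> vanishing (Z j)" "h x \<noteq> 0" using zariski_closed_vanishing[OF j(2)] by blast
  have "indep (Z (Suc j)) (Suc j) (f(j := h))"
    by (rule indep_extend[OF j(3) _ _ f(2)])
      (use j(1) f(1) h \<open>x \<in> Z (Suc j)\<close> in \<open>auto simp: vanishing_def\<close>)
  moreover have "\<forall>i<Suc j. (f(j := h)) i \<in> polyfuns" using f(1) h(1) by (auto simp: vanishing_def less_Suc_eq)
  ultimately show ?case by blast
qed

lemma indep_superset: "indep W r f \<Longrightarrow> W \<subseteq> V \<Longrightarrow> indep V r f"
  unfolding indep_def by blast

text \<open>
  A chain of length \<open>k\<close> gives \<open>k\<close> independent functions and hence \<open>k \<le> card I\<close>, where \<open>I\<close> determines
  the generic tangent space; the coordinates in \<open>I\<close> give a chain of length \<open>card I\<close>.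
\<close>

theorem krull_dim_generic_tangent_dim:
  fixes V :: "(complex ^ 'n::finite) set"
  assumes V: "zariski_closed V" "zariski_irreducible V"
  shows "generic_on axes V (\<lambda>x. enat (vec.dim (tangent_space V x)) = krull_dim V)"
proof -
  obtain I where I: "generic_on axes V (\<lambda>x. determines (tangent_space V x) I \<and> vec.dim (tangent_space V x) = card I)"
    using generic_tangent_dim[OF V(2)] by blast
  have det: "generic_on axes V (\<lambda>x. determines (tangent_space V x) I)" by (rule generic_on_mono[OF I]) blast
  let ?S = "{enat k | k. \<exists>Z :: nat \<Rightarrow> (complex ^ 'n) set.
     (\<forall>j\<le>k. zariski_closed (Z j) \<and> zariski_irreducible (Z j) \<and> Z j \<subseteq> V) \<and>
     (\<forall>j<k. Z j \<subset> Z (Suc j))}"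
  have le: "a \<le> enat (card I)" if "a \<in> ?S" for a
  proof -
    obtain k and Z :: "nat \<Rightarrow> (complex ^ 'n) set" where a: "a = enat k"
      and Z: "\<forall>j\<le>k. zariski_closed (Z j) \<and> zariski_irreducible (Z j) \<and> Z j \<subseteq> V" "\<forall>j<k. Z j \<subset> Z (Suc j)"
      using \<open>a \<in> ?S\<close> by blast
    obtain f where f: "\<forall>i<k. f i \<in> polyfuns" "indep (Z k) k f" using chain_indep[of k Z k] Z by auto
    have "indep V k f" by (rule indep_superset[OF f(2)]) (use Z(1) in auto)
    then have "k \<le> card I" by (intro indep_le_generic_tangent_dim[OF V det _]) (use f(1) in auto)
    then show ?thesis by (simp add: a)
  qed
  have mem: "enat (card I) \<in> ?S"
  proof -
    obtain f where f: "\<forall>k<card I. f k \<in> polyfuns" "indep V (card I) f" using indep_transversal[OF V(2) I] by blast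
    obtain Z :: "nat \<Rightarrow> (complex ^ 'n) set" where Z: "Z (card I) = V"
      "\<forall>j\<le>card I. zariski_closed (Z j) \<and> zariski_irreducible (Z j)" "\<forall>j<card I. Z j \<subset> Z (Suc j)"
      using indep_chain[OF V _ f(2)] f(1) by blast
    have "Z j \<subseteq> V" if "j \<le> card I" for j
      using that
    proof (induction j rule: inc_induct)
      case base
      then show ?case using Z(1) by simp
    next
      case (step j)
      then show ?case using Z(3) by blast
    qed
    then show ?thesis using Z(2,3) by (intro CollectI exI[of _ "card I"] conjI refl exI[of _ Z]) auto
  qed
  have "krull_dim V = enat (card I)" unfolding krull_dim_def
    by (rule antisym[OF Sup_least[OF le] Sup_upper[OF mem]])
  then show ?thesis using generic_on_mono[OF I] by auto
qed

section \<open>The number of critical points is generically constant\<close>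

text \<open>
  The bilinear pairing between linear forms and vectors, without complex conjugation.
\<close>

definition dotp :: "complex ^ 'n::finite \<Rightarrow> complex ^ 'n \<Rightarrow> complex" where
  "dotp u v = (\<Sum>i\<in>UNIV. u $ i * v $ i)"

lemma dotp_diff: "dotp (u - w) v = dotp u v - dotp w v"
  by (simp add: dotp_def algebra_simps sum_subtractf)

lemma dotp_add: "dotp (u + w) v = dotp u v + dotp w v"
  by (simp add: dotp_def algebra_simps sum.distrib)

lemma dotp_scale: "dotp (c *s u) v = c * dotp u v"
  by (simp add: dotp_def algebra_simps sum_distrib_left)

lemma dotp_sum: "dotp (\<Sum>j\<in>J. f j) v = (\<Sum>j\<in>J. dotp (f j) v)"
  by (induction J rule: infinite_finite_induct) (auto simp: dotp_add, auto simp: dotp_def)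

definition conormal :: "(complex ^ 'n::finite) set \<Rightarrow> (complex ^ 'n) set" where
  "conormal T = {w. \<forall>v\<in>T. dotp w v = 0}"

definition grad :: "(complex ^ 'n::finite \<Rightarrow> complex) \<Rightarrow> complex ^ 'n \<Rightarrow> complex ^ 'n" where
  "grad f x = (\<chi> i. partial f i x)"

lemma frechet_grad: "f \<in> polyfuns \<Longrightarrow> frechet_derivative f (at x) v = dotp (grad f x) v"
  by (simp add: frechet_partial dotp_def grad_def)

text \<open>
  A conormal vector that vanishes outside \<open>I\<close> pairs with the dual family to its own coordinates, so it
  is zero. Hence the coordinates outside \<open>I\<close> determine the conormal space.
\<close>

lemma conormal_bounded_below:
  assumes T: "vec.subspace T" and I: "determines T I" "card I = vec.dim T"
  shows "\<exists>k::nat. \<forall>w\<in>conormal T. norm w \<le> Suc k * norm (restrict_to (- I) w)"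
proof -
  obtain b where b: "dual_family T I b" using determines_dual[OF T I] by blast
  have zero: "w = 0" if w: "w \<in> conormal T" "restrict_to (- I) w = 0" for w
  proof -
    have out: "w $ i = 0" if "i \<notin> I" for i
    proof -
      have "restrict_to (- I) w $ i = 0" using w(2) by simp
      then show ?thesis using that by (simp add: restrict_to_def)
    qed
    have "w $ i = 0" if i: "i \<in> I" for i
    proof -
      have "0 = dotp w (b i)" using w(1) b i unfolding conormal_def dual_family_def by auto
      also have "\<dots> = (\<Sum>k\<in>UNIV. if k = i then w $ i else 0)" unfolding dotp_def
      proof (rule sum.cong[OF refl])
        fix k show "w $ k * b i $ k = (if k = i then w $ i else 0)"
          using b i out[of k] unfolding dual_family_def by (cases "k \<in> I") auto
      qed
      finally show ?thesis by simp
    qed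
    then show ?thesis using out by (auto simp: vec_eq_iff)
  qed
  have sub: "subspace (conormal T)"
  proof (rule subspaceI)
    show "0 \<in> conormal T" by (simp add: conormal_def dotp_def)
    show "u + w \<in> conormal T" if "u \<in> conormal T" "w \<in> conormal T" for u w
      using that by (simp add: conormal_def dotp_add)
    show "c *\<^sub>R w \<in> conormal T" if "w \<in> conormal T" for c w
    proof -
      have "dotp (c *\<^sub>R w) v = c *\<^sub>R dotp w v" for v by (simp add: dotp_def scaleR_sum_right)
      then show ?thesis using that by (simp add: conormal_def)
    qed
  qed
  have "bounded_linear (restrict_to (- I))"
    by (rule linear_conv_bounded_linear[THEN iffD1], rule linearI)
      (auto simp: restrict_to_def vec_eq_iff)
  then obtain e where e: "e > 0" "\<forall>w\<in>conormal T. e * norm w \<le> norm (restrict_to (- I) w)"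
    using injective_imp_isometric[OF closed_subspace[OF sub] sub] zero by blast
  obtain k :: nat where k: "1 / e < real k" using reals_Archimedean2 by blast
  have "norm w \<le> Suc k * norm (restrict_to (- I) w)" if "w \<in> conormal T" for w
  proof -
    have "norm w \<le> 1 / e * norm (restrict_to (- I) w)" using e that by (simp add: field_simps)
    also have "\<dots> \<le> Suc k * norm (restrict_to (- I) w)" using k by (intro mult_right_mono) auto
    finally show ?thesis .
  qed
  then show ?thesis by blast
qed

text \<open>
  A vector outside the span of the gradients is separated from them by a linear functional, that is,
  by a vector \<open>z\<close> that lies in the kernel but is not annihilated by \<open>w\<close>.
\<close>

lemma conormal_kernel_span:
  assumes w: "w \<in> conormal (kernel_of J x)" and J: "finite J" "J \<subseteq> polyfuns"
  shows "\<exists>\<mu>. w = (\<Sum>j\<in>J. \<mu> j *s grad j x)"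
proof -
  have "w \<in> vec.span ((\<lambda>j. grad j x) ` J)"
  proof (rule ccontr)
    assume not: "w \<notin> vec.span ((\<lambda>j. grad j x) ` J)"
    obtain B where B: "B \<subseteq> (\<lambda>j. grad j x) ` J" "vec.independent B" "(\<lambda>j. grad j x) ` J \<subseteq> vec.span B"
      using vec.maximal_independent_subset by blast
    have span: "vec.span ((\<lambda>j. grad j x) ` J) = vec.span B"
      using B(1,3) by (metis vec.span_mono vec.span_span subset_antisym)
    have indep: "vec.independent (insert w B)"
      using not B(2) unfolding span by (rule vec.independent_insertI)
    obtain b0 :: "complex ^ 'a" where b0: "b0 $ (SOME i. True) = 1" by (metis vec_lambda_beta)
    obtain L :: "complex ^ 'a \<Rightarrow> complex ^ 'a" where L: "Vector_Spaces.linear (*s) (*s) L"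
      "\<forall>y\<in>insert w B. L y = (if y = w then b0 else 0)"
      using vec.linear_independent_extend[OF indep, of "\<lambda>y. if y = w then b0 else 0"] by blast
    interpret L: Vector_Spaces.linear "(*s)" "(*s)" L by (rule L(1))
    define z where "z = (\<chi> i. L (axis i 1) $ (SOME i. True))"
    have Lz: "L y $ (SOME i. True) = dotp y z" for y
    proof -
      have "L y = L (\<Sum>i\<in>UNIV. y $ i *s axis i 1)" by (simp add: basis_expansion)
      also have "\<dots> = (\<Sum>i\<in>UNIV. y $ i *s L (axis i 1))"
        by (simp only: L.sum L.scale)
      finally show ?thesis by (simp add: dotp_def z_def)
    qed
    have "w \<notin> B" using not vec.span_base unfolding span by blast
    then have B0: "L y = 0" if "y \<in> B" for y using L(2) that by auto
    have "L y = 0" if "y \<in> vec.span B" for y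
      using that by (induction rule: vec.span_induct_alt)
        (auto simp: B0 L.zero L.add L.scale)
    then have "dotp (grad j x) z = 0" if "j \<in> J" for j
      using B(3) that Lz[of "grad j x"] by fastforce
    then have "z \<in> kernel_of J x" using J(2) unfolding kernel_of_def by (auto simp: frechet_grad)
    then have "dotp w z = 0" using w unfolding conormal_def by blast
    then show False using Lz[of w] L(2) b0 by simp
  qed
  then show ?thesis
  proof (induction rule: vec.span_induct_alt)
    case base
    show ?case by (intro exI[of _ "\<lambda>_. 0"]) simp
  next
    case (step c y z)
    then obtain j \<mu> where j: "j \<in> J" "y = grad j x" and \<mu>: "z = (\<Sum>j\<in>J. \<mu> j *s grad j x)" by blast
    have "c *s y + z = (\<Sum>i\<in>J. ((if i = j then c else 0) + \<mu> i) *s grad i x)"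
    proof -
      have "(\<Sum>i\<in>J. (if i = j then c else 0) *s grad i x) = (\<Sum>i\<in>J. if i = j then c *s grad j x else 0)"
        by (intro sum.cong) auto
      also have "\<dots> = c *s y" using j J(1) by simp
      finally show ?thesis by (simp add: \<mu> vec.scale_left_distrib sum.distrib)
    qed
    then show ?case by (intro exI[of _ "\<lambda>i. (if i = j then c else 0) + \<mu> i"]) simp
  qed
qed

text \<open>
  The critical points of \<open>log F - u\<close> with \<open>r\<close>-dimensional tangent space. With \<open>r\<close> the Krull dimension of
  \<open>V\<close> these are the critical points in the smooth locus.
\<close>

definition crit :: "(complex ^ 'n::finite) set \<Rightarrow> nat \<Rightarrow> (complex ^ 'n \<Rightarrow> complex) \<Rightarrow> complex ^ 'n \<Rightarrow> (complex ^ 'n) set" where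
  "crit V r F u = {x \<in> V. vec.dim (tangent_space V x) = r \<and> F x \<noteq> 0 \<and>
     (\<forall>v\<in>tangent_space V x. frechet_derivative F (at x) v = F x * dotp u v)}"

lemma dim_eq_determines:
  assumes "vec.subspace T"
  shows "vec.dim T = r \<longleftrightarrow> (\<exists>I\<in>{I. card I = r}. determines T I) \<and> \<not> (\<exists>I\<in>{I. card I < r}. determines T I)"
proof
  assume "vec.dim T = r"
  then show "(\<exists>I\<in>{I. card I = r}. determines T I) \<and> \<not> (\<exists>I\<in>{I. card I < r}. determines T I)"
    using determines_ex[OF assms] determines_dim_le[OF assms] by (metis (mono_tags) leD mem_Collect_eq)
next
  assume a: "(\<exists>I\<in>{I. card I = r}. determines T I) \<and> \<not> (\<exists>I\<in>{I. card I < r}. determines T I)"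
  then have "vec.dim T \<le> r" using determines_dim_le[OF assms] by blast
  moreover obtain I where "determines T I" "card I = vec.dim T" using determines_ex[OF assms] by blast
  then have "\<not> vec.dim T < r" using a by auto
  ultimately show "vec.dim T = r" by simp
qed

lemma constructible_crit:
  fixes V :: "(complex ^ 'n::finite) set" and a b c :: 'k
  assumes V: "zariski_closed V" and F: "F \<in> polyfuns" and abc: "a \<noteq> c" "b \<noteq> c"
  shows "constructible (coords :: (('k \<times> 'n \<Rightarrow> complex) \<Rightarrow> complex) set) (\<lambda>e. slot e a \<in> crit V r F (slot e b))"
proof -
  let ?C = "coords :: (('k \<times> 'n \<Rightarrow> complex) \<Rightarrow> complex) set"
  obtain J where J: "finite J" "J \<subseteq> vanishing V" "vanishing V \<subseteq> idl polyfuns J" by (rule vanishing_generators)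
  have JP: "J \<subseteq> polyfuns" using J(2) unfolding vanishing_def by auto
  let ?R = "\<lambda>e. (\<forall>j\<in>J. (\<Sum>i\<in>UNIV. partial j i (slot e a) * e (c, i)) = 0) \<and>
      \<not> (\<Sum>i\<in>UNIV. partial F i (slot e a) * e (c, i)) = F (slot e a) * (\<Sum>i\<in>UNIV. e (b, i) * e (c, i))"
  have "constructible ?C ?R"
    using J(1) JP F by (intro constructible_conj constructible_ball constructible_zero constructible_not constructible_eq
        alg_sum alg_mult alg_slot partial_polyfun alg_coord) auto
  then have "constructible ?C (\<lambda>e. \<exists>v. ?R (set_slot e c v))" by (rule constructible_ex_slot)
  moreover have "(\<exists>v. ?R (set_slot e c v)) \<longleftrightarrow>
      (\<exists>v\<in>kernel_of J (slot e a). frechet_derivative F (at (slot e a)) v \<noteq> F (slot e a) * dotp (slot e b) v)" for e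
  proof -
    have "v \<in> kernel_of J (slot e a) \<longleftrightarrow> (\<forall>j\<in>J. (\<Sum>i\<in>UNIV. partial j i (slot e a) * v $ i) = 0)" for v
      unfolding kernel_of_def mem_Collect_eq
      by (rule ball_cong[OF refl]) (use JP in \<open>simp add: frechet_partial subset_iff\<close>)
    moreover have "set_slot e c v (c, i) = v $ i" "set_slot e c v (b, i) = e (b, i)" for v i
      using abc by (simp_all add: set_slot_def)
    moreover have "slot (set_slot e c v) a = slot e a" for v using abc by (simp add: slot_set_slot)
    moreover have "frechet_derivative F (at (slot e a)) v = (\<Sum>i\<in>UNIV. partial F i (slot e a) * v $ i)" for v
      by (rule frechet_partial[OF F])
    moreover have "dotp (slot e b) v = (\<Sum>i\<in>UNIV. e (b, i) * v $ i)" for v by (simp add: dotp_def slot_def)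
    ultimately show ?thesis by (simp add: Bex_def)
  qed
  ultimately have c1: "constructible ?C (\<lambda>e. \<exists>v\<in>kernel_of J (slot e a).
      frechet_derivative F (at (slot e a)) v \<noteq> F (slot e a) * dotp (slot e b) v)" by simp
  have dimC: "constructible axes (\<lambda>x. (\<exists>I\<in>{I. card I = r}. determines (kernel_of J x) I) \<and>
      \<not> (\<exists>I\<in>{I. card I < r}. determines (kernel_of J x) I))"
    by (intro constructible_conj constructible_not constructible_bex constructible_determines J(1) JP) auto
  have "constructible axes (\<lambda>x. x \<in> V \<and> (\<not> F x = 0) \<and> (\<exists>I\<in>{I. card I = r}. determines (kernel_of J x) I) \<and>
      \<not> (\<exists>I\<in>{I. card I < r}. determines (kernel_of J x) I))"
    by (rule constructible_conj[OF constructible_closed[OF V] constructible_conj[OF constructible_not[OF constructible_zero[OF F]] dimC]])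
  from constructible_conj[OF constructible_slot[OF this, of a] constructible_not[OF c1]]
  show ?thesis
  proof (rule back_subst[of "constructible ?C"], intro ext)
    fix e :: "'k \<times> 'n \<Rightarrow> complex"
    let ?x = "slot e a"
    show "((?x \<in> V \<and> \<not> F ?x = 0 \<and> (\<exists>I\<in>{I. card I = r}. determines (kernel_of J ?x) I) \<and>
        \<not> (\<exists>I\<in>{I. card I < r}. determines (kernel_of J ?x) I)) \<and>
        \<not> (\<exists>v\<in>kernel_of J ?x. frechet_derivative F (at ?x) v \<noteq> F ?x * dotp (slot e b) v)) =
        (?x \<in> crit V r F (slot e b))"
    proof (cases "?x \<in> V")
      case True
      have T: "tangent_space V ?x = kernel_of J ?x" by (rule tangent_space_kernel[OF J(2,3) True])
      have "?x \<in> crit V r F (slot e b) \<longleftrightarrow> vec.dim (kernel_of J ?x) = r \<and> F ?x \<noteq> 0 \<and>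
          (\<forall>v\<in>kernel_of J ?x. frechet_derivative F (at ?x) v = F ?x * dotp (slot e b) v)"
        using True by (simp add: crit_def T)
      then show ?thesis using True dim_eq_determines[OF subspace_tangent_space, of V ?x r, unfolded T] by blast
    next
      case False
      then show ?thesis by (simp add: crit_def)
    qed
  qed
qed

lemma generically_slot:
  fixes R :: "complex ^ 'n::finite \<Rightarrow> bool"
  assumes "generic_on (coords :: (('k \<times> 'n \<Rightarrow> complex) \<Rightarrow> complex) set) UNIV (\<lambda>e. R (slot e j))"
  shows "generically R"
proof -
  obtain g e0 where g: "g \<in> alg (coords :: (('k \<times> 'n \<Rightarrow> complex) \<Rightarrow> complex) set)" "g e0 \<noteq> 0"
      "\<forall>e. g e \<noteq> 0 \<longrightarrow> R (slot e j)"
    using assms unfolding generic_on_def by auto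
  have P: "(\<lambda>u. g (set_slot e0 j u)) \<in> polyfuns"
  proof (rule alg_compose[OF g(1)])
    fix a :: "('k \<times> 'n \<Rightarrow> complex) \<Rightarrow> complex" assume "a \<in> coords"
    then obtain k i where a: "a = (\<lambda>e. e (k, i))" by (auto simp: coords_def)
    show "(\<lambda>u. a (set_slot e0 j u)) \<in> polyfuns"
      unfolding a set_slot_def by (cases "k = j") (auto intro: alg_const)
  qed
  have "set_slot e0 j (slot e0 j) = e0" by (auto simp: set_slot_def slot_def)
  then have ne: "g (set_slot e0 j (slot e0 j)) \<noteq> 0" using g(2) by simp
  have R: "R u" if "g (set_slot e0 j u) \<noteq> 0" for u
  proof -
    have "R (slot (set_slot e0 j u) j)" using g(3) that by blast
    then show ?thesis by (simp add: slot_set_slot)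
  qed
  show ?thesis unfolding generically_generic_on generic_on_def
    using ne R by (intro bexI[OF _ P]) auto
qed

lemma finite_card_coordinates:
  fixes A :: "(complex ^ 'n::finite) set"
  assumes "\<And>i. finite ((\<lambda>x. x $ i) ` A)" "\<And>i. card ((\<lambda>x. x $ i) ` A) \<le> d i"
  shows "finite A \<and> card A \<le> (\<Prod>i\<in>UNIV. d i)"
proof -
  let ?P = "PiE UNIV (\<lambda>i. (\<lambda>x. x $ i) ` A)"
  have fin: "finite ?P" using assms(1) by (intro finite_PiE) auto
  have inj: "inj_on (\<lambda>x i. x $ i) A" by (auto simp: inj_on_def vec_eq_iff fun_eq_iff)
  have sub: "(\<lambda>x i. x $ i) ` A \<subseteq> ?P" by auto
  have "finite A" using finite_imageD[OF finite_subset[OF sub fin] inj] .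
  moreover have "card A \<le> card ?P" using card_inj_on_le[OF inj sub fin] .
  moreover have "card ?P \<le> (\<Prod>i\<in>UNIV. d i)" using assms(2) by (simp add: card_PiE prod_mono)
  ultimately show ?thesis by simp
qed

text \<open>
  Near a pair \<open>(x, u)\<close> with \<open>x\<close> critical for \<open>u\<close>, the pair is controlled by \<open>glue I x u\<close>: the point \<open>x\<close>
  by its coordinates in \<open>I\<close>, and \<open>u\<close>, which differs from \<open>dF / F\<close> by a conormal vector, by its
  coordinates outside \<open>I\<close>. The sets \<open>Y I k\<close> fix the index set and the constant in the estimate of
  conormal vectors, because that estimate is applied at the nearby point, where the conormal space is
  a different one.
\<close>

lemma negligible_crit_image:
  fixes V :: "(complex ^ 'n::finite) set"
  assumes F: "F \<in> polyfuns"
  shows "negligible {(y, u). \<exists>x\<in>crit V r F u. x $ i0 = y}"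
proof -
  obtain J where J: "finite J" "J \<subseteq> vanishing V" "vanishing V \<subseteq> idl polyfuns J" by (rule vanishing_generators)
  have JP: "J \<subseteq> polyfuns" using J(2) unfolding vanishing_def by auto
  define Y where "Y I k = {(x, u). x \<in> crit V r F u \<and> determines (tangent_space V x) I \<and>
     (\<forall>w\<in>conormal (tangent_space V x). norm w \<le> Suc k * norm (restrict_to (- I) w))}" for I and k :: nat
  let ?\<pi> = "\<lambda>(x, u). (x $ i0, u :: complex ^ 'n)"
  have neg: "negligible (?\<pi> ` Y I k)" for I k
  proof (rule negligible_locally_determined_image[where \<kappa> = "\<lambda>(x, u). glue I x u"])
    fix z assume "z \<in> Y I k"
    then obtain x u where z: "z = (x, u)" "x \<in> crit V r F u" "determines (tangent_space V x) I"
      unfolding Y_def by blast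
    have xV: "x \<in> V" and Fx: "F x \<noteq> 0"
      using z(2) unfolding crit_def by auto
    define a where "a y = (1 / F y) *s grad F y" for y
    have normal: "u' - a y \<in> conormal (tangent_space V y)" if "y \<in> crit V r F u'" for y u'
      using that F unfolding conormal_def crit_def a_def
      by (auto simp: dotp_diff dotp_scale frechet_grad)
    have "u - a x \<in> conormal (kernel_of J x)"
      using normal[OF z(2)] tangent_space_kernel[OF J(2,3) xV] by simp
    then obtain \<mu> where \<mu>: "u - a x = (\<Sum>j\<in>J. \<mu> j *s grad j x)"
      using conormal_kernel_span[OF _ J(1) JP] by blast
    \<comment> \<open>A smooth function with value u at x that differs from dF / F by conormal vectors at every point of V.\<close>
    define \<Phi> where "\<Phi> y = a y + (\<Sum>j\<in>J. \<mu> j *s grad j y)" for y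
    have \<Phi>x: "\<Phi> x = u" unfolding \<Phi>_def using \<mu> by (simp add: algebra_simps)
    have "(\<lambda>y. \<Phi> y $ i) differentiable (at x)" for i
    proof -
      have "(\<lambda>y. \<Phi> y $ i) = (\<lambda>y. partial F i y / F y + (\<Sum>j\<in>J. \<mu> j * partial j i y))"
        by (simp add: \<Phi>_def a_def grad_def fun_eq_iff)
      moreover have "(\<lambda>y. partial F i y / F y) differentiable (at x)"
        by (intro differentiable_divide polyfun_differentiable partial_polyfun F Fx)
      moreover have "(\<lambda>y. \<Sum>j\<in>J. \<mu> j * partial j i y) differentiable (at x)"
        by (intro polyfun_differentiable alg_sum alg_mult alg_const partial_polyfun) (use JP in auto)
      ultimately show ?thesis by (simp add: differentiable_add)
    qed
    then have "\<exists>l::nat. \<forall>y. dist x y < 1 / Suc l \<longrightarrow> norm (\<Phi> y $ i - \<Phi> x $ i) \<le> Suc l * norm (y - x)" for i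
      by (rule differentiable_locally_lipschitz)
    then obtain l where l: "\<And>i y. dist x y < 1 / Suc (l i) \<Longrightarrow> norm (\<Phi> y $ i - \<Phi> x $ i) \<le> Suc (l i) * norm (y - x)"
      by metis
    obtain k1 where k1: "\<forall>y\<in>V. dist x y < 1 / Suc k1 \<longrightarrow> norm (y - x) \<le> Suc k1 * norm (restrict_to I (y - x))"
      using variety_locally_determined[OF xV z(3)] by blast
    define M where "M = (\<Sum>i\<in>UNIV. Suc (l i))"
    define m where "m = Suc k1 + (Suc k * (1 + M * Suc k1) + M * Suc k1) + M"
    have lM: "l i < M" for i
    proof -
      have "Suc (l i) \<le> M" unfolding M_def by (rule member_le_sum) auto
      then show ?thesis by simp
    qed
    show "\<exists>m::nat. \<forall>z'\<in>Y I k. dist z z' < 1 / Suc m \<longrightarrow>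
        dist (?\<pi> z) (?\<pi> z') \<le> Suc m * dist (case z of (x, u) \<Rightarrow> glue I x u) (case z' of (x, u) \<Rightarrow> glue I x u)"
    proof (intro exI[of _ m] ballI impI)
      fix z' assume z'Y: "z' \<in> Y I k" and dz: "dist z z' < 1 / Suc m"
      obtain x' u' where z': "z' = (x', u')" "x' \<in> crit V r F u'"
        "\<And>w. w \<in> conormal (tangent_space V x') \<Longrightarrow> norm w \<le> Suc k * norm (restrict_to (- I) w)"
        using z'Y unfolding Y_def by blast
      have x'V: "x' \<in> V" using z'(2) by (simp add: crit_def)
      have "dist x x' \<le> dist z z'" unfolding z(1) z'(1) dist_Pair_Pair by (rule real_sqrt_sum_squares_ge1)
      moreover have small: "1 / Suc m \<le> 1 / Suc j" if "j \<le> m" for j using that by (simp add: divide_simps)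
      ultimately have dx: "dist x x' < 1 / Suc j" if "j \<le> m" for j using dz small[OF that] by linarith
      define \<delta> where "\<delta> = norm (glue I x' u' - glue I x u)"
      have \<delta>0: "0 \<le> \<delta>" by (simp add: \<delta>_def)
      have "norm (restrict_to I (x' - x)) \<le> \<delta>"
        unfolding \<delta>_def by (rule norm_restrict_to_le) (simp add: glue_nth)
      moreover have "norm (x' - x) \<le> Suc k1 * norm (restrict_to I (x' - x))"
        using k1 dx[of k1] x'V by (simp add: m_def)
      moreover have "Suc k1 * norm (restrict_to I (x' - x)) \<le> Suc k1 * \<delta>"
        using calculation(1) by (intro mult_left_mono) auto
      ultimately have xd: "norm (x' - x) \<le> Suc k1 * \<delta>" by linarith
      have "norm (\<Phi> x' - \<Phi> x) \<le> (\<Sum>i\<in>UNIV. norm ((\<Phi> x' - \<Phi> x) $ i))" by (rule norm_vec_le_sum)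
      also have "\<dots> \<le> (\<Sum>i\<in>UNIV. real (Suc (l i)) * norm (x' - x))"
      proof (rule sum_mono)
        fix i
        have "l i \<le> m" using lM[of i] by (simp add: m_def)
        then show "norm ((\<Phi> x' - \<Phi> x) $ i) \<le> real (Suc (l i)) * norm (x' - x)" using l[OF dx] by simp
      qed
      also have "\<dots> = real M * norm (x' - x)" by (simp only: M_def sum_distrib_right of_nat_sum)
      also have "\<dots> \<le> real M * (Suc k1 * \<delta>)" using xd by (intro mult_left_mono) auto
      finally have \<Phi>d: "norm (\<Phi> x' - \<Phi> x) \<le> real M * (Suc k1 * \<delta>)" .
      have "u' - \<Phi> x' \<in> conormal (tangent_space V x')"
      proof -
        have "dotp (\<Sum>j\<in>J. \<mu> j *s grad j x') v = 0" if "v \<in> tangent_space V x'" for v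
        proof -
          have "dotp (grad j x') v = 0" if "j \<in> J" for j
            using \<open>v \<in> tangent_space V x'\<close> that J(2) JP unfolding tangent_space_vanishing
            by (auto simp: frechet_grad[symmetric] subset_iff)
          then show ?thesis by (simp add: dotp_sum dotp_scale)
        qed
        then have "(u' - a x') - (\<Sum>j\<in>J. \<mu> j *s grad j x') \<in> conormal (tangent_space V x')"
          using normal[OF z'(2)] by (simp add: conormal_def dotp_diff)
        then show ?thesis by (simp add: \<Phi>_def algebra_simps)
      qed
      then have "norm (u' - \<Phi> x') \<le> Suc k * norm (restrict_to (- I) (u' - \<Phi> x'))" by (rule z'(3))
      also have "norm (restrict_to (- I) (u' - \<Phi> x')) \<le> \<delta> + norm (\<Phi> x' - \<Phi> x)"
      proof -
        have "restrict_to (- I) (u' - \<Phi> x') = restrict_to (- I) (u' - u) - restrict_to (- I) (\<Phi> x' - \<Phi> x)"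
          by (simp add: restrict_to_def vec_eq_iff \<Phi>x)
        then have "norm (restrict_to (- I) (u' - \<Phi> x')) \<le> norm (restrict_to (- I) (u' - u)) + norm (restrict_to (- I) (\<Phi> x' - \<Phi> x))"
          by (simp add: norm_triangle_ineq4)
        moreover have "norm (restrict_to (- I) (u' - u)) \<le> \<delta>"
          unfolding \<delta>_def by (rule norm_restrict_to_le) (simp add: glue_nth)
        moreover have "norm (restrict_to (- I) (\<Phi> x' - \<Phi> x)) \<le> norm (\<Phi> x' - \<Phi> x)"
          by (rule norm_restrict_to_le) simp
        ultimately show ?thesis by linarith
      qed
      finally have ud: "norm (u' - \<Phi> x') \<le> Suc k * (\<delta> + norm (\<Phi> x' - \<Phi> x))" by (simp add: mult_left_mono)
      have "norm (u' - u) \<le> norm (u' - \<Phi> x') + norm (\<Phi> x' - \<Phi> x)"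
        unfolding \<Phi>x using norm_triangle_ineq[of "u' - \<Phi> x'" "\<Phi> x' - u"] by simp
      also have "\<dots> \<le> Suc k * (\<delta> + real M * (Suc k1 * \<delta>)) + real M * (Suc k1 * \<delta>)"
      proof -
        have "Suc k * (\<delta> + norm (\<Phi> x' - \<Phi> x)) \<le> Suc k * (\<delta> + real M * (Suc k1 * \<delta>))"
          by (intro mult_left_mono add_left_mono \<Phi>d) simp
        then show ?thesis using ud \<Phi>d by linarith
      qed
      finally have ud': "norm (u' - u) \<le> Suc k * (\<delta> + real M * (Suc k1 * \<delta>)) + real M * (Suc k1 * \<delta>)" .
      have "norm (x' $ i0 - x $ i0) \<le> norm (x' - x)"
        using Finite_Cartesian_Product.norm_nth_le[of "x' - x" i0] by simp
      then have "norm (x' $ i0 - x $ i0) + norm (u' - u) \<le>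
          Suc k1 * \<delta> + (Suc k * (\<delta> + real M * (Suc k1 * \<delta>)) + real M * (Suc k1 * \<delta>))" using xd ud' by linarith
      also have "\<dots> = (real (Suc k1) + (real (Suc k) * (1 + real M * real (Suc k1)) + real M * real (Suc k1))) * \<delta>"
        by (simp only: distrib_right mult.assoc mult_1 distrib_left)
      also have "\<dots> \<le> real (Suc m) * \<delta>"
      proof (rule mult_right_mono[OF _ \<delta>0])
        have "real m = real (Suc k1) + (real (Suc k) * (1 + real M * real (Suc k1)) + real M * real (Suc k1)) + real M"
          unfolding m_def by (simp only: of_nat_add of_nat_mult of_nat_1)
        then show "real (Suc k1) + (real (Suc k) * (1 + real M * real (Suc k1)) + real M * real (Suc k1)) \<le> real (Suc m)"
          by simp
      qed
      finally have tot: "norm (x' $ i0 - x $ i0) + norm (u' - u) \<le> real (Suc m) * \<delta>" .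
      have "dist (x' $ i0, u') (x $ i0, u) \<le> norm (x' $ i0 - x $ i0) + norm (u' - u)"
        unfolding dist_norm diff_Pair by (rule norm_Pair_le)
      then have "dist (x' $ i0, u') (x $ i0, u) \<le> real (Suc m) * \<delta>" using tot by linarith
      moreover have "dist (glue I x u) (glue I x' u') = \<delta>"
        by (simp add: \<delta>_def dist_norm norm_minus_commute)
      ultimately show "dist (?\<pi> z) (?\<pi> z') \<le> Suc m * dist (case z of (x, u) \<Rightarrow> glue I x u) (case z' of (x, u) \<Rightarrow> glue I x u)"
        unfolding z(1) z'(1) prod.case by (simp only: dist_commute[of "(x $ i0, u)"])
    qed
  qed
  have "negligible (\<Union>(I, k)\<in>UNIV. ?\<pi> ` Y I k)"
    using neg by (intro negligible_countable_Union countable_image) (auto simp: case_prod_beta intro: countableI_type)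
  moreover have "{(y, u). \<exists>x\<in>crit V r F u. x $ i0 = y} \<subseteq> (\<Union>(I, k)\<in>UNIV. ?\<pi> ` Y I k)"
  proof
    fix p assume "p \<in> {(y, u). \<exists>x\<in>crit V r F u. x $ i0 = y}"
    then obtain x u where p: "p = (x $ i0, u)" "x \<in> crit V r F u" by blast
    obtain I where I: "determines (tangent_space V x) I" "card I = vec.dim (tangent_space V x)"
      using determines_ex[OF subspace_tangent_space] by blast
    obtain k where "\<forall>w\<in>conormal (tangent_space V x). norm w \<le> Suc k * norm (restrict_to (- I) w)"
      using conormal_bounded_below[OF subspace_tangent_space I] by blast
    then have "(x, u) \<in> Y I k" using p(2) I(1) unfolding Y_def by blast
    then have "p \<in> ?\<pi> ` Y I k" using p(1) by (intro image_eqI[of _ _ "(x, u)"]) auto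
    then show "p \<in> (\<Union>(I, k)\<in>UNIV. ?\<pi> ` Y I k)" by (intro UN_I[of "(I, k)"]) auto
  qed
  ultimately show ?thesis by (rule negligible_subset)
qed

text \<open>
  The values of a coordinate \<open>x $ i\<close> at the critical points for \<open>u\<close> are roots of a polynomial in one
  variable with coefficients depending on \<open>u\<close>, of bounded degree and generically not zero.
\<close>

lemma generically_bounded_crit:
  fixes V :: "(complex ^ 'n::finite) set"
  assumes V: "zariski_closed V" and F: "F \<in> polyfuns"
  shows "\<exists>K. generically (\<lambda>u. finite (crit V r F u) \<and> card (crit V r F u) \<le> K)"
proof -
  let ?C = "coords :: ((nat \<times> 'n \<Rightarrow> complex) \<Rightarrow> complex) set"
  have one: "\<exists>d. generic_on ?C UNIV (\<lambda>e. finite ((\<lambda>x. x $ i) ` crit V r F (slot e 0)) \<and>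
      card ((\<lambda>x. x $ i) ` crit V r F (slot e 0)) \<le> d)" for i
  proof -
    let ?Q = "\<lambda>e. slot e 1 \<in> crit V r F (slot e 0) \<and> e (1, i) = e (2, i)"
    define B where "B e \<longleftrightarrow> (\<exists>x. ?Q (set_slot e 1 x))" for e :: "nat \<times> 'n \<Rightarrow> complex"
    have "constructible ?C ?Q"
      by (intro constructible_conj constructible_eq alg_coord constructible_crit[OF V F, of 1 3 0]) auto
    then have cB: "constructible ?C B" unfolding B_def by (rule constructible_ex_slot)
    have B_iff: "B e \<longleftrightarrow> (\<exists>x\<in>crit V r F (slot e 0). x $ i = e (2, i))" for e
    proof -
      have "slot (set_slot e 1 x) 1 = x" for x by (simp only: slot_set_slot refl if_True)
      moreover have "slot (set_slot e 1 x) 0 = slot e 0" for x by (simp add: slot_set_slot)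
      moreover have "set_slot e 1 x (2, i) = e (2, i)" "set_slot e 1 x (1, i) = x $ i" for x
        by (simp_all add: set_slot_def)
      ultimately show ?thesis unfolding B_def by (simp add: Bex_def)
    qed
    have "generic_on ?C UNIV (\<lambda>e. \<not> B e)"
      by (rule generic_not_of_negligible[OF cB negligible_crit_image[OF F]]) (auto simp: B_iff)
    then obtain g e0 where g: "g \<in> alg ?C" "g e0 \<noteq> 0" "\<forall>e. g e \<noteq> 0 \<longrightarrow> \<not> B e" unfolding generic_on_def by auto
    obtain d q where q: "polyfam ?C d q" "\<forall>e y. g (e((2, i) := y)) = poly (q e) y"
      using alg_coords_polyfam[OF g(1)] by blast
    have "q e0 \<noteq> 0" using g(2) q(2)[rule_format, of e0 "e0 (2, i)"] by auto
    then obtain k where k: "coeff (q e0) k \<noteq> 0" by (metis leading_coeff_0_iff)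
    have "finite ((\<lambda>x. x $ i) ` crit V r F (slot e 0)) \<and> card ((\<lambda>x. x $ i) ` crit V r F (slot e 0)) \<le> d"
      if "coeff (q e) k \<noteq> 0" for e
    proof -
      have q0: "q e \<noteq> 0" using that by auto
      have "(\<lambda>x. x $ i) ` crit V r F (slot e 0) \<subseteq> {y. poly (q e) y = 0}"
      proof
        fix y assume "y \<in> (\<lambda>x. x $ i) ` crit V r F (slot e 0)"
        moreover have "slot (e((2, i) := y)) 0 = slot e 0" by (simp add: slot_def)
        ultimately have "B (e((2, i) := y))" unfolding B_iff by auto
        then have "g (e((2, i) := y)) = 0" using g(3) by blast
        then show "y \<in> {y. poly (q e) y = 0}" using q(2)[rule_format, of e y] by simp
      qed
      moreover have "finite {y. poly (q e) y = 0}" "card {y. poly (q e) y = 0} \<le> degree (q e)"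
        using poly_roots_finite[OF q0] card_poly_roots_bound[OF q0] by auto
      moreover have "degree (q e) \<le> d" using q(1) by (simp add: polyfam_def)
      ultimately show ?thesis by (meson card_mono finite_subset order_trans)
    qed
    then have "generic_on ?C UNIV (\<lambda>e. finite ((\<lambda>x. x $ i) ` crit V r F (slot e 0)) \<and>
        card ((\<lambda>x. x $ i) ` crit V r F (slot e 0)) \<le> d)"
      unfolding generic_on_def using k by (intro bexI[OF _ polyfam_coeff[OF q(1), of k]]) auto
    then show ?thesis by blast
  qed
  from choice[OF allI[OF one]] obtain d where d: "\<forall>i. generic_on ?C UNIV (\<lambda>e. finite ((\<lambda>x. x $ i) ` crit V r F (slot e 0)) \<and>
      card ((\<lambda>x. x $ i) ` crit V r F (slot e 0)) \<le> d i)" ..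
  have "generic_on ?C UNIV (\<lambda>e. \<forall>i\<in>UNIV. finite ((\<lambda>x. x $ i) ` crit V r F (slot e 0)) \<and>
      card ((\<lambda>x. x $ i) ` crit V r F (slot e 0)) \<le> d i)"
    by (rule generic_on_ball[OF prime_on_coords finite_class.finite_UNIV]) (rule d[rule_format])
  then have "generic_on ?C UNIV (\<lambda>e. finite (crit V r F (slot e 0)) \<and> card (crit V r F (slot e 0)) \<le> (\<Prod>i\<in>UNIV. d i))"
    by (rule generic_on_mono) (rule finite_card_coordinates, simp_all)
  then have "generically (\<lambda>u. finite (crit V r F u) \<and> card (crit V r F u) \<le> (\<Prod>i\<in>UNIV. d i))"
    by (rule generically_slot)
  then show ?thesis by blast
qed

text \<open>
  Also meaningful for infinite sets, and expressible by quantifying over \<open>k\<close> vectors.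
\<close>

definition at_least :: "nat \<Rightarrow> 'a set \<Rightarrow> bool" where
  "at_least k A \<longleftrightarrow> (\<exists>xs :: nat \<Rightarrow> 'a. (\<forall>a\<in>{1..k}. xs a \<in> A) \<and> inj_on xs {1..k})"

lemma at_least_card: "finite A \<Longrightarrow> at_least k A \<longleftrightarrow> k \<le> card A"
proof
  assume A: "finite A" "at_least k A"
  then obtain xs :: "nat \<Rightarrow> 'a" where "xs ` {1..k} \<subseteq> A" "inj_on xs {1..k}" unfolding at_least_def by blast
  then show "k \<le> card A" using card_inj_on_le[of xs "{1..k}" A] A(1) by simp
next
  assume "finite A" "k \<le> card A"
  then obtain S where S: "S \<subseteq> A" "card S = k" "finite S" by (metis obtain_subset_with_card_n)
  then obtain h where "bij_betw h {1..k} S"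
    using ex_bij_betw_nat_finite_1 by blast
  then show "at_least k A" unfolding at_least_def
    using S(1) by (intro exI[of _ h]) (auto simp: bij_betw_def)
qed

lemma generic_at_least_crit:
  fixes V :: "(complex ^ 'n::finite) set"
  assumes V: "zariski_closed V" and F: "F \<in> polyfuns"
  shows "generically (\<lambda>u. at_least k (crit V r F u)) \<or> generically (\<lambda>u. \<not> at_least k (crit V r F u))"
proof -
  let ?C = "coords :: ((nat \<times> 'n \<Rightarrow> complex) \<Rightarrow> complex) set"
  define Q where "Q e \<longleftrightarrow> (\<forall>a\<in>{1..k}. slot e a \<in> crit V r F (slot e 0)) \<and>
      (\<forall>a\<in>{1..k}. \<forall>b\<in>{1..k}. (a = b) \<or> \<not> (\<forall>i\<in>UNIV. e (a, i) = e (b, i)))"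
    for e :: "nat \<times> 'n \<Rightarrow> complex"
  have "constructible ?C (\<lambda>e. slot e a \<in> crit V r F (slot e 0))" if "a \<in> {1..k}" for a
    by (rule constructible_crit[OF V F, of a "Suc k" 0]) (use that in auto)
  then have "constructible ?C Q"
    unfolding Q_def by (intro constructible_conj constructible_ball constructible_disj constructible_not constructible_eq
        alg_coord constructible_const) auto
  then have cQ: "constructible ?C (\<lambda>e. \<exists>e'. (\<forall>v. v \<notin> {1..k} \<times> UNIV \<longrightarrow> e' v = e v) \<and> Q e')"
    by (intro constructible_ex) auto
  have "(\<exists>e'. (\<forall>v. v \<notin> {1..k} \<times> UNIV \<longrightarrow> e' v = e v) \<and> Q e') \<longleftrightarrow> at_least k (crit V r F (slot e 0))" for e
  proof
    assume "\<exists>e'. (\<forall>v. v \<notin> {1..k} \<times> UNIV \<longrightarrow> e' v = e v) \<and> Q e'"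
    then obtain e' where e': "\<forall>v. v \<notin> {1..k} \<times> UNIV \<longrightarrow> e' v = e v" "Q e'" by blast
    have "slot e' 0 = slot e 0" using e'(1) by (simp add: slot_def)
    moreover have "inj_on (slot e') {1..k}"
    proof (rule inj_onI)
      fix a b assume ab: "a \<in> {1..k}" "b \<in> {1..k}" "slot e' a = slot e' b"
      then have "\<forall>i\<in>UNIV. e' (a, i) = e' (b, i)" by (simp add: slot_def vec_eq_iff)
      then show "a = b" using e'(2) ab(1,2) unfolding Q_def by blast
    qed
    ultimately show "at_least k (crit V r F (slot e 0))"
      unfolding at_least_def using e'(2) unfolding Q_def by (intro exI[of _ "slot e'"]) auto
  next
    assume "at_least k (crit V r F (slot e 0))"
    then obtain xs :: "nat \<Rightarrow> complex ^ 'n" where xs: "\<forall>a\<in>{1..k}. xs a \<in> crit V r F (slot e 0)" "inj_on xs {1..k}"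
      unfolding at_least_def by blast
    let ?e = "\<lambda>(a, i). if a \<in> {1..k} then xs a $ i else e (a, i)"
    have s: "slot ?e a = (if a \<in> {1..k} then xs a else slot e a)" for a
      by (cases "a \<in> {1..k}") (auto simp: slot_def vec_eq_iff)
    have "\<forall>a\<in>{1..k}. \<forall>b\<in>{1..k}. a = b \<or> \<not> (\<forall>i\<in>UNIV. ?e (a, i) = ?e (b, i))"
    proof (intro ballI)
      fix a b assume ab: "a \<in> {1..k}" "b \<in> {1..k}"
      have "a = b" if "\<forall>i\<in>UNIV. ?e (a, i) = ?e (b, i)"
      proof -
        have "xs a = xs b" using that ab by (simp add: vec_eq_iff)
        then show "a = b" using inj_onD[OF xs(2)] ab by blast
      qed
      then show "a = b \<or> \<not> (\<forall>i\<in>UNIV. ?e (a, i) = ?e (b, i))" by argo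
    qed
    then have "Q ?e" using xs(1) unfolding Q_def s by simp
    then show "\<exists>e'. (\<forall>v. v \<notin> {1..k} \<times> UNIV \<longrightarrow> e' v = e v) \<and> Q e'" by (intro exI[of _ ?e]) auto
  qed
  then have "constructible ?C (\<lambda>e. at_least k (crit V r F (slot e 0)))" using cQ by simp
  from generic_dichotomy[OF prime_on_coords this] show ?thesis
    using generically_slot[of "\<lambda>u. at_least k (crit V r F u)" 0] generically_slot[of "\<lambda>u. \<not> at_least k (crit V r F u)" 0]
    by blast
qed

lemma generically_conj: "generically P \<Longrightarrow> generically Q \<Longrightarrow> generically (\<lambda>u. P u \<and> Q u)"
  unfolding generically_generic_on by (rule generic_on_conj[OF prime_on_UNIV])

lemma generically_mono: "generically P \<Longrightarrow> (\<And>u. P u \<Longrightarrow> Q u) \<Longrightarrow> generically Q"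
  unfolding generically_generic_on by (rule generic_on_mono)

lemma generically_ex: "generically P \<Longrightarrow> \<exists>u. P u"
  unfolding generically_def by blast

text \<open>
  The generic number is the least \<open>k\<close> that is generically not reached, minus one.
\<close>

theorem generic_card_crit:
  fixes V :: "(complex ^ 'n::finite) set"
  assumes V: "zariski_closed V" and F: "F \<in> polyfuns"
  shows "\<exists>N. generically (\<lambda>u. finite (crit V r F u) \<and> card (crit V r F u) = N)"
proof -
  let ?W = "crit V r F"
  obtain K where K: "generically (\<lambda>u. finite (?W u) \<and> card (?W u) \<le> K)" using generically_bounded_crit[OF V F] by blast
  have "\<not> generically (\<lambda>u. at_least (Suc K) (?W u))"
  proof
    assume "generically (\<lambda>u. at_least (Suc K) (?W u))"
    from generically_ex[OF generically_conj[OF K this]] show False by (auto simp: at_least_card)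
  qed
  then have ex: "generically (\<lambda>u. \<not> at_least (Suc K) (?W u))" using generic_at_least_crit[OF V F] by blast
  define k where "k = (LEAST k. generically (\<lambda>u. \<not> at_least k (?W u)))"
  have k: "generically (\<lambda>u. \<not> at_least k (?W u))" unfolding k_def
    by (rule LeastI[of "\<lambda>k. generically (\<lambda>u. \<not> at_least k (?W u))", OF ex])
  have "k \<noteq> 0"
  proof
    assume "k = 0"
    then show False using generically_ex[OF k] by (auto simp: at_least_def)
  qed
  then have "\<not> generically (\<lambda>u. \<not> at_least (k - 1) (?W u))"
    unfolding k_def by (intro not_less_Least) simp
  then have "generically (\<lambda>u. at_least (k - 1) (?W u))" using generic_at_least_crit[OF V F] by blast
  from generically_conj[OF K generically_conj[OF k this]]
  have "generically (\<lambda>u. finite (?W u) \<and> card (?W u) = k - 1)"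
    by (rule generically_mono) (auto simp: at_least_card)
  then show ?thesis by blast
qed

section \<open>Homogeneous polynomials\<close>

abbreviation mdeg :: "('n::finite \<Rightarrow>\<^sub>0 nat) \<Rightarrow> nat" where
  "mdeg m \<equiv> \<Sum>i\<in>UNIV. Poly_Mapping.lookup m i"

lemma mon_scale:
  "(\<Prod>i\<in>UNIV. ((c *s x) $ i) ^ Poly_Mapping.lookup m i) =
     c ^ mdeg m * (\<Prod>i\<in>UNIV. (x $ i) ^ Poly_Mapping.lookup m i)" for x :: "complex ^ 'n::finite"
  by (simp add: power_mult_distrib prod.distrib power_sum)

lemma homogeneous_scale:
  assumes "homogeneous_poly e p" shows "peval p (c *s x) = c ^ e * peval p x"
proof -
  have "peval p (c *s x) = (\<Sum>m\<in>Poly_Mapping.keys p. c ^ e * (Poly_Mapping.lookup p m * (\<Prod>i\<in>UNIV. (x $ i) ^ Poly_Mapping.lookup m i)))"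
    unfolding peval_def mon_scale
    by (intro sum.cong) (use assms in \<open>auto simp: homogeneous_poly_def\<close>)
  then show ?thesis by (simp add: peval_def sum_distrib_left)
qed

definition hom_component :: "nat \<Rightarrow> 'n::finite cpoly \<Rightarrow> 'n cpoly" where
  "hom_component e p = (\<Sum>m\<in>{m \<in> Poly_Mapping.keys p. mdeg m = e}. Poly_Mapping.single m (Poly_Mapping.lookup p m))"

lemma homogeneous_hom_component: "homogeneous_poly e (hom_component e p)"
proof -
  have "Poly_Mapping.keys (hom_component e p) \<subseteq> {m \<in> Poly_Mapping.keys p. mdeg m = e}"
    unfolding hom_component_def by (rule order_trans[OF keys_sum]) (auto split: if_splits)
  then show ?thesis unfolding homogeneous_poly_def by auto
qed

lemma peval_scale_hom_component:
  "peval p (c *s x) = (\<Sum>e\<in>mdeg ` Poly_Mapping.keys p. c ^ e * peval (hom_component e p) x)"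
proof -
  have h: "peval (hom_component e p) x = (\<Sum>m\<in>{m \<in> Poly_Mapping.keys p. mdeg m = e}.
      Poly_Mapping.lookup p m * (\<Prod>i\<in>UNIV. (x $ i) ^ Poly_Mapping.lookup m i))" for e
    unfolding hom_component_def peval_sum peval_single ..
  have "peval p (c *s x) = (\<Sum>m\<in>Poly_Mapping.keys p. c ^ mdeg m * (Poly_Mapping.lookup p m * (\<Prod>i\<in>UNIV. (x $ i) ^ Poly_Mapping.lookup m i)))"
    unfolding peval_def mon_scale by (intro sum.cong) auto
  also have "\<dots> = (\<Sum>e\<in>mdeg ` Poly_Mapping.keys p. \<Sum>m\<in>{m \<in> Poly_Mapping.keys p. mdeg m = e}.
      c ^ mdeg m * (Poly_Mapping.lookup p m * (\<Prod>i\<in>UNIV. (x $ i) ^ Poly_Mapping.lookup m i)))"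
    by (rule sum.image_gen) simp
  also have "\<dots> = (\<Sum>e\<in>mdeg ` Poly_Mapping.keys p. c ^ e * peval (hom_component e p) x)"
    unfolding h sum_distrib_left by (intro sum.cong) auto
  finally show ?thesis .
qed

text \<open>
  Along the line through \<open>x\<close> the values of the components are the coefficients of a polynomial in \<open>c\<close>.
\<close>

lemma hom_component_zero:
  assumes "\<And>c. peval p (c *s x) = 0" shows "peval (hom_component e p) x = 0"
proof -
  let ?E = "mdeg ` Poly_Mapping.keys p"
  define q where "q = (\<Sum>k\<in>?E. monom (peval (hom_component k p) x) k)"
  have "poly q c = 0" for c
    using assms[of c] unfolding peval_scale_hom_component q_def by (simp add: poly_sum poly_monom mult.commute)
  then have "q = 0" using poly_all_0_iff_0 by blast
  then have "0 = coeff q e" by simp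
  also have "\<dots> = (if e \<in> ?E then peval (hom_component e p) x else 0)"
    unfolding q_def by (simp add: coeff_sum sum.delta)
  finally have a: "(if e \<in> ?E then peval (hom_component e p) x else 0) = 0" by simp
  show ?thesis
  proof (cases "e \<in> ?E")
    case True
    then show ?thesis using a by simp
  next
    case False
    then have "hom_component e p = 0" unfolding hom_component_def by (intro sum.neutral) auto
    then show ?thesis by simp
  qed
qed

lemma homogeneous_mult:
  assumes "homogeneous_poly d p" "homogeneous_poly e q" shows "homogeneous_poly (d + e) (p * q)"
  unfolding homogeneous_poly_def
proof
  fix m assume "m \<in> Poly_Mapping.keys (p * q)"
  then have "m \<in> {a + b | a b. a \<in> Poly_Mapping.keys p \<and> b \<in> Poly_Mapping.keys q}" by (rule subsetD[OF keys_mult])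
  then obtain a b where "a \<in> Poly_Mapping.keys p" "b \<in> Poly_Mapping.keys q" "m = a + b" by blast
  then show "mdeg m = d + e"
    using assms unfolding homogeneous_poly_def by (simp add: lookup_add sum.distrib)
qed

lemma homogeneous_linear_power: "homogeneous_poly d (linear_poly u ^ d)"
proof (induction d)
  case 0
  show ?case by (simp add: homogeneous_poly_def)
next
  case (Suc d)
  have "homogeneous_poly 1 (linear_poly u)" unfolding homogeneous_poly_def
  proof
    fix m assume "m \<in> Poly_Mapping.keys (linear_poly u)"
    then have "m \<in> (\<Union>i\<in>UNIV. Poly_Mapping.keys (Poly_Mapping.single (Poly_Mapping.single i 1) (u $ i)))"
      unfolding linear_poly_def by (rule subsetD[OF keys_sum])
    then obtain i where "m = Poly_Mapping.single i 1" by (auto split: if_splits)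
    then show "mdeg m = 1" by (simp add: lookup_single when_def)
  qed
  from homogeneous_mult[OF this Suc] show ?case by simp
qed

lemma peval_linear: "peval (linear_poly u) x = dotp u x"
  by (simp add: peval_linear_poly dotp_def)

section \<open>The affine cone\<close>

lemma span_singleton: "vec.span {x} = range (\<lambda>c. c *s x)" for x :: "complex ^ 'n::finite"
  by (rule vec.span_singleton)

lemma span_singleton_scale: "c \<noteq> 0 \<Longrightarrow> vec.span {c *s x} = vec.span {x}" for x :: "complex ^ 'n::finite"
proof -
  assume c: "c \<noteq> 0"
  have "k *s x \<in> range (\<lambda>k. k *s (c *s x))" for k
    by (rule range_eqI[of _ _ "k / c"]) (use c in \<open>simp add: vec_eq_iff\<close>)
  moreover have "k *s (c *s x) \<in> range (\<lambda>k. k *s x)" for k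
    by (rule range_eqI[of _ _ "k * c"]) (simp add: vec_eq_iff)
  ultimately show ?thesis unfolding span_singleton by blast
qed

locale proj_variety =
  fixes X :: "(complex ^ 'n::finite) set set"
  assumes closed: "proj_closed X" and irr: "proj_irreducible X"
begin

abbreviation "C \<equiv> affine_cone X"

lemma X_proj_space: "L \<in> X \<Longrightarrow> L \<in> proj_space"
  using closed unfolding proj_closed_def by blast

lemma lineE:
  assumes "L \<in> X" "x \<in> L" "x \<noteq> 0" shows "L = vec.span {x}"
proof -
  obtain y where y: "L = vec.span {y}" using X_proj_space[OF assms(1)] unfolding proj_space_def by blast
  obtain c where "x = c *s y" using assms(2) unfolding y span_singleton by blast
  moreover from this have "c \<noteq> 0" using assms(3) by auto
  ultimately show ?thesis using y span_singleton_scale[of c y] by simp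
qed

lemma zero_in_line: "L \<in> X \<Longrightarrow> 0 \<in> L"
  using X_proj_space[of L] vec.span_zero unfolding proj_space_def by auto

lemma cone_iff: "x \<noteq> 0 \<Longrightarrow> x \<in> C \<longleftrightarrow> vec.span {x} \<in> X"
proof
  assume x: "x \<noteq> 0" "x \<in> C"
  then obtain L where L: "L \<in> X" "x \<in> L" unfolding affine_cone_def by blast
  then show "vec.span {x} \<in> X" using lineE[OF L x(1)] by simp
next
  assume "vec.span {x} \<in> X"
  moreover have "x \<in> vec.span {x}" by (rule vec.span_base) simp
  ultimately show "x \<in> C" unfolding affine_cone_def by blast
qed

lemma cone_scale: assumes "x \<in> C" shows "c *s x \<in> C"
proof (cases "c = 0 \<or> x = 0")
  case True
  then show ?thesis by (auto simp: affine_cone_def)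
next
  case False
  then show ?thesis using assms cone_iff[of x] cone_iff[of "c *s x"] span_singleton_scale[of c x] by simp
qed

lemma nonempty: "\<exists>L. L \<in> X"
  using irr unfolding proj_irreducible_def by blast

lemma line_subset_cone: "L \<in> X \<Longrightarrow> L \<subseteq> C"
  unfolding affine_cone_def by blast

lemma zariski_closed_cone: "zariski_closed C"
proof -
  obtain S where S: "\<forall>p\<in>S. \<exists>e. homogeneous_poly e p" "X = {L \<in> proj_space. \<forall>p\<in>S. \<forall>x\<in>L. peval p x = 0}"
    using closed unfolding proj_closed_def by blast
  have "C = {x. \<forall>p\<in>S. peval p x = 0}"
  proof
    show "C \<subseteq> {x. \<forall>p\<in>S. peval p x = 0}"
    proof
      fix x assume x: "x \<in> C"
      obtain L where "L \<in> X" "x \<in> L" using x nonempty zero_in_line unfolding affine_cone_def by blast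
      then show "x \<in> {x. \<forall>p\<in>S. peval p x = 0}" using S(2) by blast
    qed
    show "{x. \<forall>p\<in>S. peval p x = 0} \<subseteq> C"
    proof
      fix x assume x: "x \<in> {x. \<forall>p\<in>S. peval p x = 0}"
      show "x \<in> C"
      proof (cases "x = 0")
        case True
        then show ?thesis by (simp add: affine_cone_def)
      next
        case False
        have "peval p (c *s x) = 0" if pS: "p \<in> S" for p c
        proof -
          obtain e where "homogeneous_poly e p" using S(1) pS by blast
          then show ?thesis using x pS by (simp add: homogeneous_scale)
        qed
        then have "vec.span {x} \<in> X" using False unfolding S(2) span_singleton proj_space_def by auto
        then show ?thesis using cone_iff[OF False] by simp
      qed
    qed
  qed
  then show ?thesis unfolding zariski_closed_def by blast
qed

text \<open>
  A line lies in the zero set of a polynomial iff it lies in those of its homogeneous components.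
\<close>

lemma proj_closed_lines_in:
  fixes A :: "(complex ^ 'n) set"
  assumes "zariski_closed A" shows "proj_closed {L \<in> proj_space. L \<subseteq> A}"
proof -
  obtain S where S: "A = {x. \<forall>p\<in>S. peval p x = 0}" using assms unfolding zariski_closed_def by blast
  let ?S = "{hom_component e p | e p. p \<in> S}"
  have "{L \<in> proj_space. L \<subseteq> A} = {L \<in> proj_space. \<forall>q\<in>?S. \<forall>x\<in>L. peval q x = 0}"
  proof (intro Collect_cong conj_cong refl)
    fix L :: "(complex ^ 'n) set" assume "L \<in> proj_space"
    then have cl: "c *s x \<in> L" if "x \<in> L" for c x
      using that unfolding proj_space_def by (auto intro: vec.span_scale)
    show "L \<subseteq> A \<longleftrightarrow> (\<forall>q\<in>?S. \<forall>x\<in>L. peval q x = 0)"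
    proof
      assume LA: "L \<subseteq> A"
      show "\<forall>q\<in>?S. \<forall>x\<in>L. peval q x = 0"
      proof (intro ballI)
        fix q x assume "q \<in> ?S" and x: "x \<in> L"
        then obtain e p where q: "q = hom_component e p" "p \<in> S" by blast
        have "peval p (c *s x) = 0" for c using cl[OF x, of c] LA q(2) unfolding S by blast
        then show "peval q x = 0" unfolding q(1) by (rule hom_component_zero)
      qed
    next
      assume q: "\<forall>q\<in>?S. \<forall>x\<in>L. peval q x = 0"
      have "peval p x = 0" if "x \<in> L" "p \<in> S" for x p
      proof -
        have "peval (hom_component e p) x = 0" for e using q that by blast
        then show ?thesis using peval_scale_hom_component[of p 1 x] by simp
      qed
      then show "L \<subseteq> A" unfolding S by blast
    qed
  qed
  moreover have "\<forall>q\<in>?S. \<exists>e. homogeneous_poly e q" using homogeneous_hom_component by blast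
  ultimately show ?thesis unfolding proj_closed_def by (intro exI[of _ ?S]) simp
qed

lemma line_in_closed:
  fixes A :: "(complex ^ 'n) set"
  assumes A: "zariski_closed A" and inf: "infinite {c. c *s x \<in> A}"
  shows "vec.span {x} \<subseteq> A"
proof -
  have "f (c *s x) = 0" if f: "f \<in> vanishing A" for f c
  proof -
    have fP: "f \<in> polyfuns" using f by (simp add: vanishing_def)
    obtain q where q: "\<forall>s. f (0 + s *s x) = poly q s" using polyfun_on_line[OF fP] by blast
    have "{c. c *s x \<in> A} \<subseteq> {s. poly q s = 0}" using f q by (auto simp: vanishing_def)
    then have "q = 0" using inf poly_roots_finite finite_subset by blast
    then show ?thesis using q[rule_format, of c] by simp
  qed
  then show ?thesis using zariski_closed_vanishing[OF A] unfolding span_singleton by blast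
qed

text \<open>
  If two closed sets cover the cone, each line of the cone meets one of them in infinitely many points
  and so lies in it. The lines contained in either set form two projective closed sets that cover \<open>X\<close>.
\<close>

lemma zariski_irreducible_cone: "zariski_irreducible C"
  unfolding zariski_irreducible_def
proof (intro conjI allI impI)
  show "C \<noteq> {}" by (simp add: affine_cone_def)
  fix A B :: "(complex ^ 'n) set" assume A: "zariski_closed A" and B: "zariski_closed B" and AB: "C \<subseteq> A \<union> B"
  have cov: "L \<subseteq> A \<or> L \<subseteq> B" if "L \<in> X" for L
  proof -
    obtain x where x: "L = vec.span {x}" using X_proj_space[OF \<open>L \<in> X\<close>] unfolding proj_space_def by blast
    have "c *s x \<in> A \<union> B" for c using AB line_subset_cone[OF \<open>L \<in> X\<close>] unfolding x span_singleton by blast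
    then have "UNIV = {c. c *s x \<in> A} \<union> {c. c *s x \<in> B}" by blast
    then have "infinite {c. c *s x \<in> A} \<or> infinite {c. c *s x \<in> B}"
      using infinite_UNIV_char_0[where 'a = complex] by (metis finite_Un)
    then show ?thesis unfolding x using line_in_closed[OF A] line_in_closed[OF B] by blast
  qed
  have "X \<subseteq> {L \<in> proj_space. L \<subseteq> A} \<union> {L \<in> proj_space. L \<subseteq> B}" using cov X_proj_space by blast
  then have "X \<subseteq> {L \<in> proj_space. L \<subseteq> A} \<or> X \<subseteq> {L \<in> proj_space. L \<subseteq> B}"
    using irr proj_closed_lines_in[OF A] proj_closed_lines_in[OF B] unfolding proj_irreducible_def by blast
  then have "\<Union>X \<subseteq> A \<or> \<Union>X \<subseteq> B" by blast
  moreover have "C = \<Union>X" using nonempty zero_in_line unfolding affine_cone_def by blast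
  ultimately show "C \<subseteq> A \<or> C \<subseteq> B" by simp
qed

end

lemma prime_on_irreducible:
  assumes "prime_on axes V" shows "zariski_irreducible V"
  unfolding zariski_irreducible_def
proof (intro conjI allI impI)
  show "V \<noteq> {}" using assms unfolding prime_on_def by blast
  fix A B assume A: "zariski_closed A" and B: "zariski_closed B" and AB: "V \<subseteq> A \<union> B"
  show "V \<subseteq> A \<or> V \<subseteq> B"
  proof (rule ccontr)
    assume "\<not> (V \<subseteq> A \<or> V \<subseteq> B)"
    then obtain a b where ab: "a \<in> V" "a \<notin> A" "b \<in> V" "b \<notin> B" by blast
    obtain f where f: "f \<in> vanishing A" "f a \<noteq> 0" using ab(2) zariski_closed_vanishing[OF A] by blast
    obtain g where g: "g \<in> vanishing B" "g b \<noteq> 0" using ab(4) zariski_closed_vanishing[OF B] by blast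
    have "(\<forall>x\<in>V. f x = 0) \<or> (\<forall>x\<in>V. g x = 0)"
      by (rule prime_onD[OF assms]) (use f(1) g(1) AB in \<open>auto simp: vanishing_def\<close>)
    then show False using f(2) g(2) ab by blast
  qed
qed

text \<open>
  A power of \<open>y $ i\<close> clears the denominators of \<open>f (y / y $ i)\<close>. Multiplying by a further \<open>y $ i\<close>
  turns functions vanishing on the chart into functions vanishing on the cone.
\<close>

lemma homogenization:
  fixes i :: "'n::finite"
  assumes "f \<in> polyfuns"
  shows "\<exists>e. \<exists>fh\<in>polyfuns. \<forall>y. y $ i \<noteq> 0 \<longrightarrow> fh y = y $ i ^ e * f ((1 / y $ i) *s y)"
  using assms
proof (induction rule: alg.induct)
  case (alg_const c)
  show ?case by (intro exI[of _ 0] bexI[OF _ alg.alg_const[of c]]) simp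
next
  case (alg_gen f)
  then obtain j where f: "f = (\<lambda>x. x $ j)" by (auto simp: axes_def)
  show ?case by (intro exI[of _ 1] bexI[OF _ polyfun_axis[of j]]) (simp add: f)
next
  case (alg_add f g)
  then obtain d p e q where p: "p \<in> polyfuns" "\<forall>y. y $ i \<noteq> 0 \<longrightarrow> p y = y $ i ^ d * f ((1 / y $ i) *s y)"
    and q: "q \<in> polyfuns" "\<forall>y. y $ i \<noteq> 0 \<longrightarrow> q y = y $ i ^ e * g ((1 / y $ i) *s y)" by blast
  have "(\<lambda>y. y $ i ^ e * p y + y $ i ^ d * q y) \<in> polyfuns"
    by (intro alg.alg_add alg.alg_mult alg_power p q polyfun_axis)
  moreover have "\<forall>y. y $ i \<noteq> 0 \<longrightarrow> y $ i ^ e * p y + y $ i ^ d * q y =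
      y $ i ^ (d + e) * (f ((1 / y $ i) *s y) + g ((1 / y $ i) *s y))"
    using p(2) q(2) by (simp add: power_add algebra_simps)
  ultimately show ?case by (intro exI[of _ "d + e"] bexI[of _ "\<lambda>y. y $ i ^ e * p y + y $ i ^ d * q y"])
next
  case (alg_mult f g)
  then obtain d p e q where p: "p \<in> polyfuns" "\<forall>y. y $ i \<noteq> 0 \<longrightarrow> p y = y $ i ^ d * f ((1 / y $ i) *s y)"
    and q: "q \<in> polyfuns" "\<forall>y. y $ i \<noteq> 0 \<longrightarrow> q y = y $ i ^ e * g ((1 / y $ i) *s y)" by blast
  have "(\<lambda>y. p y * q y) \<in> polyfuns"
    by (intro alg.alg_mult p q)
  moreover have "\<forall>y. y $ i \<noteq> 0 \<longrightarrow> p y * q y =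
      y $ i ^ (d + e) * (f ((1 / y $ i) *s y) * g ((1 / y $ i) *s y))"
    using p(2) q(2) by (simp add: power_add algebra_simps)
  ultimately show ?case by (intro exI[of _ "d + e"] bexI[of _ "\<lambda>y. p y * q y"])
qed

lemma frechet_compose_scale:
  fixes f :: "complex ^ 'n::finite \<Rightarrow> complex"
  assumes "f \<in> polyfuns"
  shows "(\<lambda>y. f (c *s y)) \<in> polyfuns"
    and "frechet_derivative (\<lambda>y. f (c *s y)) (at x) v = c * frechet_derivative f (at (c *s x)) v"
proof -
  show "(\<lambda>y. f (c *s y)) \<in> polyfuns"
  proof (rule alg_compose[OF assms])
    fix a :: "complex ^ 'n \<Rightarrow> complex" assume "a \<in> axes"
    then obtain i where a: "a = (\<lambda>x. x $ i)" by (auto simp: axes_def)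
    have "(\<lambda>y :: complex ^ 'n. c * y $ i) \<in> polyfuns" by (intro alg_mult alg_const polyfun_axis)
    then show "(\<lambda>y. a (c *s y)) \<in> polyfuns" by (simp add: a)
  qed
  have "bounded_linear (\<lambda>y :: complex ^ 'n. c *s y)"
    by (rule linear_conv_bounded_linear[THEN iffD1], rule linearI) (auto simp: vec_eq_iff algebra_simps)
  then have "((\<lambda>y. c *s y) has_derivative (\<lambda>y. c *s y)) (at x)" by (rule bounded_linear_imp_has_derivative)
  from has_derivative_compose[OF this polyfun_has_derivative[OF assms]]
  have "frechet_derivative (\<lambda>y. f (c *s y)) (at x) = (\<lambda>v. frechet_derivative f (at (c *s x)) (c *s v))"
    by (rule frechet_derivative_at[symmetric])
  then show "frechet_derivative (\<lambda>y. f (c *s y)) (at x) v = c * frechet_derivative f (at (c *s x)) v"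
    by (simp add: frechet_scale[OF assms])
qed

lemma vanishing_lineD:
  fixes f :: "complex ^ 'n::finite \<Rightarrow> complex"
  assumes f: "f \<in> polyfuns" and q: "\<And>s. f (x + s *s v) = poly q s"
  shows "frechet_derivative f (at x) v = poly (pderiv q) 0"
  using pderiv_on_line[OF f q, of 0] by simp

context proj_variety
begin

lemma tangent_cone_scale_subset:
  assumes "c \<noteq> 0" shows "tangent_space C x \<subseteq> tangent_space C (c *s x)"
proof
  fix v assume v: "v \<in> tangent_space C x"
  have "frechet_derivative f (at (c *s x)) v = 0" if f: "f \<in> vanishing C" for f
  proof -
    have fP: "f \<in> polyfuns" using f by (simp add: vanishing_def)
    have "(\<lambda>y. f (c *s y)) \<in> vanishing C"
      using f frechet_compose_scale(1)[OF fP] cone_scale by (simp add: vanishing_def)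
    then have "frechet_derivative (\<lambda>y. f (c *s y)) (at x) v = 0" using v unfolding tangent_space_vanishing by blast
    then show ?thesis using assms by (simp add: frechet_compose_scale(2)[OF fP])
  qed
  then show "v \<in> tangent_space C (c *s x)" unfolding tangent_space_vanishing by blast
qed

lemma tangent_cone_scale:
  assumes "c \<noteq> 0" shows "tangent_space C (c *s x) = tangent_space C x"
  using tangent_cone_scale_subset[OF assms, of x] tangent_cone_scale_subset[of "1 / c" "c *s x"] assms by auto

lemma smooth_cone_scale:
  assumes "c \<noteq> 0" "x \<in> smooth_locus C" shows "c *s x \<in> smooth_locus C"
  using assms cone_scale tangent_cone_scale[OF assms(1)] by (simp add: smooth_locus_def)

lemma euler_tangent: assumes "x \<in> C" shows "x \<in> tangent_space C x"
proof -
  have "frechet_derivative f (at x) x = 0" if f: "f \<in> vanishing C" for f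
  proof -
    have "f (x + s *s x) = poly 0 s" for s
    proof -
      have "x + s *s x = (1 + s) *s x" by (simp add: vec_eq_iff algebra_simps)
      then have "x + s *s x \<in> C" using cone_scale[OF assms, of "1 + s"] by simp
      then show ?thesis using f by (auto simp: vanishing_def)
    qed
    from vanishing_lineD[OF _ this] show ?thesis using f by (simp add: vanishing_def)
  qed
  then show ?thesis unfolding tangent_space_vanishing by blast
qed

lemma chart_scale: assumes "y \<in> C" "y $ i \<noteq> 0" shows "(1 / y $ i) *s y \<in> affine_chart X i"
  using cone_scale[OF assms(1), of "1 / y $ i"] assms(2) by (simp add: affine_chart_def)

lemma chart_cone: "x \<in> affine_chart X i \<Longrightarrow> x \<in> C \<and> x $ i = 1"
  by (simp add: affine_chart_def)

lemma zariski_closed_chart: "zariski_closed (affine_chart X i)"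
proof -
  have "zariski_closed {x. x $ i - 1 = 0}" by (rule zariski_closed_zero) (intro alg_diff polyfun_axis alg_const)
  from zariski_closed_Int[OF zariski_closed_cone this] show ?thesis
    by (simp add: affine_chart_def Collect_conj_eq[symmetric] Int_def)
qed

lemma homogenization_on_chart:
  assumes fh: "\<forall>y. y $ i \<noteq> 0 \<longrightarrow> fh y = y $ i ^ e * f ((1 / y $ i) *s y)" and x: "x \<in> affine_chart X i"
  shows "fh x = f x"
  using fh[rule_format, of x] chart_cone[OF x] by simp

lemma prime_on_chart:
  assumes "affine_chart X i \<noteq> {}" shows "prime_on axes (affine_chart X i)"
  unfolding prime_on_def
proof (intro conjI ballI impI)
  show "affine_chart X i \<noteq> {}" by fact
  fix f g assume f: "f \<in> polyfuns" and g: "g \<in> polyfuns" and fg: "\<forall>x\<in>affine_chart X i. f x * g x = 0"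
  obtain d p where p: "p \<in> polyfuns" "\<forall>y. y $ i \<noteq> 0 \<longrightarrow> p y = y $ i ^ d * f ((1 / y $ i) *s y)"
    using homogenization[OF f] by blast
  obtain e q where q: "q \<in> polyfuns" "\<forall>y. y $ i \<noteq> 0 \<longrightarrow> q y = y $ i ^ e * g ((1 / y $ i) *s y)"
    using homogenization[OF g] by blast
  have "(\<forall>y\<in>C. y $ i * p y = 0) \<or> (\<forall>y\<in>C. q y = 0)"
  proof (rule prime_onD[OF zariski_irreducible_prime_on[OF zariski_irreducible_cone]])
    show "(\<lambda>y. y $ i * p y) \<in> polyfuns" by (intro alg_mult polyfun_axis p(1))
    show "q \<in> polyfuns" by fact
    fix y assume y: "y \<in> C"
    show "y $ i * p y * q y = 0"
    proof (cases "y $ i = 0")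
      case False
      have "f ((1 / y $ i) *s y) * g ((1 / y $ i) *s y) = 0" using fg chart_scale[OF y False] by blast
      then show ?thesis using p(2) q(2) False by auto
    qed simp
  qed
  then show "(\<forall>x\<in>affine_chart X i. f x = 0) \<or> (\<forall>x\<in>affine_chart X i. g x = 0)"
  proof
    assume z: "\<forall>y\<in>C. y $ i * p y = 0"
    have "f x = 0" if x: "x \<in> affine_chart X i" for x
      using z homogenization_on_chart[OF p(2) x] chart_cone[OF x] by force
    then show ?thesis by blast
  next
    assume z: "\<forall>y\<in>C. q y = 0"
    have "g x = 0" if x: "x \<in> affine_chart X i" for x
      using z homogenization_on_chart[OF q(2) x] chart_cone[OF x] by force
    then show ?thesis by blast
  qed
qed

text \<open>
  A direction with \<open>v $ i = 0\<close> stays in the hyperplane \<open>y $ i = 1\<close>, where a function \<open>f\<close> on the chart and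
  its homogenization times \<open>y $ i\<close> agree, so their derivatives along \<open>v\<close> agree.
\<close>

lemma tangent_chart:
  assumes x: "x \<in> affine_chart X i"
  shows "tangent_space (affine_chart X i) x = {v \<in> tangent_space C x. v $ i = 0}"
proof
  have xi: "x $ i = 1" using chart_cone[OF x] by simp
  show "tangent_space (affine_chart X i) x \<subseteq> {v \<in> tangent_space C x. v $ i = 0}"
  proof
    fix v assume v: "v \<in> tangent_space (affine_chart X i) x"
    have "vanishing C \<subseteq> vanishing (affine_chart X i)" using chart_cone by (auto simp: vanishing_def)
    then have "v \<in> tangent_space C x" using v unfolding tangent_space_vanishing by blast
    moreover have "(\<lambda>y. y $ i - 1) \<in> vanishing (affine_chart X i)"
      unfolding vanishing_def using chart_cone by (auto intro!: alg_diff polyfun_axis alg_const)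
    then have "frechet_derivative (\<lambda>y. y $ i - 1) (at x) v = 0" using v unfolding tangent_space_vanishing by blast
    moreover have "((\<lambda>y. y $ i - 1) has_derivative (\<lambda>v. v $ i)) (at x)"
      using has_derivative_diff[OF bounded_linear_imp_has_derivative[OF bounded_linear_vec_nth[of i]] has_derivative_const[of 1]] by simp
    then have "frechet_derivative (\<lambda>y. y $ i - 1) (at x) v = v $ i" using frechet_derivative_at by metis
    ultimately show "v \<in> {v \<in> tangent_space C x. v $ i = 0}" by simp
  qed
  show "{v \<in> tangent_space C x. v $ i = 0} \<subseteq> tangent_space (affine_chart X i) x"
  proof
    fix v assume v: "v \<in> {v \<in> tangent_space C x. v $ i = 0}"
    have "frechet_derivative f (at x) v = 0" if f: "f \<in> vanishing (affine_chart X i)" for f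
    proof -
      have fP: "f \<in> polyfuns" using f by (simp add: vanishing_def)
      obtain e p where p: "p \<in> polyfuns" "\<forall>y. y $ i \<noteq> 0 \<longrightarrow> p y = y $ i ^ e * f ((1 / y $ i) *s y)"
        using homogenization[OF fP] by blast
      have "y $ i * p y = 0" if y: "y \<in> C" for y
      proof (cases "y $ i = 0")
        case False
        have "f ((1 / y $ i) *s y) = 0" using f chart_scale[OF y False] by (simp add: vanishing_def)
        then show ?thesis using p(2) False by auto
      qed simp
      then have "(\<lambda>y. y $ i * p y) \<in> vanishing C"
        unfolding vanishing_def by (auto intro!: alg_mult polyfun_axis p(1))
      then have z: "frechet_derivative (\<lambda>y. y $ i * p y) (at x) v = 0"
        using v unfolding tangent_space_vanishing by blast
      obtain q where q: "\<forall>s. f (x + s *s v) = poly q s" using polyfun_on_line[OF fP] by blast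
      have line: "(x + s *s v) $ i = 1" for s using v xi by simp
      have q': "(\<lambda>y. y $ i * p y) (x + s *s v) = poly q s" for s
        using p(2)[rule_format, of "x + s *s v"] line[of s] q by simp
      have "frechet_derivative f (at x) v = poly (pderiv q) 0"
        by (rule vanishing_lineD[OF fP]) (use q in blast)
      also have "\<dots> = frechet_derivative (\<lambda>y. y $ i * p y) (at x) v"
        by (rule vanishing_lineD[symmetric, OF alg_mult[OF polyfun_axis p(1)] q'])
      finally show ?thesis using z by simp
    qed
    then show "v \<in> tangent_space (affine_chart X i) x" unfolding tangent_space_vanishing by blast
  qed
qed

lemma tangent_cone_decompose:
  assumes x: "x \<in> affine_chart X i" and v: "v \<in> tangent_space C x"
  shows "v - v $ i *s x \<in> tangent_space (affine_chart X i) x"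
proof -
  have "v $ i *s x \<in> tangent_space C x"
    using chart_cone[OF x] euler_tangent vec.subspace_scale[OF subspace_tangent_space] by blast
  then have "v - v $ i *s x \<in> tangent_space C x" using v vec.subspace_diff[OF subspace_tangent_space] by blast
  then show ?thesis unfolding tangent_chart[OF x] using chart_cone[OF x] by simp
qed

lemma dim_tangent_chart:
  assumes x: "x \<in> affine_chart X i"
  shows "vec.dim (tangent_space C x) = Suc (vec.dim (tangent_space (affine_chart X i) x))"
proof -
  let ?T = "tangent_space (affine_chart X i) x"
  have sT: "vec.span ?T = ?T" using subspace_tangent_space vec.span_eq_iff by blast
  have "x \<notin> ?T" using chart_cone[OF x] unfolding tangent_chart[OF x] by simp
  then have "x \<notin> vec.span ?T" unfolding sT .
  then have "vec.dim (insert x ?T) = Suc (vec.dim ?T)"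
    unfolding vec.dim_insert by (simp only: if_False Suc_eq_plus1)
  moreover have "vec.span (insert x ?T) = tangent_space C x"
  proof
    have "insert x ?T \<subseteq> tangent_space C x"
      using chart_cone[OF x] euler_tangent unfolding tangent_chart[OF x] by blast
    then show "vec.span (insert x ?T) \<subseteq> tangent_space C x"
      by (rule vec.span_minimal[OF _ subspace_tangent_space])
    show "tangent_space C x \<subseteq> vec.span (insert x ?T)"
    proof
      fix v assume v: "v \<in> tangent_space C x"
      have "(v - v $ i *s x) + v $ i *s x \<in> vec.span (insert x ?T)"
        using tangent_cone_decompose[OF x v] by (intro vec.span_add vec.span_scale vec.span_base) auto
      then show "v \<in> vec.span (insert x ?T)" by simp
    qed
  qed
  ultimately show ?thesis by (metis vec.dim_span)
qed

text \<open>
  The Krull dimensions are the generic tangent dimensions. By homogenization, a generic condition on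
  the chart becomes one on the cone, so some point of the chart is generic for both.
\<close>

lemma krull_dim_chart:
  assumes "affine_chart X i \<noteq> {}"
  shows "krull_dim C = krull_dim (affine_chart X i) + 1"
proof -
  let ?V = "affine_chart X i"
  have primeC: "prime_on axes C" by (rule zariski_irreducible_prime_on[OF zariski_irreducible_cone])
  have genC: "generic_on axes C (\<lambda>x. enat (vec.dim (tangent_space C x)) = krull_dim C)"
    by (rule krull_dim_generic_tangent_dim[OF zariski_closed_cone zariski_irreducible_cone])
  have "generic_on axes ?V (\<lambda>x. enat (vec.dim (tangent_space ?V x)) = krull_dim ?V)"
    by (rule krull_dim_generic_tangent_dim[OF zariski_closed_chart prime_on_irreducible[OF prime_on_chart[OF assms]]])
  then obtain h x0 where h: "h \<in> polyfuns" "x0 \<in> ?V" "h x0 \<noteq> 0"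
    "\<forall>x\<in>?V. h x \<noteq> 0 \<longrightarrow> enat (vec.dim (tangent_space ?V x)) = krull_dim ?V" unfolding generic_on_def by blast
  obtain e p where p: "p \<in> polyfuns" "\<forall>y. y $ i \<noteq> 0 \<longrightarrow> p y = y $ i ^ e * h ((1 / y $ i) *s y)"
    using homogenization[OF h(1)] by blast
  have pP: "(\<lambda>y. y $ i * p y) \<in> polyfuns" by (intro alg_mult polyfun_axis p(1))
  have "x0 $ i * p x0 \<noteq> 0" using homogenization_on_chart[OF p(2) h(2)] chart_cone[OF h(2)] h(3) by simp
  then have "generic_on axes C (\<lambda>y. y $ i * p y \<noteq> 0)"
    unfolding generic_on_def using chart_cone[OF h(2)] by (intro bexI[OF _ pP] conjI) blast+
  from generic_on_ex[OF generic_on_conj[OF primeC genC this]]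
  obtain y where y: "y \<in> C" "enat (vec.dim (tangent_space C y)) = krull_dim C" "y $ i \<noteq> 0" "p y \<noteq> 0" by auto
  let ?x = "(1 / y $ i) *s y"
  have x: "?x \<in> ?V" by (rule chart_scale[OF y(1,3)])
  have "h ?x \<noteq> 0" using p(2) y(3,4) by auto
  then have "enat (vec.dim (tangent_space ?V ?x)) = krull_dim ?V" using h(4) x by blast
  moreover have "vec.dim (tangent_space C ?x) = Suc (vec.dim (tangent_space ?V ?x))" by (rule dim_tangent_chart[OF x])
  moreover have "tangent_space C ?x = tangent_space C y" by (rule tangent_cone_scale) (use y(3) in simp)
  ultimately show ?thesis using y(2) by (metis eSuc_enat eSuc_plus_1 plus_1_eSuc(2))
qed

lemma smooth_chart:
  assumes x: "x \<in> affine_chart X i"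
  shows "x \<in> smooth_locus (affine_chart X i) \<longleftrightarrow> x \<in> smooth_locus C"
proof -
  have "krull_dim C = eSuc (krull_dim (affine_chart X i))" using krull_dim_chart[of i] x plus_1_eSuc(2) by force
  then show ?thesis using x chart_cone[OF x] dim_tangent_chart[OF x]
    by (simp add: smooth_locus_def eSuc_enat[symmetric])
qed

end

section \<open>Logarithmic derivatives\<close>

lemma dlog_quotient:
  fixes f g :: "complex ^ 'n::finite \<Rightarrow> complex"
  assumes f: "f \<in> polyfuns" "f x \<noteq> 0" and g: "g \<in> polyfuns" "g x \<noteq> 0"
  shows "dlog (\<lambda>y. f y / g y) x v = frechet_derivative f (at x) v / f x - frechet_derivative g (at x) v / g x"
proof -
  have "frechet_derivative (\<lambda>y. f y / g y) (at x) =
      (\<lambda>v. (frechet_derivative f (at x) v * g x - f x * frechet_derivative g (at x) v) / (g x * g x))"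
    by (rule frechet_derivative_at[symmetric], rule has_derivative_divide'[OF polyfun_has_derivative[OF f(1)] polyfun_has_derivative[OF g(1)] g(2)])
  then show ?thesis unfolding dlog_def using f(2) g(2) by (simp add: field_simps)
qed

lemma has_derivative_dotp: "(dotp u has_derivative dotp u) (at x)"
proof (rule bounded_linear_imp_has_derivative, rule linear_conv_bounded_linear[THEN iffD1], rule linearI)
  show "dotp u (v + w) = dotp u v + dotp u w" for v w by (simp add: dotp_def algebra_simps sum.distrib)
  show "dotp u (c *\<^sub>R v) = c *\<^sub>R dotp u v" for c v by (simp add: dotp_def scaleR_sum_right)
qed

lemma frechet_linear: "frechet_derivative (peval (linear_poly u)) (at x) v = dotp u v"
proof -
  have "peval (linear_poly u) = dotp u" by (rule ext) (rule peval_linear)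
  then show ?thesis using frechet_derivative_at[OF has_derivative_dotp[of u x]] by simp
qed

lemma dotp_scale_right: "dotp u (c *s v) = c * dotp u v"
  by (simp add: dotp_def sum_distrib_left algebra_simps)

lemma dotp_diff_right: "dotp u (v - w) = dotp u v - dotp u w"
  by (simp add: dotp_def algebra_simps sum_subtractf)

lemma dlog_linear_power:
  assumes "dotp u x \<noteq> 0" "d \<ge> 1"
  shows "frechet_derivative (peval (linear_poly u ^ d)) (at x) v / peval (linear_poly u ^ d) x = of_nat d * dotp u v / dotp u x"
proof -
  have e: "peval (linear_poly u ^ d) = (\<lambda>y. dotp u y ^ d)" by (rule ext) (simp add: peval_power peval_linear)
  obtain d' where d: "d = Suc d'" using assms(2) by (cases d) auto
  have "((\<lambda>y. dotp u y ^ d) has_derivative (\<lambda>v. of_nat d * dotp u v * dotp u x ^ (d - 1))) (at x)"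
    by (rule has_derivative_power[OF has_derivative_dotp])
  then have "frechet_derivative (peval (linear_poly u ^ d)) (at x) v = of_nat d * dotp u v * dotp u x ^ (d - 1)"
    unfolding e by (simp add: frechet_derivative_at[symmetric])
  moreover have "peval (linear_poly u ^ d) x = dotp u x * dotp u x ^ (d - 1)" unfolding e by (simp add: d)
  ultimately show ?thesis using assms(1) by simp
qed

locale homogeneous_on_variety = proj_variety X for X :: "(complex ^ 'n::finite) set set" +
  fixes F :: "'n cpoly" and d :: nat
  assumes hom: "homogeneous_poly d F" and d: "d \<ge> 1"
begin

lemma F_scale: "peval F (c *s x) = c ^ d * peval F x"
  by (rule homogeneous_scale[OF hom])

lemma F_zero: "peval F 0 = 0"
  using F_scale[of 0 0] d by (simp add: zero_power)

text \<open>
  Euler's identity, read off from \<open>F (x + s x) = (1 + s) ^ d F x\<close> at \<open>s = 0\<close>.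
\<close>

lemma F_euler: "frechet_derivative (peval F) (at x) x = of_nat d * peval F x"
proof -
  let ?q = "smult (peval F x) ([:1, 1:] ^ d)"
  have "peval F (x + s *s x) = poly ?q s" for s
  proof -
    have "x + s *s x = (1 + s) *s x" by (simp add: vec_eq_iff algebra_simps)
    then show ?thesis using F_scale[of "1 + s" x] by (simp add: poly_power)
  qed
  from vanishing_lineD[OF peval_polyfun this] show ?thesis
    by (simp add: pderiv_smult pderiv_power poly_power pderiv_pCons)
qed

lemma F_log_scale:
  assumes "c \<noteq> 0" "peval F x \<noteq> 0"
  shows "frechet_derivative (peval F) (at (c *s x)) v / peval F (c *s x) = frechet_derivative (peval F) (at x) v / peval F x / c"
proof -
  have "c * frechet_derivative (peval F) (at (c *s x)) v = frechet_derivative (\<lambda>y. peval F (c *s y)) (at x) v"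
    by (rule frechet_compose_scale(2)[OF peval_polyfun, symmetric])
  also have "\<dots> = frechet_derivative (\<lambda>y. c ^ d * peval F y) (at x) v" by (simp add: F_scale)
  also have "\<dots> = c ^ d * frechet_derivative (peval F) (at x) v"
    using frechet_mult_poly[OF alg_const[of "c ^ d"] peval_polyfun[of F], of x v] by simp
  finally have "c * frechet_derivative (peval F) (at (c *s x)) v = c ^ d * frechet_derivative (peval F) (at x) v" .
  then show ?thesis using assms by (simp add: F_scale field_simps)
qed

lemma cone_critical_crit:
  assumes "krull_dim C = enat r"
  shows "cone_critical_points F X u = crit C r (peval F) u"
  unfolding cone_critical_points_def crit_def smooth_locus_def dlog_def assms frechet_linear
  by (auto simp: field_simps)

lemma unit_rep_on_line:
  assumes L: "L \<in> X" and GH: "(G, H) \<in> unit_reps X F Q L" and x: "x \<in> L" "x \<noteq> 0"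
  shows "peval G x \<noteq> 0 \<and> peval H x \<noteq> 0"
proof -
  obtain e y where e: "homogeneous_poly e G" "homogeneous_poly e H" and y: "y \<in> L" "peval G y \<noteq> 0" "peval H y \<noteq> 0"
    using GH unfolding unit_reps_def by blast
  obtain c where "y = c *s x" using y(1) unfolding lineE[OF L x] span_singleton by blast
  then show ?thesis using y(2,3) homogeneous_scale[OF e(1)] homogeneous_scale[OF e(2)] by auto
qed

text \<open>
  From \<open>F H = u ^ d G\<close> with \<open>G\<close> and \<open>H\<close> nonzero at \<open>x\<close>, the functions \<open>F\<close> and \<open>u\<close> vanish at \<open>x\<close>
  together. If they do, \<open>u ^ d G\<close> vanishes on an irreducible component of the zero set of \<open>F\<close> through
  \<open>x\<close>, and since \<open>G\<close> does not vanish there, \<open>u\<close> does.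
\<close>

lemma unit_rep_nonzero:
  assumes Z: "{x \<in> C. peval F x = 0} = \<Union>\<Z>" "\<forall>Z\<in>\<Z>. zariski_irreducible Z"
    and u: "\<forall>Z\<in>\<Z>. Z \<subseteq> {0} \<or> (\<exists>z\<in>Z. dotp u z \<noteq> 0)"
    and L: "L \<in> X" and GH: "(G, H) \<in> unit_reps X F (linear_poly u ^ d) L" and x: "x \<in> L" "x \<noteq> 0"
  shows "peval F x \<noteq> 0 \<and> dotp u x \<noteq> 0"
proof -
  have eq: "peval F y * peval H y = dotp u y ^ d * peval G y" if "y \<in> C" for y
    using GH that unfolding unit_reps_def by (auto simp: peval_power peval_linear)
  have GHx: "peval G x \<noteq> 0" "peval H x \<noteq> 0" using unit_rep_on_line[OF L GH x] by auto
  have xC: "x \<in> C" using line_subset_cone[OF L] x(1) by blast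
  have Fx: "peval F x \<noteq> 0"
  proof
    assume "peval F x = 0"
    then obtain W where W: "W \<in> \<Z>" "x \<in> W" using Z(1) xC by blast
    have "(\<forall>y\<in>W. dotp u y ^ d = 0) \<or> (\<forall>y\<in>W. peval G y = 0)"
    proof (rule prime_onD[OF zariski_irreducible_prime_on])
      show "zariski_irreducible W" using W(1) Z(2) by blast
      show "(\<lambda>y. dotp u y ^ d) \<in> polyfuns" unfolding dotp_def by (intro alg_power alg_sum alg_mult alg_const polyfun_axis)
      show "peval G \<in> polyfuns" by (rule peval_polyfun)
      fix y assume "y \<in> W"
      then have "y \<in> C" "peval F y = 0" using W(1) Z(1) by blast+
      then show "dotp u y ^ d * peval G y = 0" using eq[of y] by simp
    qed
    then have "\<forall>y\<in>W. dotp u y = 0" using GHx(1) W(2) by auto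
    then have "W \<subseteq> {0}" using u W(1) by blast
    then show False using W(2) x(2) by blast
  qed
  have "dotp u x \<noteq> 0"
  proof
    assume "dotp u x = 0"
    then have "dotp u x ^ d = 0" using d by (cases d) auto
    then have "peval F x * peval H x = 0" using eq[OF xC] by simp
    then show False using Fx GHx(2) by simp
  qed
  then show ?thesis using Fx by blast
qed

lemma generically_not_vanishing_on:
  assumes "finite \<Z>"
  shows "generically (\<lambda>u. \<forall>Z\<in>\<Z>. Z \<subseteq> {0} \<or> (\<exists>z\<in>Z. dotp u z \<noteq> 0))"
  unfolding generically_generic_on
proof (rule generic_on_ball[OF prime_on_UNIV assms])
  fix Z assume "Z \<in> \<Z>"
  show "generic_on axes UNIV (\<lambda>u. Z \<subseteq> {0} \<or> (\<exists>z\<in>Z. dotp u z \<noteq> 0))"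
  proof (cases "Z \<subseteq> {0}")
    case True
    then show ?thesis by (intro generic_on_always[OF prime_on_UNIV]) simp
  next
    case False
    then obtain z where z0: "z \<in> Z" "z \<noteq> 0" by blast
    then obtain i where "z $ i \<noteq> 0" by (auto simp: vec_eq_iff)
    with z0 have z: "z \<in> Z" "z $ i \<noteq> 0" by auto
    have "(\<lambda>u. dotp u z) \<in> polyfuns" unfolding dotp_def by (intro alg_sum alg_mult alg_const polyfun_axis)
    moreover have "dotp (axis i 1) z = z $ i"
    proof -
      have "dotp (axis i 1) z = (\<Sum>k\<in>UNIV. if k = i then z $ i else 0)"
        unfolding dotp_def by (intro sum.cong) (auto simp: axis_def)
      then show ?thesis by simp
    qed
    ultimately show ?thesis unfolding generic_on_def using z
      by (intro bexI[of _ "\<lambda>u. dotp u z"]) (auto intro!: exI[of _ "axis i 1"])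
  qed
qed

lemma crit_dotp:
  assumes "x \<in> crit C r (peval F) u" shows "x \<in> C" "peval F x \<noteq> 0" "x \<noteq> 0" "dotp u x = of_nat d"
proof -
  show xC: "x \<in> C" and Fx: "peval F x \<noteq> 0" using assms by (auto simp: crit_def)
  show "x \<noteq> 0" using Fx F_zero by auto
  have "frechet_derivative (peval F) (at x) x = peval F x * dotp u x"
    using assms euler_tangent[OF xC] by (simp add: crit_def)
  then show "dotp u x = of_nat d" using Fx by (simp add: F_euler)
qed

text \<open>
  Passing from \<open>x\<close> to its multiple \<open>c x\<close> in a chart divides \<open>dF / F\<close> by \<open>c\<close>, and \<open>d du / u\<close> at \<open>c x\<close> is
  \<open>du / c\<close> because \<open>u(x) = d\<close>.
\<close>

lemma span_crit_log_critical:
  assumes r: "krull_dim C = enat r" and x: "x \<in> crit C r (peval F) u"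
  shows "vec.span {x} \<in> log_critical_points X F (linear_poly u ^ d)"
proof -
  let ?Q = "linear_poly u ^ d" and ?L = "vec.span {x}"
  note x' = crit_dotp[OF x]
  have LX: "?L \<in> X" using cone_iff[OF x'(3)] x'(1) by simp
  obtain i where i: "x $ i \<noteq> 0" using x'(3) by (auto simp: vec_eq_iff)
  define c where "c = 1 / x $ i"
  have c: "c \<noteq> 0" using i by (simp add: c_def)
  let ?y = "c *s x"
  have y: "?y \<in> affine_chart X i" unfolding c_def by (rule chart_scale[OF x'(1) i])
  have yL: "?y \<in> ?L" unfolding span_singleton by blast
  have Fy: "peval F ?y \<noteq> 0" using x'(2) c by (simp add: F_scale)
  have uy: "dotp u ?y = c * of_nat d" using x'(4) by (simp add: dotp_scale_right)
  have uy0: "dotp u ?y \<noteq> 0" using uy c d by simp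
  have Qy: "peval ?Q ?y \<noteq> 0" using uy0 by (simp add: peval_power peval_linear)
  have rep: "(F, ?Q) \<in> unit_reps X F ?Q ?L"
    unfolding unit_reps_def using hom homogeneous_linear_power[of d u] Fy Qy yL by auto
  have "x \<in> smooth_locus C" using x r by (simp add: crit_def smooth_locus_def)
  then have "?y \<in> smooth_locus (affine_chart X i)" using smooth_chart[OF y] smooth_cone_scale[OF c] by simp
  then have "?L \<in> proj_smooth_locus X" unfolding proj_smooth_locus_def using LX yL by blast
  moreover have "?L \<notin> div_support X F ?Q" unfolding div_support_def using rep by blast
  moreover have "dlog (\<lambda>y. peval F y / peval ?Q y) ?y v = 0" if v: "v \<in> tangent_space (affine_chart X i) ?y" for v
  proof -
    have "v \<in> tangent_space C x" using v tangent_cone_scale[OF c, of x] unfolding tangent_chart[OF y] by simp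
    then have "frechet_derivative (peval F) (at x) v = peval F x * dotp u v" using x by (simp add: crit_def)
    then have "frechet_derivative (peval F) (at ?y) v / peval F ?y = dotp u v / c"
      using F_log_scale[OF c x'(2), of v] x'(2) by simp
    moreover have "frechet_derivative (peval ?Q) (at ?y) v / peval ?Q ?y = dotp u v / c"
      using dlog_linear_power[OF uy0 d] c d by (simp add: uy)
    ultimately show ?thesis
      by (simp add: dlog_quotient[where f = "peval F", OF peval_polyfun Fy peval_polyfun Qy])
  qed
  moreover have "?y $ i = 1" using chart_cone[OF y] by blast
  ultimately show ?thesis
    unfolding log_critical_points_def using rep yL by blast
qed

text \<open>
  On the tangent space of the chart, \<open>dlog (G / H)\<close> is \<open>dlog (F / u ^ d)\<close>, since \<open>F H - u ^ d G\<close>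
  vanishes on the chart. The equation \<open>dF / F = d du / u\<close> obtained there extends to the tangent space
  of the cone by Euler's identity, and the multiple of \<open>y\<close> with \<open>u = d\<close> is the critical point.
\<close>

lemma log_critical_span_crit:
  assumes r: "krull_dim C = enat r"
    and nz: "\<And>L G H x. L \<in> X \<Longrightarrow> (G, H) \<in> unit_reps X F (linear_poly u ^ d) L \<Longrightarrow> x \<in> L \<Longrightarrow> x \<noteq> 0 \<Longrightarrow>
       peval F x \<noteq> 0 \<and> dotp u x \<noteq> 0"
    and L: "L \<in> log_critical_points X F (linear_poly u ^ d)"
  shows "\<exists>x\<in>crit C r (peval F) u. L = vec.span {x}"
proof -
  let ?Q = "linear_poly u ^ d"
  obtain i y G H where sm: "L \<in> proj_smooth_locus X" and yL: "y \<in> L" and GH: "(G, H) \<in> unit_reps X F ?Q L"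
    and yi: "y $ i = 1" and crt: "\<forall>v\<in>tangent_space (affine_chart X i) y. dlog (\<lambda>z. peval G z / peval H z) y v = 0"
    using L unfolding log_critical_points_def by blast
  have LX: "L \<in> X" using sm unfolding proj_smooth_locus_def by blast
  have y0: "y \<noteq> 0" using yi by auto
  have Fy: "peval F y \<noteq> 0" and uy: "dotp u y \<noteq> 0" using nz[OF LX GH yL y0] by auto
  have GHy: "peval G y \<noteq> 0" "peval H y \<noteq> 0" using unit_rep_on_line[OF LX GH yL y0] by auto
  have Qy: "peval ?Q y \<noteq> 0" using uy by (simp add: peval_power peval_linear)
  have yC: "y \<in> C" using line_subset_cone[OF LX] yL by blast
  have ych: "y \<in> affine_chart X i" using yC yi by (simp add: affine_chart_def)
  have val: "peval F z * peval H z = peval ?Q z * peval G z" if "z \<in> C" for z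
    using GH that unfolding unit_reps_def by blast
  have chart: "frechet_derivative (peval F) (at y) v / peval F y = of_nat d * dotp u v / dotp u y"
    if v: "v \<in> tangent_space (affine_chart X i) y" for v
  proof -
    let ?D = "\<lambda>p. frechet_derivative (peval p) (at y) v"
    have "(\<lambda>z. peval F z * peval H z + (- 1) * (peval ?Q z * peval G z)) \<in> polyfuns"
      by (intro alg_add alg_mult peval_polyfun alg_const)
    moreover have "peval F z * peval H z + (- 1) * (peval ?Q z * peval G z) = 0" if "z \<in> affine_chart X i" for z
      using val chart_cone[OF that] by simp
    ultimately have "(\<lambda>z. peval F z * peval H z + (- 1) * (peval ?Q z * peval G z)) \<in> vanishing (affine_chart X i)"
      unfolding vanishing_def by blast
    then have "0 = frechet_derivative (\<lambda>z. peval F z * peval H z + (- 1) * (peval ?Q z * peval G z)) (at y) v"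
      using v unfolding tangent_space_vanishing by auto
    also have "\<dots> = frechet_derivative (\<lambda>z. peval F z * peval H z) (at y) v +
        frechet_derivative (\<lambda>z. (- 1) * (peval ?Q z * peval G z)) (at y) v"
      by (rule frechet_sum_poly) (intro alg_mult peval_polyfun alg_const)+
    also have "frechet_derivative (\<lambda>z. (- 1) * (peval ?Q z * peval G z)) (at y) v =
        (- 1) * frechet_derivative (\<lambda>z. peval ?Q z * peval G z) (at y) v"
      using frechet_mult_poly[OF alg_const[of "- 1"] alg_mult[OF peval_polyfun[of ?Q] peval_polyfun[of G]], of y v] by simp
    also have "frechet_derivative (\<lambda>z. peval ?Q z * peval G z) (at y) v = peval ?Q y * ?D G + ?D ?Q * peval G y"
      by (rule frechet_mult_poly[OF peval_polyfun peval_polyfun])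
    also have "frechet_derivative (\<lambda>z. peval F z * peval H z) (at y) v = peval F y * ?D H + ?D F * peval H y"
      by (rule frechet_mult_poly[OF peval_polyfun peval_polyfun])
    finally have "peval F y * ?D H + ?D F * peval H y = peval ?Q y * ?D G + ?D ?Q * peval G y" by algebra
    then have "(peval F y * ?D H + ?D F * peval H y) / (peval F y * peval H y) =
        (peval ?Q y * ?D G + ?D ?Q * peval G y) / (peval ?Q y * peval G y)" using val[OF yC] by simp
    then have "?D H / peval H y + ?D F / peval F y = ?D G / peval G y + ?D ?Q / peval ?Q y"
      using Fy GHy Qy by (simp add: add_divide_distrib)
    moreover have "?D G / peval G y - ?D H / peval H y = 0"
      using crt v by (simp add: dlog_quotient[where f = "peval G", OF peval_polyfun GHy(1) peval_polyfun GHy(2)])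
    ultimately have "?D F / peval F y = ?D ?Q / peval ?Q y" by (simp add: algebra_simps)
    then show ?thesis using dlog_linear_power[OF uy d] by simp
  qed
  have cone: "frechet_derivative (peval F) (at y) w / peval F y = of_nat d * dotp u w / dotp u y"
    if w: "w \<in> tangent_space C y" for w
  proof -
    let ?v = "w - w $ i *s y"
    have "frechet_derivative (peval F) (at y) w = frechet_derivative (peval F) (at y) (?v + w $ i *s y)" by simp
    also have "\<dots> = frechet_derivative (peval F) (at y) ?v + w $ i * (of_nat d * peval F y)"
      by (simp only: frechet_add[OF peval_polyfun] frechet_scale[OF peval_polyfun] F_euler)
    finally have "frechet_derivative (peval F) (at y) w / peval F y =
        frechet_derivative (peval F) (at y) ?v / peval F y + w $ i * of_nat d"
      using Fy by (simp add: add_divide_distrib)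
    also have "\<dots> = of_nat d * dotp u ?v / dotp u y + w $ i * of_nat d"
      using chart[OF tangent_cone_decompose[OF ych w]] by simp
    also have "\<dots> = of_nat d * dotp u w / dotp u y"
      using uy by (simp add: dotp_diff_right dotp_scale_right field_simps)
    finally show ?thesis .
  qed
  define c where "c = of_nat d / dotp u y"
  have c: "c \<noteq> 0" using d uy by (simp add: c_def)
  have "c *s y \<in> crit C r (peval F) u" unfolding crit_def
  proof (intro CollectI conjI ballI)
    show "c *s y \<in> C" by (rule cone_scale[OF yC])
    obtain k z where z: "z \<in> L" "z \<in> smooth_locus (affine_chart X k)"
      using sm unfolding proj_smooth_locus_def by blast
    have zch: "z \<in> affine_chart X k" using z(2) by (simp add: smooth_locus_def)
    then have z0: "z \<noteq> 0" using chart_cone by fastforce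
    have "z \<in> smooth_locus C" using smooth_chart[OF zch] z(2) by simp
    moreover obtain b where b: "c *s y = b *s z"
    proof -
      have "y \<in> vec.span {z}" using lineE[OF LX z(1) z0] yL by simp
      then obtain b' where "y = b' *s z" unfolding span_singleton by blast
      then show ?thesis using that[of "c * b'"] by (simp add: vec_eq_iff)
    qed
    moreover have "b \<noteq> 0"
    proof
      assume "b = 0"
      then have "c *s y = 0" using b by simp
      then show False using c y0 by simp
    qed
    ultimately have "c *s y \<in> smooth_locus C" using smooth_cone_scale by metis
    then show "vec.dim (tangent_space C (c *s y)) = r" using r by (simp add: smooth_locus_def)
    show Fcy: "peval F (c *s y) \<noteq> 0" using Fy c by (simp add: F_scale)
    fix w assume "w \<in> tangent_space C (c *s y)"
    then have "w \<in> tangent_space C y" using tangent_cone_scale[OF c] by simp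
    then have "frechet_derivative (peval F) (at (c *s y)) w / peval F (c *s y) = of_nat d * dotp u w / dotp u y / c"
      unfolding F_log_scale[OF c Fy] by (simp only: cone)
    also have "\<dots> = dotp u w" using uy d by (simp add: c_def)
    finally show "frechet_derivative (peval F) (at (c *s y)) w = peval F (c *s y) * dotp u w"
      using Fcy by (simp add: field_simps)
  qed
  moreover have "L = vec.span {c *s y}" unfolding span_singleton_scale[OF c] by (rule lineE[OF LX yL y0])
  ultimately show ?thesis by blast
qed

lemma inj_on_span_crit: "inj_on (\<lambda>x. vec.span {x}) (crit C r (peval F) u)"
proof (rule inj_onI)
  fix x y assume x: "x \<in> crit C r (peval F) u" and y: "y \<in> crit C r (peval F) u" and e: "vec.span {x} = vec.span {y}"
  have "y \<in> vec.span {x}" unfolding e by (rule vec.span_base) simp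
  then obtain c where c: "y = c *s x" unfolding span_singleton by blast
  have "of_nat d = c * (of_nat d :: complex)"
    using crit_dotp(4)[OF x] crit_dotp(4)[OF y] by (simp add: c dotp_scale_right)
  then have "c = 1" using d by simp
  then show "x = y" using c by simp
qed

theorem generic_log_critical_count:
  "generically (\<lambda>u. finite (log_critical_points X F (linear_poly u ^ d)) \<and>
     card (log_critical_points X F (linear_poly u ^ d)) = MLD F X)"
proof -
  have "generic_on axes C (\<lambda>x. enat (vec.dim (tangent_space C x)) = krull_dim C)"
    by (rule krull_dim_generic_tangent_dim[OF zariski_closed_cone zariski_irreducible_cone])
  from generic_on_ex[OF this] obtain x where "enat (vec.dim (tangent_space C x)) = krull_dim C" by blast
  then obtain r where r: "krull_dim C = enat r" by metis
  obtain N where "generically (\<lambda>u. finite (crit C r (peval F) u) \<and> card (crit C r (peval F) u) = N)"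
    using generic_card_crit[OF zariski_closed_cone peval_polyfun] by blast
  then have N: "generically (\<lambda>u. finite (cone_critical_points F X u) \<and> card (cone_critical_points F X u) = N)"
    by (simp add: cone_critical_crit[OF r])
  have MLD: "MLD F X = N" unfolding MLD_def
  proof (rule the_equality)
    show "generically (\<lambda>u. finite (cone_critical_points F X u) \<and> card (cone_critical_points F X u) = N)" by (rule N)
    fix M assume "generically (\<lambda>u. finite (cone_critical_points F X u) \<and> card (cone_critical_points F X u) = M)"
    from generically_ex[OF generically_conj[OF this N]] show "M = N" by auto
  qed
  have "zariski_closed (C \<inter> {x. peval F x = 0})"
    by (rule zariski_closed_Int[OF zariski_closed_cone zariski_closed_zero[OF peval_polyfun]])
  from zariski_components[OF this] obtain \<Z> where Z: "finite \<Z>" "\<forall>Z\<in>\<Z>. zariski_closed Z \<and> zariski_irreducible Z"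
    "C \<inter> {x. peval F x = 0} = \<Union>\<Z>" by blast
  have Z': "{x \<in> C. peval F x = 0} = \<Union>\<Z>" using Z(3) by blast
  have Z2: "\<forall>Z\<in>\<Z>. zariski_irreducible Z" using Z(2) by blast
  from generically_conj[OF N generically_not_vanishing_on[OF Z(1)]] show ?thesis
  proof (rule generically_mono)
    fix u assume u: "(finite (cone_critical_points F X u) \<and> card (cone_critical_points F X u) = N) \<and>
        (\<forall>Z\<in>\<Z>. Z \<subseteq> {0} \<or> (\<exists>z\<in>Z. dotp u z \<noteq> 0))"
    let ?W = "crit C r (peval F) u" and ?P = "log_critical_points X F (linear_poly u ^ d)"
    have nz: "peval F x \<noteq> 0 \<and> dotp u x \<noteq> 0"
      if "L \<in> X" "(G, H) \<in> unit_reps X F (linear_poly u ^ d) L" "x \<in> L" "x \<noteq> 0" for L G H x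
      by (rule unit_rep_nonzero[OF Z' Z2 _ that]) (use u in blast)
    have "(\<lambda>x. vec.span {x}) ` ?W = ?P"
    proof
      show "(\<lambda>x. vec.span {x}) ` ?W \<subseteq> ?P" using span_crit_log_critical[OF r] by blast
      show "?P \<subseteq> (\<lambda>x. vec.span {x}) ` ?W"
      proof
        fix L assume "L \<in> ?P"
        have "\<exists>x\<in>?W. L = vec.span {x}" by (rule log_critical_span_crit[OF r _ \<open>L \<in> ?P\<close>]) (rule nz)
        then show "L \<in> (\<lambda>x. vec.span {x}) ` ?W" by blast
      qed
    qed
    then have "bij_betw (\<lambda>x. vec.span {x}) ?W ?P" unfolding bij_betw_def using inj_on_span_crit by blast
    then have "finite ?P \<longleftrightarrow> finite ?W" "card ?P = card ?W"
      using bij_betw_finite bij_betw_same_card by metis+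
    then show "finite ?P \<and> card ?P = MLD F X" using u unfolding MLD cone_critical_crit[OF r] by simp
  qed
qed

end

theorem theorem1p1:
  fixes X :: "(complex ^ 'n::finite) set set"
    and F :: "'n cpoly"
    and d :: nat
  assumes "proj_closed X"
    and "proj_irreducible X"
    and "homogeneous_poly d F"
    and "d \<ge> 1"
    and "\<exists>L\<in>X. \<exists>x\<in>L. peval F x \<noteq> 0"
  shows "generically (\<lambda>u.
    finite (log_critical_points X F (linear_poly u ^ d)) \<and>
    card (log_critical_points X F (linear_poly u ^ d)) = MLD F X)"
proof -
  interpret homogeneous_on_variety X F d
    by unfold_locales (use assms in auto)
  show ?thesis by (rule generic_log_critical_count)
qed

end
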